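(* Let $X$ and $X'$ be one-dimensional $kT$-modules such that the principal series $\mathrm{Irr}_k(G|(T,X))$ and $\mathrm{Irr}_k(G|(T,X'))$ are distinct, i.e. $\mathrm{Irr}_k(G|(T,X)) \neq \mathrm{Irr}_k(G|(T,X'))$. If $Y \in \mathrm{Irr}_k(G|(T,X))$ and $V \in \mathrm{Irr}_k(G|(T,X'))$, then $\mathrm{Ext}^1_{kG}(Y,V)=0$.
   Context: Let $q$ be a power of a prime $p$ and let $G$ be a finite group of Lie type over $\mathbb{F}_q$, i.e. $G=\mathbb{G}^F$ for a connected reductive algebraic group $\mathbb{G}$ over $\overline{\mathbb{F}}_p$ and a Steinberg endomorphism $F$. $G$ carries its standard split $BN$-pair of characteristic $p$: subgroups $B$ ("Borel subgroup") and $N$ with $T=B\cap N$ abelian ("maximal torus"), $B=U\rtimes T$ where $U$ is the largest normal $p$-subgroup of $B$, and $\bigcap_{n\in N} nBn^{-1}=T$. Let $k$ be an algebraically closed field of characteristic $r>0$ with $r\neq p$. All modules are left modules, finite-dimensional over $k$. $\mathrm{Irr}_k(G)$ denotes a full set of non-isomorphic irreducible $kG$-modules. For a $kT$-module $X$, let $\tilde X$ be its inflation to $B$ along $B\to B/U\cong T$, and let $R_T^G(X)=\mathrm{Ind}_B^G(\tilde X)$ (Harish-Chandra induction). For a one-dimensional (equivalently, irreducible) $kT$-module $X$, the principal series $\mathrm{Irr}_k(G|(T,X))$ is the set of $Y\in \mathrm{Irr}_k(G)$ such that $X$ is a composition factor of the $kT$-module $Y^U$ of $U$-fixed points; equivalently,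 the set of irreducible $kG$-modules occurring in the head (equivalently, the socle) of $R_T^G(X)$. *)

theory Defs
  imports
    "HOL-Algebra.AbelCoset"
    "HOL-Algebra.Elementary_Groups"
    "HOL-Algebra.Group_Action"
    "HOL-Algebra.Solvable_Groups"
    "Jordan_Normal_Form.VS_Connect"
begin

section \<open>Linear algebraic groups\<close>

text \<open>
  A linear algebraic group over the algebraically closed field \<open>'a\<close> is a Zariski closed subgroup
  of some \<open>GL\<^sub>n\<close>, where \<open>n\<close> is a natural number (so that it can be quantified over).  The regular
  functions on \<open>GL\<^sub>n\<close> are the polynomials in the matrix entries and \<open>1/det\<close>; since they are only
  ever evaluated, they are represented as functions.
\<close>

definition GL :: "nat \<Rightarrow> 'a::field mat monoid" where
  "GL n = units_of (ring_mat TYPE('a) n ())"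

inductive_set regular_functions :: "nat \<Rightarrow> ('a::field mat \<Rightarrow> 'a) set" for n :: nat where
  const: "(\<lambda>A. c) \<in> regular_functions n"
| entry: "i < n \<Longrightarrow> j < n \<Longrightarrow> (\<lambda>A. A $$ (i, j)) \<in> regular_functions n"
| inv_det: "(\<lambda>A. inverse (Determinant.det A)) \<in> regular_functions n"
| add: "f \<in> regular_functions n \<Longrightarrow> g \<in> regular_functions n \<Longrightarrow> (\<lambda>A. f A + g A) \<in> regular_functions n"
| mult: "f \<in> regular_functions n \<Longrightarrow> g \<in> regular_functions n \<Longrightarrow> (\<lambda>A. f A * g A) \<in> regular_functions n"

definition zariski_closed :: "nat \<Rightarrow> 'a::field mat set \<Rightarrow> bool" where
  "zariski_closed n S \<longleftrightarrow>
     (\<exists>E \<subseteq> regular_functions n. S = {A \<in> carrier (GL n). \<forall>f\<in>E. f A = 0})"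

text \<open>For closed \<open>S\<close>, the closed subsets of \<open>S\<close> are the closed subsets of \<open>GL\<^sub>n\<close> contained in \<open>S\<close>.\<close>

definition zariski_connected :: "nat \<Rightarrow> 'a::field mat set \<Rightarrow> bool" where
  "zariski_connected n S \<longleftrightarrow> S \<noteq> {} \<and>
     \<not> (\<exists>C D. zariski_closed n C \<and> zariski_closed n D \<and> C \<noteq> {} \<and> D \<noteq> {} \<and>
          C \<inter> D = {} \<and> C \<union> D = S)"

definition alg_group :: "nat \<Rightarrow> 'a::field mat set \<Rightarrow> bool" where
  "alg_group n H \<longleftrightarrow> subgroup H (GL n) \<and> zariski_closed n H"

definition connected_alg_group :: "nat \<Rightarrow> 'a::field mat set \<Rightarrow> bool" where
  "connected_alg_group n H \<longleftrightarrow> alg_group n H \<and> zariski_connected n H"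

definition alg_group_hom ::
  "nat \<Rightarrow> 'a::field mat set \<Rightarrow> nat \<Rightarrow> 'a mat set \<Rightarrow> ('a mat \<Rightarrow> 'a mat) \<Rightarrow> bool" where
  "alg_group_hom n H m K \<phi> \<longleftrightarrow>
     \<phi> \<in> hom (GL n\<lparr>carrier := H\<rparr>) (GL m\<lparr>carrier := K\<rparr>) \<and>
     (\<forall>i<m. \<forall>j<m. \<exists>f\<in>regular_functions n. \<forall>A\<in>H. \<phi> A $$ (i, j) = f A)"

definition alg_group_iso ::
  "nat \<Rightarrow> 'a::field mat set \<Rightarrow> nat \<Rightarrow> 'a mat set \<Rightarrow> ('a mat \<Rightarrow> 'a mat) \<Rightarrow> bool" where
  "alg_group_iso n H m K \<phi> \<longleftrightarrow>
     alg_group_hom n H m K \<phi> \<and> bij_betw \<phi> H K \<and> alg_group_hom m K n H (inv_into H \<phi>)"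

definition unipotent :: "nat \<Rightarrow> 'a::field mat set \<Rightarrow> bool" where
  "unipotent n H \<longleftrightarrow> (\<forall>A\<in>H. \<exists>l. (A - 1\<^sub>m n) ^\<^sub>m l = 0\<^sub>m n n)"

definition connected_reductive :: "nat \<Rightarrow> 'a::field mat set \<Rightarrow> bool" where
  "connected_reductive n H \<longleftrightarrow> connected_alg_group n H \<and>
     (\<forall>V. connected_alg_group n V \<and> V \<lhd> (GL n\<lparr>carrier := H\<rparr>) \<and> unipotent n V
        \<longrightarrow> V = {1\<^sub>m n})"

definition diagonal_group :: "nat \<Rightarrow> 'a::field mat set" where
  "diagonal_group m = {A \<in> carrier (GL m). diagonal_mat A}"

definition torus :: "nat \<Rightarrow> 'a::field mat set \<Rightarrow> bool" where
  "torus n S \<longleftrightarrow> alg_group n S \<and> (\<exists>m \<phi>. alg_group_iso n S m (diagonal_group m) \<phi>)"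

definition maximal_torus :: "nat \<Rightarrow> 'a::field mat set \<Rightarrow> 'a mat set \<Rightarrow> bool" where
  "maximal_torus n H S \<longleftrightarrow> torus n S \<and> S \<subseteq> H \<and>
     (\<forall>S'. torus n S' \<and> S' \<subseteq> H \<and> S \<subseteq> S' \<longrightarrow> S' = S)"

definition borel_subgroup :: "nat \<Rightarrow> 'a::field mat set \<Rightarrow> 'a mat set \<Rightarrow> bool" where
  "borel_subgroup n H B \<longleftrightarrow>
     connected_alg_group n B \<and> solvable (GL n\<lparr>carrier := B\<rparr>) \<and> B \<subseteq> H \<and>
     (\<forall>B'. connected_alg_group n B' \<and> solvable (GL n\<lparr>carrier := B'\<rparr>) \<and> B' \<subseteq> H \<and> B \<subseteq> B'
        \<longrightarrow> B' = B)"

text \<open>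
  \<open>F\<close> is the Frobenius map of an \<open>\<F>\<^sub>q\<close>-structure on \<open>H\<close> if some closed embedding of \<open>H\<close> into a
  \<open>GL\<^sub>d\<close> turns it into the entrywise \<open>q\<close>-th power map.  A Steinberg endomorphism has a power that is
  such a Frobenius map.  For \<open>q\<close> a power of the characteristic \<open>p\<close>, replacing an exponent \<open>m\<close> by a
  multiple shows that the definition below is the usual one, with \<open>p ^ l\<close> in place of \<open>q ^ l\<close>;
  in particular, the Suzuki and Ree cases are included.
\<close>

definition frobenius_map :: "nat \<Rightarrow> nat \<Rightarrow> 'a::field mat set \<Rightarrow> ('a mat \<Rightarrow> 'a mat) \<Rightarrow> bool" where
  "frobenius_map q n H F \<longleftrightarrow>
     (\<exists>d K \<phi>. alg_group d K \<and> alg_group_iso n H d K \<phi> \<and>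
        (\<forall>A\<in>H. \<phi> (F A) = map_mat (\<lambda>x. x ^ q) (\<phi> A)))"

definition steinberg_endomorphism ::
  "nat \<Rightarrow> nat \<Rightarrow> 'a::field mat set \<Rightarrow> ('a mat \<Rightarrow> 'a mat) \<Rightarrow> bool" where
  "steinberg_endomorphism q n H F \<longleftrightarrow>
     alg_group_hom n H n H F \<and> (\<exists>m>0. \<exists>l>0. frobenius_map (q ^ l) n H (F ^^ m))"

definition fixed_points :: "('a \<Rightarrow> 'a) \<Rightarrow> 'a set \<Rightarrow> 'a set" where
  "fixed_points F S = {x \<in> S. F x = x}"

text \<open>
  The field \<open>'a\<close> is an algebraic closure of \<open>\<F>\<^sub>p\<close>; when \<open>CHAR('a) = p\<close> is prime, the prime field is
  the image of the natural numbers.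
\<close>

definition is_closure_of_prime_field :: "nat \<Rightarrow> 'a::alg_closed_field itself \<Rightarrow> bool" where
  "is_closure_of_prime_field p K \<longleftrightarrow> CHAR('a) = p \<and>
     (\<forall>x::'a. \<exists>P. P \<noteq> 0 \<and> (\<forall>i. Polynomial.coeff P i \<in> range of_nat) \<and> poly P x = 0)"


section \<open>Split BN-pairs of characteristic p\<close>

text \<open>
  The elements \<open>s\<close>, \<open>w\<close> of the Weyl group \<open>W = N/(B \<inter> N)\<close> are cosets of \<open>B \<inter> N\<close> in \<open>N\<close>, that is,
  subsets of \<open>G\<close>.  As \<open>B \<inter> N \<subseteq> B\<close>, products such as \<open>s B w\<close> can be formed as complex products.
\<close>

definition BN_pair :: "('g, 'm) monoid_scheme \<Rightarrow> 'g set \<Rightarrow> 'g set \<Rightarrow> bool" where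
  "BN_pair G B N \<longleftrightarrow>
     subgroup B G \<and> subgroup N G \<and> generate G (B \<union> N) = carrier G \<and>
     (B \<inter> N) \<lhd> (G\<lparr>carrier := N\<rparr>) \<and>
     (let W = G\<lparr>carrier := N\<rparr> Mod (B \<inter> N) in
      \<exists>S \<subseteq> carrier W.
        generate W S = carrier W \<and>
        (\<forall>s\<in>S. s \<noteq> \<one>\<^bsub>W\<^esub> \<and> s \<otimes>\<^bsub>W\<^esub> s = \<one>\<^bsub>W\<^esub>) \<and>
        (\<forall>s\<in>S. \<forall>w\<in>carrier W.
           s <#>\<^bsub>G\<^esub> B <#>\<^bsub>G\<^esub> w \<subseteq>
             (B <#>\<^bsub>G\<^esub> w <#>\<^bsub>G\<^esub> B) \<union> (B <#>\<^bsub>G\<^esub> (s \<otimes>\<^bsub>W\<^esub> w) <#>\<^bsub>G\<^esub> B)) \<and>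
        (\<forall>s\<in>S. s <#>\<^bsub>G\<^esub> B <#>\<^bsub>G\<^esub> s \<noteq> B))"

definition largest_normal_p_subgroup :: "nat \<Rightarrow> ('g, 'm) monoid_scheme \<Rightarrow> 'g set \<Rightarrow> bool" where
  "largest_normal_p_subgroup p H U \<longleftrightarrow>
     U \<lhd> H \<and> (\<exists>a. card U = p ^ a) \<and>
     (\<forall>V. V \<lhd> H \<and> (\<exists>a. card V = p ^ a) \<longrightarrow> V \<subseteq> U)"

definition split_BN_pair ::
  "nat \<Rightarrow> ('g, 'm) monoid_scheme \<Rightarrow> 'g set \<Rightarrow> 'g set \<Rightarrow> 'g set \<Rightarrow> 'g set \<Rightarrow> bool" where
  "split_BN_pair p G B N T U \<longleftrightarrow>
     group G \<and> finite (carrier G) \<and> BN_pair G B N \<and>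
     T = B \<inter> N \<and> comm_group (G\<lparr>carrier := T\<rparr>) \<and>
     largest_normal_p_subgroup p (G\<lparr>carrier := B\<rparr>) U \<and>
     U <#>\<^bsub>G\<^esub> T = B \<and> U \<inter> T = {\<one>\<^bsub>G\<^esub>} \<and>
     (\<Inter>n\<in>N. n <#\<^bsub>G\<^esub> B #>\<^bsub>G\<^esub> (inv\<^bsub>G\<^esub> n)) = T"


section \<open>Modules over a not necessarily commutative ring\<close>

text \<open>The library locale \<open>module\<close> is restricted to commutative rings.\<close>

locale left_module = R?: ring R + M?: abelian_group M
  for R :: "('r, 'c) ring_scheme" (structure) and M :: "('r, 'm, 'd) module_scheme" (structure) +
  assumes smult_closed:
      "\<lbrakk>a \<in> carrier R; x \<in> carrier M\<rbrakk> \<Longrightarrow> a \<odot>\<^bsub>M\<^esub> x \<in> carrier M"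
    and smult_l_distr:
      "\<lbrakk>a \<in> carrier R; b \<in> carrier R; x \<in> carrier M\<rbrakk> \<Longrightarrow>
       (a \<oplus> b) \<odot>\<^bsub>M\<^esub> x = a \<odot>\<^bsub>M\<^esub> x \<oplus>\<^bsub>M\<^esub> b \<odot>\<^bsub>M\<^esub> x"
    and smult_r_distr:
      "\<lbrakk>a \<in> carrier R; x \<in> carrier M; y \<in> carrier M\<rbrakk> \<Longrightarrow>
       a \<odot>\<^bsub>M\<^esub> (x \<oplus>\<^bsub>M\<^esub> y) = a \<odot>\<^bsub>M\<^esub> x \<oplus>\<^bsub>M\<^esub> a \<odot>\<^bsub>M\<^esub> y"
    and smult_assoc:
      "\<lbrakk>a \<in> carrier R; b \<in> carrier R; x \<in> carrier M\<rbrakk> \<Longrightarrow>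
       (a \<otimes> b) \<odot>\<^bsub>M\<^esub> x = a \<odot>\<^bsub>M\<^esub> (b \<odot>\<^bsub>M\<^esub> x)"
    and smult_one:
      "x \<in> carrier M \<Longrightarrow> \<one> \<odot>\<^bsub>M\<^esub> x = x"

definition left_hom ::
  "('r, 'c) ring_scheme \<Rightarrow> ('r, 'm, 'd) module_scheme \<Rightarrow> ('r, 'n, 'e) module_scheme \<Rightarrow> ('m \<Rightarrow> 'n) set" where
  "left_hom R M N =
     {f \<in> carrier M \<rightarrow>\<^sub>E carrier N.
        (\<forall>x\<in>carrier M. \<forall>y\<in>carrier M. f (x \<oplus>\<^bsub>M\<^esub> y) = f x \<oplus>\<^bsub>N\<^esub> f y) \<and>
        (\<forall>a\<in>carrier R. \<forall>x\<in>carrier M. f (a \<odot>\<^bsub>M\<^esub> x) = a \<odot>\<^bsub>N\<^esub> f x)}"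

definition left_iso ::
  "('r, 'c) ring_scheme \<Rightarrow> ('r, 'm, 'd) module_scheme \<Rightarrow> ('r, 'n, 'e) module_scheme \<Rightarrow> bool" where
  "left_iso R M N \<longleftrightarrow> (\<exists>f \<in> left_hom R M N. bij_betw f (carrier M) (carrier N))"

text \<open>
  The predicate \<open>Module.submodule\<close> of the library makes sense over any ring.  The components
  \<open>mult\<close> and \<open>one\<close> of module records are irrelevant.
\<close>

definition quotient_module :: "('r, 'm, 'd) module_scheme \<Rightarrow> 'm set \<Rightarrow> ('r, 'm set) module" where
  "quotient_module M S =
     \<lparr>carrier = a_rcosets\<^bsub>M\<^esub> S, mult = undefined, one = undefined,
      zero = S, add = (\<lambda>C D. C <+>\<^bsub>M\<^esub> D),
      smult = (\<lambda>a C. S <+>\<^bsub>M\<^esub> ((\<lambda>x. a \<odot>\<^bsub>M\<^esub> x) ` C))\<rparr>"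

definition irreducible_module :: "('r, 'c) ring_scheme \<Rightarrow> ('r, 'm, 'd) module_scheme \<Rightarrow> bool" where
  "irreducible_module R M \<longleftrightarrow>
     left_module R M \<and> carrier M \<noteq> {\<zero>\<^bsub>M\<^esub>} \<and>
     (\<forall>S. Module.submodule S R M \<longrightarrow> S = {\<zero>\<^bsub>M\<^esub>} \<or> S = carrier M)"

definition composition_series ::
  "('r, 'c) ring_scheme \<Rightarrow> ('r, 'm, 'd) module_scheme \<Rightarrow> nat \<Rightarrow> (nat \<Rightarrow> 'm set) \<Rightarrow> bool" where
  "composition_series R M l S \<longleftrightarrow>
     S 0 = {\<zero>\<^bsub>M\<^esub>} \<and> S l = carrier M \<and> (\<forall>i\<le>l. Module.submodule (S i) R M) \<and>
     (\<forall>i<l. S i \<subseteq> S (Suc i) \<and>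
        irreducible_module R (quotient_module (M\<lparr>carrier := S (Suc i)\<rparr>) (S i)))"

definition composition_factor ::
  "('r, 'c) ring_scheme \<Rightarrow> ('r, 'x, 'd) module_scheme \<Rightarrow> ('r, 'm, 'e) module_scheme \<Rightarrow> bool" where
  "composition_factor R X M \<longleftrightarrow>
     (\<exists>l S. composition_series R M l S \<and>
        (\<exists>i<l. left_iso R X (quotient_module (M\<lparr>carrier := S (Suc i)\<rparr>) (S i))))"


section \<open>The first extension group\<close>

text \<open>
  With the canonical free presentation \<open>0 \<longrightarrow> K \<longrightarrow> P \<longrightarrow> M \<longrightarrow> 0\<close>, in which \<open>P\<close> is the free module
  on the underlying set of \<open>M\<close>, \<open>Ext\<^sup>1(M, N)\<close> is the cokernel of the restriction map
  \<open>Hom(P, N) \<longrightarrow> Hom(K, N)\<close>.  Any other projective presentation gives an isomorphic group.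
\<close>

definition free_cover ::
  "('r, 'c) ring_scheme \<Rightarrow> ('r, 'm, 'd) module_scheme \<Rightarrow> ('r, 'm \<Rightarrow> 'r) module" where
  "free_cover R M =
     \<lparr>carrier = {f. (\<forall>m\<in>carrier M. f m \<in> carrier R) \<and> (\<forall>m. m \<notin> carrier M \<longrightarrow> f m = \<zero>\<^bsub>R\<^esub>) \<and>
                    finite {m. f m \<noteq> \<zero>\<^bsub>R\<^esub>}},
      mult = undefined, one = undefined,
      zero = (\<lambda>m. \<zero>\<^bsub>R\<^esub>), add = (\<lambda>f g m. f m \<oplus>\<^bsub>R\<^esub> g m),
      smult = (\<lambda>a f m. a \<otimes>\<^bsub>R\<^esub> f m)\<rparr>"

definition free_cover_map ::
  "('r, 'c) ring_scheme \<Rightarrow> ('r, 'm, 'd) module_scheme \<Rightarrow> ('m \<Rightarrow> 'r) \<Rightarrow> 'm" where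
  "free_cover_map R M f = finsum M (\<lambda>m. f m \<odot>\<^bsub>M\<^esub> m) {m. f m \<noteq> \<zero>\<^bsub>R\<^esub>}"

definition free_cover_kernel ::
  "('r, 'c) ring_scheme \<Rightarrow> ('r, 'm, 'd) module_scheme \<Rightarrow> ('r, 'm \<Rightarrow> 'r) module" where
  "free_cover_kernel R M =
     (free_cover R M)\<lparr>carrier := {f \<in> carrier (free_cover R M). free_cover_map R M f = \<zero>\<^bsub>M\<^esub>}\<rparr>"

definition hom_group ::
  "('r, 'c) ring_scheme \<Rightarrow> ('r, 'm, 'd) module_scheme \<Rightarrow> ('r, 'n, 'e) module_scheme \<Rightarrow> ('m \<Rightarrow> 'n) monoid" where
  "hom_group R M N =
     \<lparr>carrier = left_hom R M N,
      mult = (\<lambda>f g. \<lambda>x\<in>carrier M. f x \<oplus>\<^bsub>N\<^esub> g x),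
      one = (\<lambda>x\<in>carrier M. \<zero>\<^bsub>N\<^esub>)\<rparr>"

definition Ext1 ::
  "('r, 'c) ring_scheme \<Rightarrow> ('r, 'm, 'd) module_scheme \<Rightarrow> ('r, 'n, 'e) module_scheme \<Rightarrow>
   (('m \<Rightarrow> 'r) \<Rightarrow> 'n) set monoid" where
  "Ext1 R M N =
     hom_group R (free_cover_kernel R M) N Mod
       ((\<lambda>h. restrict h (carrier (free_cover_kernel R M))) ` left_hom R (free_cover R M) N)"


section \<open>Modules for group algebras of finite groups\<close>

text \<open>
  Elements of \<open>kG\<close> are functions vanishing outside \<open>G\<close>.  Hence, for a subgroup \<open>H\<close> of \<open>G\<close>, the
  algebra \<open>kH\<close> is literally a subring of \<open>kG\<close>, and a \<open>kG\<close>-module, restricted to \<open>H\<close>, is the same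
  record regarded as a \<open>kH\<close>-module.
\<close>

definition group_algebra :: "('g, 'c) monoid_scheme \<Rightarrow> ('g \<Rightarrow> 'k::field) ring" where
  "group_algebra G =
     \<lparr>carrier = {a. \<forall>x. x \<notin> carrier G \<longrightarrow> a x = 0},
      mult = (\<lambda>a b x. if x \<in> carrier G then \<Sum>y\<in>carrier G. a y * b (inv\<^bsub>G\<^esub> y \<otimes>\<^bsub>G\<^esub> x) else 0),
      one = (\<lambda>x. if x = \<one>\<^bsub>G\<^esub> then 1 else 0),
      zero = (\<lambda>x. 0),
      add = (\<lambda>a b x. a x + b x)\<rparr>"

definition group_elem :: "'g \<Rightarrow> 'g \<Rightarrow> 'k::field" where
  "group_elem g = (\<lambda>x. if x = g then 1 else 0)"

definition underlying_space ::
  "('g, 'c) monoid_scheme \<Rightarrow> ('g \<Rightarrow> 'k::field, 'm, 'd) module_scheme \<Rightarrow> ('k, 'm) module" where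
  "underlying_space G M =
     \<lparr>carrier = carrier M, mult = undefined, one = undefined, zero = \<zero>\<^bsub>M\<^esub>, add = add M,
      smult = (\<lambda>c x. (\<lambda>g. c * group_elem \<one>\<^bsub>G\<^esub> g) \<odot>\<^bsub>M\<^esub> x)\<rparr>"

definition kG_module ::
  "('g, 'c) monoid_scheme \<Rightarrow> ('g \<Rightarrow> 'k::field, 'm, 'd) module_scheme \<Rightarrow> bool" where
  "kG_module G M \<longleftrightarrow> left_module (group_algebra G) M \<and>
     vectorspace.fin_dim class_ring (underlying_space G M)"

definition one_dimensional ::
  "('g, 'c) monoid_scheme \<Rightarrow> ('g \<Rightarrow> 'k::field, 'm, 'd) module_scheme \<Rightarrow> bool" where
  "one_dimensional G M \<longleftrightarrow> kG_module G M \<and>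
     vectorspace.dim class_ring (underlying_space G M) = 1"

text \<open>
  A full set of pairwise non-isomorphic irreducible \<open>kG\<close>-modules.  Each \<open>k\<^sup>d\<close> is contained in
  \<open>'k vec\<close>, so every finite-dimensional module is isomorphic to one with a carrier in that type.
\<close>

definition full_set_of_irreducibles ::
  "('g, 'c) monoid_scheme \<Rightarrow> ('g \<Rightarrow> 'k::field, 'k vec) module set \<Rightarrow> bool" where
  "full_set_of_irreducibles G Irr \<longleftrightarrow>
     (\<forall>Y\<in>Irr. kG_module G Y \<and> irreducible_module (group_algebra G) Y) \<and>
     (\<forall>Y\<in>Irr. \<forall>Z\<in>Irr. left_iso (group_algebra G) Y Z \<longrightarrow> Y = Z) \<and>
     (\<forall>M :: ('g \<Rightarrow> 'k, 'k vec) module.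
        kG_module G M \<and> irreducible_module (group_algebra G) M \<longrightarrow>
        (\<exists>Y\<in>Irr. left_iso (group_algebra G) M Y))"

definition invariants ::
  "'g set \<Rightarrow> ('g \<Rightarrow> 'k::field, 'm, 'd) module_scheme \<Rightarrow> ('g \<Rightarrow> 'k, 'm, 'd) module_scheme" where
  "invariants U M = M\<lparr>carrier := {x \<in> carrier M. \<forall>u\<in>U. group_elem u \<odot>\<^bsub>M\<^esub> x = x}\<rparr>"

definition principal_series ::
  "('g, 'c) monoid_scheme \<Rightarrow> 'g set \<Rightarrow> 'g set \<Rightarrow> ('g \<Rightarrow> 'k::field, 'm, 'd) module_scheme set \<Rightarrow>
   ('g \<Rightarrow> 'k, 'x, 'e) module_scheme \<Rightarrow> ('g \<Rightarrow> 'k, 'm, 'd) module_scheme set" where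
  "principal_series G T U Irr X =
     {Y \<in> Irr. composition_factor (group_algebra (G\<lparr>carrier := T\<rparr>)) X (invariants U Y)}"

end

theory Submission
  imports Defs "HOL-Algebra.Sylow" "HOL-Algebra.Multiplicative_Group"
begin

text \<open>
  If a ring \<open>R\<close> contains elements \<open>c\<close>, \<open>d\<close> with \<open>d R c = 0\<close>, and \<open>Y\<close>, \<open>V\<close> are irreducible
  modules with \<open>c Y \<noteq> 0\<close> and \<open>d V \<noteq> 0\<close>, then every extension of \<open>Y\<close> by \<open>V\<close> splits: the elements
  \<open>x\<close> with \<open>d R x = 0\<close> form a submodule that maps onto \<open>Y\<close> and does not contain \<open>V\<close>.

  For \<open>R = kG\<close>, one takes multiples of the idempotents of \<open>k[U T']\<close> belonging to the two characters
  of \<open>T\<close>, where \<open>T'\<close> is the \<open>r'\<close>-part of \<open>T\<close>.  By the Bruhat decomposition \<open>G = U N U\<close>, the condition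
  \<open>d R c = 0\<close> holds as soon as the characters are not conjugate under \<open>N\<close>; they are determined by
  their restrictions to \<open>T'\<close>, since \<open>k\<close> has no \<open>r\<close>-torsion.

  Conjugate characters have the same principal series.  Indeed, if \<open>n\<close> represents a simple
  reflection and \<open>e\<close> is the sum of the elements of \<open>U\<close>, then \<open>z \<mapsto> e n z\<close> is a bijection of \<open>Y\<^sup>U\<close>
  that twists the action of \<open>T\<close> by \<open>n\<close>.  Its bijectivity comes from the quadratic relation
  \<open>e n e n\<inverse> = a e + e n \<theta>\<close> on \<open>Y\<^sup>U\<close>, with \<open>\<theta> \<in> kT\<close> and \<open>a\<close> a power of \<open>p\<close>, hence
  invertible in \<open>k\<close>.
\<close>

section \<open>Modules and extensions\<close>

text \<open>The prime r may divide the order of T. Then Y^U need not be semisimple over kT, and a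
  composition factor of it is visible only as an eigenvector modulo a term of a composition series.
  This decides the form of many statements: averages over U and over U T' are computed modulo a
  subspace S, and the conclusion is that some vector lies in S. Taking S = 0, respectively S equal
  to an image, gives injectivity and surjectivity of z \<mapsto> e n z, without dimension counts and
  without writing out \<theta>.

  The number a is the order of the group of all v in U with n v n^-1 in B. Such v are conjugated
  into U itself because U is the largest normal p-subgroup of B: T then has no nontrivial
  p-elements, so all p-elements of B lie in U.

  Ext is computed from the free cover of Y, so splitting an extension takes the form of extending a
  homomorphism from the kernel of the cover to the whole cover.\<close>

lemma (in left_module) smult_r_null:
  assumes "a \<in> carrier R" shows "a \<odot>\<^bsub>M\<^esub> \<zero>\<^bsub>M\<^esub> = \<zero>\<^bsub>M\<^esub>"
proof -
  have "a \<odot>\<^bsub>M\<^esub> \<zero>\<^bsub>M\<^esub> \<oplus>\<^bsub>M\<^esub> a \<odot>\<^bsub>M\<^esub> \<zero>\<^bsub>M\<^esub> = a \<odot>\<^bsub>M\<^esub> \<zero>\<^bsub>M\<^esub>"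
    using smult_r_distr[OF assms, of "\<zero>\<^bsub>M\<^esub>" "\<zero>\<^bsub>M\<^esub>"] by simp
  then show ?thesis
    using smult_closed[OF assms M.zero_closed] M.add.l_cancel_one by simp
qed

lemma (in left_module) smult_l_null:
  assumes "x \<in> carrier M" shows "\<zero> \<odot>\<^bsub>M\<^esub> x = \<zero>\<^bsub>M\<^esub>"
proof -
  have "\<zero> \<odot>\<^bsub>M\<^esub> x \<oplus>\<^bsub>M\<^esub> \<zero> \<odot>\<^bsub>M\<^esub> x = \<zero> \<odot>\<^bsub>M\<^esub> x"
    using smult_l_distr[of "\<zero>" "\<zero>" x] assms by simp
  then show ?thesis
    using smult_closed[OF R.zero_closed assms] M.add.l_cancel_one by simp
qed

lemma (in left_module) smult_r_minus:
  assumes "a \<in> carrier R" "x \<in> carrier M" shows "a \<odot>\<^bsub>M\<^esub> (\<ominus>\<^bsub>M\<^esub> x) = \<ominus>\<^bsub>M\<^esub> (a \<odot>\<^bsub>M\<^esub> x)"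
proof -
  have "a \<odot>\<^bsub>M\<^esub> (\<ominus>\<^bsub>M\<^esub> x) \<oplus>\<^bsub>M\<^esub> a \<odot>\<^bsub>M\<^esub> x = \<zero>\<^bsub>M\<^esub>"
    using smult_r_distr[of a "\<ominus>\<^bsub>M\<^esub> x" x] assms by (simp add: M.l_neg smult_r_null)
  then show ?thesis
    using assms by (metis M.add.inv_closed M.minus_equality smult_closed)
qed

lemma (in left_module) smult_l_minus:
  assumes "a \<in> carrier R" "x \<in> carrier M" shows "(\<ominus> a) \<odot>\<^bsub>M\<^esub> x = \<ominus>\<^bsub>M\<^esub> (a \<odot>\<^bsub>M\<^esub> x)"
proof -
  have "(\<ominus> a) \<odot>\<^bsub>M\<^esub> x \<oplus>\<^bsub>M\<^esub> a \<odot>\<^bsub>M\<^esub> x = \<zero>\<^bsub>M\<^esub>"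
    using smult_l_distr[of "\<ominus> a" a x] assms by (simp add: R.l_neg smult_l_null)
  then show ?thesis
    using assms by (metis R.add.inv_closed M.minus_equality smult_closed)
qed

lemma (in left_module) smult_finsum:
  assumes "a \<in> carrier R" "finite A" "f \<in> A \<rightarrow> carrier M"
  shows "a \<odot>\<^bsub>M\<^esub> (finsum M f A) = finsum M (\<lambda>x. a \<odot>\<^bsub>M\<^esub> f x) A"
  using assms(2,3)
  by (induction A)
    (auto simp: smult_r_null assms(1) smult_r_distr smult_closed Pi_iff)

lemma (in left_module) submoduleI:
  assumes "S \<subseteq> carrier M" "\<zero>\<^bsub>M\<^esub> \<in> S"
    and "\<And>x y. x \<in> S \<Longrightarrow> y \<in> S \<Longrightarrow> x \<oplus>\<^bsub>M\<^esub> y \<in> S"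
    and smult: "\<And>a x. a \<in> carrier R \<Longrightarrow> x \<in> S \<Longrightarrow> a \<odot>\<^bsub>M\<^esub> x \<in> S"
  shows "Module.submodule S R M"
proof -
  have "\<ominus>\<^bsub>M\<^esub> x \<in> S" if "x \<in> S" for x
    using smult[of "\<ominus> \<one>" x] that assms(1) smult_l_minus[of \<one> x] smult_one by auto
  then show ?thesis
    using assms unfolding Module.submodule_def Module.submodule_axioms_def a_inv_def
    by (auto intro!: subgroup.intro)
qed

lemma submodule_closed:
  assumes "Module.submodule S R M"
  shows "S \<subseteq> carrier M" "\<zero>\<^bsub>M\<^esub> \<in> S" "x \<in> S \<Longrightarrow> y \<in> S \<Longrightarrow> x \<oplus>\<^bsub>M\<^esub> y \<in> S"
    "x \<in> S \<Longrightarrow> \<ominus>\<^bsub>M\<^esub> x \<in> S" "x \<in> S \<Longrightarrow> y \<in> S \<Longrightarrow> x \<ominus>\<^bsub>M\<^esub> y \<in> S"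
    "a \<in> carrier R \<Longrightarrow> x \<in> S \<Longrightarrow> a \<odot>\<^bsub>M\<^esub> x \<in> S"
proof -
  interpret Module.submodule S R M by (rule assms)
  show "S \<subseteq> carrier M" "\<zero>\<^bsub>M\<^esub> \<in> S" "x \<in> S \<Longrightarrow> y \<in> S \<Longrightarrow> x \<oplus>\<^bsub>M\<^esub> y \<in> S"
    "x \<in> S \<Longrightarrow> \<ominus>\<^bsub>M\<^esub> x \<in> S" "a \<in> carrier R \<Longrightarrow> x \<in> S \<Longrightarrow> a \<odot>\<^bsub>M\<^esub> x \<in> S"
    using subset one_closed m_closed m_inv_closed by (auto simp: a_inv_def)
  show "x \<in> S \<Longrightarrow> y \<in> S \<Longrightarrow> x \<ominus>\<^bsub>M\<^esub> y \<in> S"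
    using m_closed m_inv_closed by (auto simp: a_inv_def a_minus_def)
qed

section \<open>Module homomorphisms and their extension from a submodule\<close>

lemma left_homD:
  assumes "f \<in> left_hom R M N"
  shows "x \<in> carrier M \<Longrightarrow> f x \<in> carrier N"
    "x \<in> carrier M \<Longrightarrow> y \<in> carrier M \<Longrightarrow> f (x \<oplus>\<^bsub>M\<^esub> y) = f x \<oplus>\<^bsub>N\<^esub> f y"
    "a \<in> carrier R \<Longrightarrow> x \<in> carrier M \<Longrightarrow> f (a \<odot>\<^bsub>M\<^esub> x) = a \<odot>\<^bsub>N\<^esub> f x"
  using assms unfolding left_hom_def by auto

lemma left_hom_zero:
  assumes "left_module R M" "left_module R N" "f \<in> left_hom R M N"
  shows "f \<zero>\<^bsub>M\<^esub> = \<zero>\<^bsub>N\<^esub>"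
proof -
  interpret M: left_module R M by fact
  interpret N: left_module R N by fact
  show ?thesis
    using left_homD(3)[OF assms(3) M.R.zero_closed M.M.zero_closed]
    by (simp add: M.smult_r_null N.smult_l_null left_homD(1)[OF assms(3)])
qed

lemma left_module_submodule:
  assumes "left_module R M" "Module.submodule S R M"
  shows "left_module R (M\<lparr>carrier := S\<rparr>)"
proof -
  interpret M: left_module R M by fact
  note S = submodule_closed[OF assms(2)]
  have sub: "x \<in> carrier M" if "x \<in> S" for x using that S(1) by auto
  have "abelian_group (M\<lparr>carrier := S\<rparr>)"
  proof (rule abelian_groupI)
    fix x assume "x \<in> carrier (M\<lparr>carrier := S\<rparr>)"
    then show "\<exists>y\<in>carrier (M\<lparr>carrier := S\<rparr>). y \<oplus>\<^bsub>M\<lparr>carrier := S\<rparr>\<^esub> x = \<zero>\<^bsub>M\<lparr>carrier := S\<rparr>\<^esub>"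
      using S(4)[of x] sub M.M.l_neg by auto
  qed (use S sub in \<open>auto simp: M.M.a_ac\<close>)
  then show ?thesis
    unfolding left_module_def left_module_axioms_def using M.R.ring_axioms S
    by (auto simp: sub M.smult_l_distr M.smult_r_distr M.smult_assoc M.smult_one)
qed

text \<open>The map \<phi> on K and the zero map on Q fit together on P = K + Q because \<phi>
  vanishes on K \<inter> Q. The extension obtained is what makes a class in Ext trivial.\<close>

lemma left_hom_extend:
  assumes P: "left_module R P" and V: "left_module R V"
    and K: "Module.submodule K R P" and Q: "Module.submodule Q R P"
    and KQ: "\<And>x. x \<in> carrier P \<Longrightarrow> \<exists>k\<in>K. x \<ominus>\<^bsub>P\<^esub> k \<in> Q"
    and \<phi>: "\<phi> \<in> left_hom R (P\<lparr>carrier := K\<rparr>) V"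
    and van: "\<And>x. x \<in> K \<Longrightarrow> x \<in> Q \<Longrightarrow> \<phi> x = \<zero>\<^bsub>V\<^esub>"
  shows "\<exists>h\<in>left_hom R P V. restrict h K = \<phi>"
proof -
  interpret P: left_module R P by fact
  interpret V: left_module R V by fact
  note K' = submodule_closed[OF K] and Q' = submodule_closed[OF Q]
  note \<phi>' = left_homD[OF \<phi>, simplified]
  have Kc: "x \<in> carrier P" if "x \<in> K" for x using K'(1) that by auto
  have Qc: "x \<in> carrier P" if "x \<in> Q" for x using Q'(1) that by auto
  \<comment> \<open>Some K-component of x is chosen; \<open>wd\<close> shows that \<phi> takes the
    same value on all of them.\<close>
  define h where "h = (\<lambda>x\<in>carrier P. \<phi> (SOME k. k \<in> K \<and> x \<ominus>\<^bsub>P\<^esub> k \<in> Q))"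
  have wd: "\<phi> k = \<phi> l" if "k \<in> K" "l \<in> K" "k \<ominus>\<^bsub>P\<^esub> l \<in> Q" for k l
  proof -
    have "\<phi> ((k \<ominus>\<^bsub>P\<^esub> l) \<oplus>\<^bsub>P\<^esub> l) = \<phi> l"
      using that \<phi>' van K' by (simp add: V.M.l_zero)
    moreover have "(k \<ominus>\<^bsub>P\<^esub> l) \<oplus>\<^bsub>P\<^esub> l = k"
      using that Kc by (simp add: a_minus_def P.M.a_assoc P.M.l_neg)
    ultimately show ?thesis by simp
  qed
  have h_eq: "h (k \<oplus>\<^bsub>P\<^esub> q) = \<phi> k" if k: "k \<in> K" and q: "q \<in> Q" for k q
  proof -
    let ?x = "k \<oplus>\<^bsub>P\<^esub> q"
    have x: "?x \<in> carrier P" using k q Kc Qc by simp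
    define l where "l = (SOME k. k \<in> K \<and> ?x \<ominus>\<^bsub>P\<^esub> k \<in> Q)"
    have l: "l \<in> K" "?x \<ominus>\<^bsub>P\<^esub> l \<in> Q"
      using someI_ex[of "\<lambda>k. k \<in> K \<and> ?x \<ominus>\<^bsub>P\<^esub> k \<in> Q"] KQ[OF x] unfolding l_def by auto
    have "k \<ominus>\<^bsub>P\<^esub> l = (?x \<ominus>\<^bsub>P\<^esub> l) \<ominus>\<^bsub>P\<^esub> q"
      using k q l(1) Kc Qc P.M.a_lcomm[of q "\<ominus>\<^bsub>P\<^esub> l" "\<ominus>\<^bsub>P\<^esub> q"]
      by (simp add: a_minus_def P.M.a_assoc P.M.r_neg)
    then have "k \<ominus>\<^bsub>P\<^esub> l \<in> Q" using l q Q'(5) by simp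
    then show ?thesis using wd[OF k l(1)] x by (simp add: h_def l_def)
  qed
  have dec: "\<exists>k\<in>K. \<exists>q\<in>Q. x = k \<oplus>\<^bsub>P\<^esub> q" if x: "x \<in> carrier P" for x
  proof -
    obtain k where k: "k \<in> K" "x \<ominus>\<^bsub>P\<^esub> k \<in> Q" using KQ[OF x] by auto
    have "x = k \<oplus>\<^bsub>P\<^esub> (x \<ominus>\<^bsub>P\<^esub> k)"
      using x k(1) Kc P.M.a_lcomm[of k x "\<ominus>\<^bsub>P\<^esub> k"] by (simp add: a_minus_def P.M.r_neg)
    then show ?thesis using k by auto
  qed
  have "h \<in> left_hom R P V"
    unfolding left_hom_def
  proof (intro CollectI conjI ballI)
    show "h \<in> carrier P \<rightarrow>\<^sub>E carrier V"
    proof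
      fix x assume x: "x \<in> carrier P"
      show "h x \<in> carrier V" using dec[OF x] h_eq \<phi>'(1) by auto
    qed (simp add: h_def)
  next
    fix x y assume "x \<in> carrier P" "y \<in> carrier P"
    then obtain k q l s where *: "k \<in> K" "q \<in> Q" "l \<in> K" "s \<in> Q" "x = k \<oplus>\<^bsub>P\<^esub> q" "y = l \<oplus>\<^bsub>P\<^esub> s"
      using dec by metis
    have "x \<oplus>\<^bsub>P\<^esub> y = (k \<oplus>\<^bsub>P\<^esub> l) \<oplus>\<^bsub>P\<^esub> (q \<oplus>\<^bsub>P\<^esub> s)"
      using * Kc Qc by (simp add: P.M.a_ac)
    then show "h (x \<oplus>\<^bsub>P\<^esub> y) = h x \<oplus>\<^bsub>V\<^esub> h y"
      using * h_eq K'(3) Q'(3) \<phi>'(2) by simp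
  next
    fix a x assume a: "a \<in> carrier R" and "x \<in> carrier P"
    then obtain k q where *: "k \<in> K" "q \<in> Q" "x = k \<oplus>\<^bsub>P\<^esub> q"
      using dec by metis
    have "a \<odot>\<^bsub>P\<^esub> x = (a \<odot>\<^bsub>P\<^esub> k) \<oplus>\<^bsub>P\<^esub> (a \<odot>\<^bsub>P\<^esub> q)"
      using * a Kc Qc by (simp add: P.smult_r_distr)
    then show "h (a \<odot>\<^bsub>P\<^esub> x) = a \<odot>\<^bsub>V\<^esub> h x"
      using * a h_eq K'(6) Q'(6) \<phi>'(3) by simp
  qed
  moreover have "restrict h K = \<phi>"
  proof
    fix x show "restrict h K x = \<phi> x"
    proof (cases "x \<in> K")
      case True
      then show ?thesis using h_eq[OF True Q'(2)] Kc[OF True] by simp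
    next
      case False
      then show ?thesis using \<phi> by (auto simp: left_hom_def PiE_def extensional_def)
    qed
  qed
  ultimately show ?thesis by blast
qed

text \<open>This is the form in which Ext vanishes: once every homomorphism on the kernel of the
  cover extends, the subgroup factored out is the whole group.\<close>

lemma trivial_group_Mod_carrier:
  assumes "group G" shows "trivial_group (G Mod carrier G)"
proof -
  interpret group G by fact
  have "carrier G \<lhd> G" by (rule normal_invI) (auto intro: subgroup_self)
  then have "group (G Mod carrier G)" by (rule normal.factorgroup_is_group)
  moreover have "carrier (G Mod carrier G) = {carrier G}"
    using coset_join2[OF _ subgroup_self] by (auto simp: FactGroup_def RCOSETS_def)
  ultimately show ?thesis by (simp add: trivial_group_def FactGroup_def)
qed

lemma group_hom_group:
  assumes M: "left_module R M" and N: "left_module R N"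
  shows "group (hom_group R M N)"
proof -
  interpret M: left_module R M by fact
  interpret N: left_module R N by fact
  have M0: "\<zero>\<^bsub>M\<^esub> \<in> carrier M" by simp
  show ?thesis
  proof (rule groupI)
    fix f g assume "f \<in> carrier (hom_group R M N)" "g \<in> carrier (hom_group R M N)"
    then have fg: "f \<in> left_hom R M N" "g \<in> left_hom R M N" by (auto simp: hom_group_def)
    note f = left_homD[OF fg(1)] and g = left_homD[OF fg(2)]
    show "f \<otimes>\<^bsub>hom_group R M N\<^esub> g \<in> carrier (hom_group R M N)"
      by (auto simp: hom_group_def left_hom_def f g N.M.a_ac M.smult_closed N.smult_r_distr)
  next
    show "\<one>\<^bsub>hom_group R M N\<^esub> \<in> carrier (hom_group R M N)"
      by (auto simp: hom_group_def left_hom_def M.smult_closed N.smult_r_null)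
  next
    fix f g h assume "f \<in> carrier (hom_group R M N)" "g \<in> carrier (hom_group R M N)"
      "h \<in> carrier (hom_group R M N)"
    then have fg: "f \<in> left_hom R M N" "g \<in> left_hom R M N" "h \<in> left_hom R M N"
      by (auto simp: hom_group_def)
    then show "f \<otimes>\<^bsub>hom_group R M N\<^esub> g \<otimes>\<^bsub>hom_group R M N\<^esub> h =
        f \<otimes>\<^bsub>hom_group R M N\<^esub> (g \<otimes>\<^bsub>hom_group R M N\<^esub> h)"
      by (auto simp: hom_group_def left_homD(1) N.M.a_assoc)
  next
    fix f assume "f \<in> carrier (hom_group R M N)"
    then have fh: "f \<in> left_hom R M N" by (auto simp: hom_group_def)
    note f = left_homD[OF fh]
    show "\<one>\<^bsub>hom_group R M N\<^esub> \<otimes>\<^bsub>hom_group R M N\<^esub> f = f"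
      using fh by (auto simp: hom_group_def f left_hom_def PiE_def extensional_def)
    have "(\<lambda>x\<in>carrier M. \<ominus>\<^bsub>N\<^esub> f x) \<in> left_hom R M N"
      by (auto simp: left_hom_def f N.M.minus_add M.smult_closed N.smult_r_minus)
    moreover have "(\<lambda>x\<in>carrier M. \<ominus>\<^bsub>N\<^esub> f x) \<otimes>\<^bsub>hom_group R M N\<^esub> f = \<one>\<^bsub>hom_group R M N\<^esub>"
      by (auto simp: hom_group_def f N.M.l_neg)
    ultimately show "\<exists>g\<in>carrier (hom_group R M N). g \<otimes>\<^bsub>hom_group R M N\<^esub> f = \<one>\<^bsub>hom_group R M N\<^esub>"
      by (intro bexI) (simp_all add: hom_group_def)
  qed
qed

section \<open>The canonical free presentation of a module\<close>

context left_module
begin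

lemma free_cover_simps:
  "carrier (free_cover R M) = {f. (\<forall>m\<in>carrier M. f m \<in> carrier R) \<and>
     (\<forall>m. m \<notin> carrier M \<longrightarrow> f m = \<zero>) \<and> finite {m. f m \<noteq> \<zero>}}"
  "\<zero>\<^bsub>free_cover R M\<^esub> = (\<lambda>m. \<zero>)"
  "f \<oplus>\<^bsub>free_cover R M\<^esub> g = (\<lambda>m. f m \<oplus> g m)"
  "a \<odot>\<^bsub>free_cover R M\<^esub> f = (\<lambda>m. a \<otimes> f m)"
  by (simp_all add: free_cover_def)

lemma free_cover_in_carrier: "f \<in> carrier (free_cover R M) \<Longrightarrow> f m \<in> carrier R"
  by (cases "m \<in> carrier M") (auto simp: free_cover_simps)

lemma left_module_free_cover: "left_module R (free_cover R M)"
proof -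
  let ?P = "free_cover R M"
  note c = free_cover_in_carrier
  have add: "f \<oplus>\<^bsub>?P\<^esub> g \<in> carrier ?P" if f: "f \<in> carrier ?P" and g: "g \<in> carrier ?P" for f g
  proof -
    have "{m. f m \<oplus> g m \<noteq> \<zero>} \<subseteq> {m. f m \<noteq> \<zero>} \<union> {m. g m \<noteq> \<zero>}" by auto
    moreover have "finite ({m. f m \<noteq> \<zero>} \<union> {m. g m \<noteq> \<zero>})"
      using f g by (auto simp: free_cover_simps)
    ultimately show ?thesis
      using f g finite_subset by (auto simp: free_cover_simps)
  qed
  have smult: "a \<odot>\<^bsub>?P\<^esub> f \<in> carrier ?P" if a: "a \<in> carrier R" and f: "f \<in> carrier ?P" for a f
  proof -
    have "{m. a \<otimes> f m \<noteq> \<zero>} \<subseteq> {m. f m \<noteq> \<zero>}" using a by auto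
    then show ?thesis
      using f a finite_subset by (fastforce simp: free_cover_simps)
  qed
  have "abelian_group ?P"
  proof (rule abelian_groupI)
    fix f assume f: "f \<in> carrier ?P"
    have "(\<ominus> \<one>) \<odot>\<^bsub>?P\<^esub> f \<oplus>\<^bsub>?P\<^esub> f = \<zero>\<^bsub>?P\<^esub>"
      using c[OF f] by (auto simp: free_cover_simps R.l_minus R.l_neg)
    then show "\<exists>g\<in>carrier ?P. g \<oplus>\<^bsub>?P\<^esub> f = \<zero>\<^bsub>?P\<^esub>"
      using smult[OF _ f, of "\<ominus> \<one>"] by auto
  next
    show "\<zero>\<^bsub>?P\<^esub> \<in> carrier ?P" by (simp add: free_cover_simps)
  qed (auto simp: add, auto simp: free_cover_simps(2-) c R.a_ac)
  then show ?thesis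
    unfolding left_module_def left_module_axioms_def using R.ring_axioms
    by (auto simp: smult) (auto simp: free_cover_simps(2-) c R.l_distr R.r_distr R.m_assoc)
qed

text \<open>The defining sum runs over the support of f and so over a set that depends on f.
  Additivity needs one finite index set for two functions and their sum, hence the freedom to
  enlarge the support to A.\<close>

lemma free_cover_map_eq:
  assumes f: "f \<in> carrier (free_cover R M)"
    and A: "finite A" "A \<subseteq> carrier M" "{m. f m \<noteq> \<zero>} \<subseteq> A"
  shows "free_cover_map R M f = (\<Oplus>\<^bsub>M\<^esub>m\<in>A. f m \<odot>\<^bsub>M\<^esub> m)"
  unfolding free_cover_map_def
  by (rule M.add.finprod_mono_neutral_cong_left)
    (use A free_cover_in_carrier[OF f] in \<open>auto simp: smult_l_null smult_closed subset_iff\<close>)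

lemma free_cover_support:
  assumes "f \<in> carrier (free_cover R M)"
  shows "finite {m. f m \<noteq> \<zero>}" "{m. f m \<noteq> \<zero>} \<subseteq> carrier M"
  using assms by (auto simp: free_cover_simps)

lemma free_cover_map_left_hom:
  "restrict (free_cover_map R M) (carrier (free_cover R M)) \<in> left_hom R (free_cover R M) M"
proof -
  let ?P = "free_cover R M"
  interpret P: left_module R ?P by (rule left_module_free_cover)
  note c = free_cover_in_carrier and s = free_cover_support
  show ?thesis
    unfolding left_hom_def
  proof (intro CollectI conjI ballI)
    have "free_cover_map R M f \<in> carrier M" if f: "f \<in> carrier ?P" for f
      unfolding free_cover_map_def
      by (rule M.add.finprod_closed) (use c[OF f] s[OF f] in \<open>auto simp: smult_closed\<close>)
    then show "restrict (free_cover_map R M) (carrier ?P) \<in> carrier ?P \<rightarrow>\<^sub>E carrier M" by auto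
  next
    fix f g assume f: "f \<in> carrier ?P" and g: "g \<in> carrier ?P"
    let ?A = "{m. f m \<noteq> \<zero>} \<union> {m. g m \<noteq> \<zero>}"
    have A: "finite ?A" "?A \<subseteq> carrier M" using s[OF f] s[OF g] by auto
    have mem: "(\<lambda>m. f m \<odot>\<^bsub>M\<^esub> m) \<in> ?A \<rightarrow> carrier M" "(\<lambda>m. g m \<odot>\<^bsub>M\<^esub> m) \<in> ?A \<rightarrow> carrier M"
      using A c[OF f] c[OF g] by (auto simp: smult_closed subset_iff)
    have "free_cover_map R M (f \<oplus>\<^bsub>?P\<^esub> g) = (\<Oplus>\<^bsub>M\<^esub>m\<in>?A. (f m \<oplus> g m) \<odot>\<^bsub>M\<^esub> m)"
      by (subst free_cover_map_eq[OF P.M.a_closed[OF f g] A]) (auto simp: free_cover_simps(3))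
    also have "\<dots> = (\<Oplus>\<^bsub>M\<^esub>m\<in>?A. f m \<odot>\<^bsub>M\<^esub> m \<oplus>\<^bsub>M\<^esub> g m \<odot>\<^bsub>M\<^esub> m)"
      by (rule M.finsum_cong') (use A c[OF f] c[OF g] in \<open>auto simp: smult_closed smult_l_distr subset_iff\<close>)
    also have "\<dots> = (\<Oplus>\<^bsub>M\<^esub>m\<in>?A. f m \<odot>\<^bsub>M\<^esub> m) \<oplus>\<^bsub>M\<^esub> (\<Oplus>\<^bsub>M\<^esub>m\<in>?A. g m \<odot>\<^bsub>M\<^esub> m)"
      by (rule M.finsum_addf[OF mem])
    also have "\<dots> = free_cover_map R M f \<oplus>\<^bsub>M\<^esub> free_cover_map R M g"
      using free_cover_map_eq[OF f A] free_cover_map_eq[OF g A] by auto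
    finally show "restrict (free_cover_map R M) (carrier ?P) (f \<oplus>\<^bsub>?P\<^esub> g) =
        restrict (free_cover_map R M) (carrier ?P) f \<oplus>\<^bsub>M\<^esub> restrict (free_cover_map R M) (carrier ?P) g"
      using f g by simp
  next
    fix a f assume a: "a \<in> carrier R" and f: "f \<in> carrier ?P"
    let ?A = "{m. f m \<noteq> \<zero>}"
    note A = s[OF f]
    have "free_cover_map R M (a \<odot>\<^bsub>?P\<^esub> f) = (\<Oplus>\<^bsub>M\<^esub>m\<in>?A. (a \<otimes> f m) \<odot>\<^bsub>M\<^esub> m)"
      by (subst free_cover_map_eq[OF P.smult_closed[OF a f] A]) (use a in \<open>auto simp: free_cover_simps(4)\<close>)
    also have "\<dots> = (\<Oplus>\<^bsub>M\<^esub>m\<in>?A. a \<odot>\<^bsub>M\<^esub> (f m \<odot>\<^bsub>M\<^esub> m))"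
      by (rule M.finsum_cong') (use A a c[OF f] in \<open>auto simp: smult_closed smult_assoc subset_iff\<close>)
    also have "\<dots> = a \<odot>\<^bsub>M\<^esub> free_cover_map R M f"
      unfolding free_cover_map_def
      by (rule smult_finsum[symmetric]) (use A a c[OF f] in \<open>auto simp: smult_closed subset_iff\<close>)
    finally show "restrict (free_cover_map R M) (carrier ?P) (a \<odot>\<^bsub>?P\<^esub> f) =
        a \<odot>\<^bsub>M\<^esub> restrict (free_cover_map R M) (carrier ?P) f"
      using a f P.smult_closed by simp
  qed
qed

lemma free_cover_map_surj:
  assumes y: "y \<in> carrier M"
  shows "\<exists>f\<in>carrier (free_cover R M). free_cover_map R M f = y"
proof -
  let ?f = "\<lambda>m. if m = y then \<one> else \<zero>"
  have "{m. ?f m \<noteq> \<zero>} \<subseteq> {y}" by auto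
  then have f: "?f \<in> carrier (free_cover R M)"
    using y finite_subset by (force simp: free_cover_simps)
  have "free_cover_map R M ?f = (\<Oplus>\<^bsub>M\<^esub>m\<in>{y}. ?f m \<odot>\<^bsub>M\<^esub> m)"
    by (rule free_cover_map_eq[OF f]) (use y in auto)
  also have "\<dots> = y" using y by (simp add: smult_one smult_closed)
  finally show ?thesis using f by blast
qed

end

text \<open>The argument takes place in the free cover P. By \<open>dc\<close> the submodule Q
  contains c P, so its image in Y is nonzero and hence all of Y, which means P = K + Q. A
  homomorphism \<phi> from K to V sends K \<inter> Q to a submodule killed by d; as d does not kill
  V, this submodule is zero, and \<phi> extends to P by zero on Q.\<close>

theorem Ext1_trivialI:
  assumes Y: "irreducible_module R Y" and V: "irreducible_module R V"
    and c: "c \<in> carrier R" and d: "d \<in> carrier R"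
    and dc: "\<And>a. a \<in> carrier R \<Longrightarrow> d \<otimes>\<^bsub>R\<^esub> a \<otimes>\<^bsub>R\<^esub> c = \<zero>\<^bsub>R\<^esub>"
    and cY: "y \<in> carrier Y" "c \<odot>\<^bsub>Y\<^esub> y \<noteq> \<zero>\<^bsub>Y\<^esub>"
    and dV: "v \<in> carrier V" "d \<odot>\<^bsub>V\<^esub> v \<noteq> \<zero>\<^bsub>V\<^esub>"
  shows "trivial_group (Ext1 R Y V)"
proof -
  interpret Y: left_module R Y using Y by (simp add: irreducible_module_def)
  interpret V: left_module R V using V by (simp add: irreducible_module_def)
  let ?P = "free_cover R Y"
  interpret P: left_module R ?P by (rule Y.left_module_free_cover)
  define \<pi> where "\<pi> = restrict (free_cover_map R Y) (carrier ?P)"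
  have \<pi>h: "\<pi> \<in> left_hom R ?P Y" unfolding \<pi>_def by (rule Y.free_cover_map_left_hom)
  note \<pi> = left_homD[OF \<pi>h]
  have \<pi>0: "\<pi> \<zero>\<^bsub>?P\<^esub> = \<zero>\<^bsub>Y\<^esub>"
    by (rule left_hom_zero[OF P.left_module_axioms Y.left_module_axioms \<pi>h])
  have \<pi>_minus: "\<pi> (x \<ominus>\<^bsub>?P\<^esub> z) = \<pi> x \<ominus>\<^bsub>Y\<^esub> \<pi> z" if "x \<in> carrier ?P" "z \<in> carrier ?P" for x z
  proof -
    have "(\<ominus>\<^bsub>R\<^esub> \<one>\<^bsub>R\<^esub>) \<odot>\<^bsub>?P\<^esub> z = \<ominus>\<^bsub>?P\<^esub> z" "(\<ominus>\<^bsub>R\<^esub> \<one>\<^bsub>R\<^esub>) \<odot>\<^bsub>Y\<^esub> \<pi> z = \<ominus>\<^bsub>Y\<^esub> \<pi> z"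
      using that \<pi>(1) by (simp_all add: P.smult_l_minus P.smult_one Y.smult_l_minus Y.smult_one)
    then show ?thesis
      using \<pi>(2)[of x "\<ominus>\<^bsub>?P\<^esub> z"] \<pi>(3)[of "\<ominus>\<^bsub>R\<^esub> \<one>\<^bsub>R\<^esub>" z] that
      by (simp add: a_minus_def)
  qed
  define K where "K = {f \<in> carrier ?P. \<pi> f = \<zero>\<^bsub>Y\<^esub>}"
  have Kker: "free_cover_kernel R Y = ?P\<lparr>carrier := K\<rparr>"
    by (auto simp: free_cover_kernel_def K_def \<pi>_def intro!: arg_cong[where f = "\<lambda>S. ?P\<lparr>carrier := S\<rparr>"])
  have K: "Module.submodule K R ?P"
    by (rule P.submoduleI) (auto simp: K_def \<pi> \<pi>0 P.smult_closed Y.smult_r_null)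
  \<comment> \<open>Quantifying over all a makes Q stable under R; the annihilator of d alone need
    not be.\<close>
  define Q where "Q = {x \<in> carrier ?P. \<forall>a\<in>carrier R. d \<odot>\<^bsub>?P\<^esub> (a \<odot>\<^bsub>?P\<^esub> x) = \<zero>\<^bsub>?P\<^esub>}"
  have Q: "Module.submodule Q R ?P"
    by (rule P.submoduleI)
      (auto simp: Q_def d P.smult_closed P.smult_r_null P.smult_r_distr P.smult_assoc[symmetric])
  note Q' = submodule_closed[OF Q] and K' = submodule_closed[OF K]
  have cQ: "c \<odot>\<^bsub>?P\<^esub> x \<in> Q" if "x \<in> carrier ?P" for x
    using that c d dc
    by (simp add: Q_def P.smult_closed P.smult_assoc[symmetric] P.smult_l_null Y.R.m_assoc[symmetric])
  have "Module.submodule (\<pi> ` Q) R Y"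
  proof (rule Y.submoduleI)
    show "\<pi> ` Q \<subseteq> carrier Y" using Q'(1) \<pi>(1) by auto
    show "\<zero>\<^bsub>Y\<^esub> \<in> \<pi> ` Q" using \<pi>0 Q'(2) by force
  next
    fix x z assume "x \<in> \<pi> ` Q" "z \<in> \<pi> ` Q"
    then obtain x' z' where *: "x' \<in> Q" "z' \<in> Q" "x = \<pi> x'" "z = \<pi> z'" by auto
    then have "x \<oplus>\<^bsub>Y\<^esub> z = \<pi> (x' \<oplus>\<^bsub>?P\<^esub> z')" using \<pi>(2)[of x' z'] Q'(1) by (simp add: subset_iff)
    then show "x \<oplus>\<^bsub>Y\<^esub> z \<in> \<pi> ` Q" using * Q'(3) by auto
  next
    fix a x assume a: "a \<in> carrier R" and "x \<in> \<pi> ` Q"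
    then obtain x' where *: "x' \<in> Q" "x = \<pi> x'" by auto
    then have "a \<odot>\<^bsub>Y\<^esub> x = \<pi> (a \<odot>\<^bsub>?P\<^esub> x')" using \<pi>(3)[of a x'] Q'(1) a by (simp add: subset_iff)
    then show "a \<odot>\<^bsub>Y\<^esub> x \<in> \<pi> ` Q" using * a Q'(6) by auto
  qed
  moreover obtain y' where y': "y' \<in> carrier ?P" "\<pi> y' = y"
    using Y.free_cover_map_surj[OF cY(1)] by (auto simp: \<pi>_def)
  have "c \<odot>\<^bsub>Y\<^esub> y \<in> \<pi> ` Q"
    using cQ[OF y'(1)] \<pi>(3)[OF c y'(1)] y'(2) by force
  ultimately have surj: "\<pi> ` Q = carrier Y"
    using Y cY(2) by (auto simp: irreducible_module_def)
  \<comment> \<open>Subtracting from x an element q of Q with the same image in Y leaves an element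
    of K.\<close>
  have KQ: "\<exists>k\<in>K. x \<ominus>\<^bsub>?P\<^esub> k \<in> Q" if x: "x \<in> carrier ?P" for x
  proof -
    obtain q where q: "q \<in> Q" "\<pi> q = \<pi> x" using surj \<pi>(1)[OF x] by (metis imageE)
    have qP: "q \<in> carrier ?P" using q Q'(1) by auto
    have "x \<ominus>\<^bsub>?P\<^esub> q \<in> K"
      using x qP q(2) \<pi>_minus[OF x qP] \<pi>(1)[OF x] by (simp add: K_def a_minus_def Y.M.r_neg)
    moreover have "x \<ominus>\<^bsub>?P\<^esub> (x \<ominus>\<^bsub>?P\<^esub> q) = q"
      using x qP by (simp add: a_minus_def P.M.minus_add P.M.a_assoc[symmetric] P.M.r_neg)
    ultimately show ?thesis using q(1) by metis
  qed
  have "\<phi> \<in> (\<lambda>h. restrict h K) ` left_hom R ?P V"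
    if \<phi>: "\<phi> \<in> left_hom R (?P\<lparr>carrier := K\<rparr>) V" for \<phi>
  proof -
    note \<phi>' = left_homD[OF \<phi>, simplified]
    have \<phi>0: "\<phi> \<zero>\<^bsub>?P\<^esub> = \<zero>\<^bsub>V\<^esub>"
      using left_hom_zero[OF left_module_submodule[OF P.left_module_axioms K] V.left_module_axioms \<phi>]
      by simp
    have sub: "Module.submodule (\<phi> ` (K \<inter> Q)) R V"
    proof (rule V.submoduleI)
      show "\<phi> ` (K \<inter> Q) \<subseteq> carrier V" using \<phi>'(1) by auto
      show "\<zero>\<^bsub>V\<^esub> \<in> \<phi> ` (K \<inter> Q)" using \<phi>0 Q'(2) K'(2) by force
    next
      fix x z assume "x \<in> \<phi> ` (K \<inter> Q)" "z \<in> \<phi> ` (K \<inter> Q)"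
      then obtain x' z' where *: "x' \<in> K \<inter> Q" "z' \<in> K \<inter> Q" "x = \<phi> x'" "z = \<phi> z'" by auto
      then have "x \<oplus>\<^bsub>V\<^esub> z = \<phi> (x' \<oplus>\<^bsub>?P\<^esub> z')" using \<phi>'(2) by auto
      then show "x \<oplus>\<^bsub>V\<^esub> z \<in> \<phi> ` (K \<inter> Q)" using * Q'(3) K'(3) by auto
    next
      fix a x assume a: "a \<in> carrier R" and "x \<in> \<phi> ` (K \<inter> Q)"
      then obtain x' where *: "x' \<in> K \<inter> Q" "x = \<phi> x'" by auto
      then have "a \<odot>\<^bsub>V\<^esub> x = \<phi> (a \<odot>\<^bsub>?P\<^esub> x')" using \<phi>'(3) a by auto
      then show "a \<odot>\<^bsub>V\<^esub> x \<in> \<phi> ` (K \<inter> Q)" using * a Q'(6) K'(6) by auto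
    qed
    have kill: "d \<odot>\<^bsub>V\<^esub> z = \<zero>\<^bsub>V\<^esub>" if z: "z \<in> \<phi> ` (K \<inter> Q)" for z
    proof -
      obtain x where x: "x \<in> K" "x \<in> Q" "z = \<phi> x" using z by auto
      have xP: "x \<in> carrier ?P" using x Q'(1) by auto
      have "d \<odot>\<^bsub>?P\<^esub> (\<one>\<^bsub>R\<^esub> \<odot>\<^bsub>?P\<^esub> x) = \<zero>\<^bsub>?P\<^esub>"
        using x(2) Y.R.one_closed unfolding Q_def by blast
      then have "d \<odot>\<^bsub>?P\<^esub> x = \<zero>\<^bsub>?P\<^esub>"
        using xP by (simp add: P.smult_one)
      then show ?thesis using \<phi>'(3)[OF d x(1)] x(3) \<phi>0 by simp
    qed
    have "\<phi> ` (K \<inter> Q) \<noteq> carrier V" using kill dV by blast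
    then have van: "\<phi> ` (K \<inter> Q) = {\<zero>\<^bsub>V\<^esub>}"
      using V sub by (auto simp: irreducible_module_def)
    have "\<exists>h\<in>left_hom R ?P V. restrict h K = \<phi>"
    proof (rule left_hom_extend[OF P.left_module_axioms V.left_module_axioms K Q KQ \<phi>])
      show "\<phi> x = \<zero>\<^bsub>V\<^esub>" if "x \<in> K" "x \<in> Q" for x using van that by blast
    qed
    then show ?thesis by force
  qed
  moreover have "restrict h K \<in> left_hom R (?P\<lparr>carrier := K\<rparr>) V" if "h \<in> left_hom R ?P V" for h
    using left_homD[OF that] K' by (auto simp: left_hom_def subset_iff)
  ultimately have "(\<lambda>h. restrict h K) ` left_hom R ?P V = carrier (hom_group R (?P\<lparr>carrier := K\<rparr>) V)"
    by (auto simp: hom_group_def)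
  then show ?thesis
    unfolding Ext1_def Kker
    using trivial_group_Mod_carrier[OF group_hom_group[OF
        left_module_submodule[OF P.left_module_axioms K] V.left_module_axioms]]
    by simp
qed

text \<open>With this, the terms of a composition series and everything between them can be compared
  as submodules of the one module M.\<close>

lemma submodule_restrict_iff:
  assumes "left_module R M" "Module.submodule B R M"
  shows "Module.submodule C R (M\<lparr>carrier := B\<rparr>) \<longleftrightarrow> Module.submodule C R M \<and> C \<subseteq> B"
proof -
  interpret M: left_module R M by fact
  interpret B: left_module R "M\<lparr>carrier := B\<rparr>" by (rule left_module_submodule) fact+
  show ?thesis
    using M.submoduleI[of C] B.submoduleI[of C] submodule_closed[of C R M]
      submodule_closed[of C R "M\<lparr>carrier := B\<rparr>"] submodule_closed(1)[OF assms(2)]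
    by simp (metis subset_trans)
qed

section \<open>Quotient modules and their submodules\<close>

context left_module
begin

lemma minus_minus_cancel:
  assumes "x \<in> carrier M" "y \<in> carrier M" "z \<in> carrier M"
  shows "(x \<ominus>\<^bsub>M\<^esub> y) \<oplus>\<^bsub>M\<^esub> (y \<ominus>\<^bsub>M\<^esub> z) = x \<ominus>\<^bsub>M\<^esub> z" "(x \<ominus>\<^bsub>M\<^esub> y) \<oplus>\<^bsub>M\<^esub> y = x"
  using assms M.a_lcomm[of "\<ominus>\<^bsub>M\<^esub> y" y "\<ominus>\<^bsub>M\<^esub> z"]
  by (simp_all add: a_minus_def M.a_assoc M.l_neg M.r_neg2 M.r_neg1)

context
  fixes A assumes A: "Module.submodule A R M"
begin

interpretation A: abelian_subgroup A M
  using Module.submodule.axioms(1)[OF A] M.abelian_group_axioms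
  by (intro abelian_subgroupI3) (auto simp: additive_subgroup_def)

private lemma A_sub: "x \<in> A \<Longrightarrow> x \<in> carrier M"
  using submodule_closed(1)[OF A] by auto

lemma coset_eq_iff:
  assumes "x \<in> carrier M" "y \<in> carrier M"
  shows "A +>\<^bsub>M\<^esub> x = A +>\<^bsub>M\<^esub> y \<longleftrightarrow> x \<ominus>\<^bsub>M\<^esub> y \<in> A"
proof
  assume "A +>\<^bsub>M\<^esub> x = A +>\<^bsub>M\<^esub> y"
  moreover have "x \<in> A +>\<^bsub>M\<^esub> x" using assms(1) by (rule A.a_rcos_self)
  ultimately show "x \<ominus>\<^bsub>M\<^esub> y \<in> A" using A.a_rcos_module assms by (simp add: a_minus_def)
next
  assume "x \<ominus>\<^bsub>M\<^esub> y \<in> A"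
  then have "x \<in> A +>\<^bsub>M\<^esub> y" using A.a_rcos_module assms by (simp add: a_minus_def)
  then show "A +>\<^bsub>M\<^esub> x = A +>\<^bsub>M\<^esub> y"
    using M.a_repr_independence[of x A y] assms(2) A.a_subgroup by simp
qed

lemma coset_eq_zero_iff:
  assumes "x \<in> carrier M"
  shows "A +>\<^bsub>M\<^esub> x = A \<longleftrightarrow> x \<in> A"
  using A.a_rcos_const[of x] A.a_rcos_self[OF assms] by blast

lemma quotient_module_simps:
  "carrier (quotient_module M A) = {A +>\<^bsub>M\<^esub> x | x. x \<in> carrier M}"
  "\<zero>\<^bsub>quotient_module M A\<^esub> = A"
  by (auto simp: quotient_module_def A_RCOSETS_def')

lemma quotient_module_add:
  assumes "x \<in> carrier M" "y \<in> carrier M"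
  shows "(A +>\<^bsub>M\<^esub> x) \<oplus>\<^bsub>quotient_module M A\<^esub> (A +>\<^bsub>M\<^esub> y) = A +>\<^bsub>M\<^esub> (x \<oplus>\<^bsub>M\<^esub> y)"
  using A.a_rcos_sum assms by (simp add: quotient_module_def)

text \<open>The product of a with a coset C is defined by adding A to the set a C, since a C alone
  can be smaller than a coset, for instance for a = 0. The work is to see that the result is the
  expected coset.\<close>

lemma quotient_module_smult:
  assumes a: "a \<in> carrier R" and x: "x \<in> carrier M"
  shows "a \<odot>\<^bsub>quotient_module M A\<^esub> (A +>\<^bsub>M\<^esub> x) = A +>\<^bsub>M\<^esub> (a \<odot>\<^bsub>M\<^esub> x)"
proof -
  note A' = submodule_closed[OF A]
  have "A <+>\<^bsub>M\<^esub> ((\<lambda>x. a \<odot>\<^bsub>M\<^esub> x) ` (A +>\<^bsub>M\<^esub> x)) = A +>\<^bsub>M\<^esub> (a \<odot>\<^bsub>M\<^esub> x)" (is "?L = ?R")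
  proof (rule Set.set_eqI)
    fix z
    have "z \<in> ?L \<longleftrightarrow> (\<exists>h\<in>A. \<exists>k\<in>A. z = h \<oplus>\<^bsub>M\<^esub> a \<odot>\<^bsub>M\<^esub> (k \<oplus>\<^bsub>M\<^esub> x))"
      by (auto simp: set_add_def' a_r_coset_def')
    also have "\<dots> \<longleftrightarrow> (\<exists>h\<in>A. \<exists>k\<in>A. z = (h \<oplus>\<^bsub>M\<^esub> a \<odot>\<^bsub>M\<^esub> k) \<oplus>\<^bsub>M\<^esub> a \<odot>\<^bsub>M\<^esub> x)"
      using a x A_sub by (simp add: smult_r_distr smult_closed M.a_assoc)
    also have "\<dots> \<longleftrightarrow> (\<exists>h\<in>A. z = h \<oplus>\<^bsub>M\<^esub> a \<odot>\<^bsub>M\<^esub> x)"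
    proof
      assume "\<exists>h\<in>A. \<exists>k\<in>A. z = (h \<oplus>\<^bsub>M\<^esub> a \<odot>\<^bsub>M\<^esub> k) \<oplus>\<^bsub>M\<^esub> a \<odot>\<^bsub>M\<^esub> x"
      then show "\<exists>h\<in>A. z = h \<oplus>\<^bsub>M\<^esub> a \<odot>\<^bsub>M\<^esub> x" using A'(3,6) a by blast
    next
      assume "\<exists>h\<in>A. z = h \<oplus>\<^bsub>M\<^esub> a \<odot>\<^bsub>M\<^esub> x"
      then obtain h where "h \<in> A" "z = (h \<oplus>\<^bsub>M\<^esub> a \<odot>\<^bsub>M\<^esub> \<zero>\<^bsub>M\<^esub>) \<oplus>\<^bsub>M\<^esub> a \<odot>\<^bsub>M\<^esub> x"
        using a A_sub by (auto simp: smult_r_null)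
      then show "\<exists>h\<in>A. \<exists>k\<in>A. z = (h \<oplus>\<^bsub>M\<^esub> a \<odot>\<^bsub>M\<^esub> k) \<oplus>\<^bsub>M\<^esub> a \<odot>\<^bsub>M\<^esub> x"
        using A'(2) by blast
    qed
    also have "\<dots> \<longleftrightarrow> z \<in> ?R" by (auto simp: a_r_coset_def')
    finally show "z \<in> ?L \<longleftrightarrow> z \<in> ?R" .
  qed
  then show ?thesis by (simp add: quotient_module_def)
qed

lemma left_module_quotient: "left_module R (quotient_module M A)"
proof -
  let ?Q = "quotient_module M A"
  note [simp] = quotient_module_simps quotient_module_add quotient_module_smult smult_closed
  have A0: "A +>\<^bsub>M\<^esub> \<zero>\<^bsub>M\<^esub> = A" using coset_eq_zero_iff[of "\<zero>\<^bsub>M\<^esub>"] submodule_closed(2)[OF A] by simp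
  have "abelian_group ?Q"
  proof (rule abelian_groupI)
    show "\<zero>\<^bsub>?Q\<^esub> \<in> carrier ?Q" using A0 M.zero_closed unfolding quotient_module_simps by blast
  next
    fix C D assume "C \<in> carrier ?Q" "D \<in> carrier ?Q"
    then obtain x y where x: "x \<in> carrier M" "C = A +>\<^bsub>M\<^esub> x" and y: "y \<in> carrier M" "D = A +>\<^bsub>M\<^esub> y"
      by auto
    show "C \<oplus>\<^bsub>?Q\<^esub> D \<in> carrier ?Q" using x y by auto
    show "C \<oplus>\<^bsub>?Q\<^esub> D = D \<oplus>\<^bsub>?Q\<^esub> C" using x y by (simp add: M.a_comm)
    fix E assume "E \<in> carrier ?Q"
    then obtain z where "z \<in> carrier M" "E = A +>\<^bsub>M\<^esub> z" by auto
    then show "C \<oplus>\<^bsub>?Q\<^esub> D \<oplus>\<^bsub>?Q\<^esub> E = C \<oplus>\<^bsub>?Q\<^esub> (D \<oplus>\<^bsub>?Q\<^esub> E)"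
      using x y by (simp add: M.a_assoc)
  next
    fix C assume "C \<in> carrier ?Q"
    then obtain x where x: "x \<in> carrier M" "C = A +>\<^bsub>M\<^esub> x" by auto
    have "(A +>\<^bsub>M\<^esub> \<ominus>\<^bsub>M\<^esub> x) \<oplus>\<^bsub>?Q\<^esub> C = \<zero>\<^bsub>?Q\<^esub>"
      using x by (simp add: M.l_neg A0)
    moreover have "(A +>\<^bsub>M\<^esub> \<ominus>\<^bsub>M\<^esub> x) \<in> carrier ?Q" using x by auto
    ultimately show "\<exists>D\<in>carrier ?Q. D \<oplus>\<^bsub>?Q\<^esub> C = \<zero>\<^bsub>?Q\<^esub>" by blast
    show "\<zero>\<^bsub>?Q\<^esub> \<oplus>\<^bsub>?Q\<^esub> C = C"
      using quotient_module_add[of "\<zero>\<^bsub>M\<^esub>" x] x A0 by simp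
  qed
  moreover have "left_module_axioms R ?Q"
  proof
    fix a b C assume a: "a \<in> carrier R" and b: "b \<in> carrier R" and "C \<in> carrier ?Q"
    then obtain x where x: "x \<in> carrier M" "C = A +>\<^bsub>M\<^esub> x" by auto
    show "(a \<oplus> b) \<odot>\<^bsub>?Q\<^esub> C = a \<odot>\<^bsub>?Q\<^esub> C \<oplus>\<^bsub>?Q\<^esub> b \<odot>\<^bsub>?Q\<^esub> C"
      using a b x by (simp add: smult_l_distr)
    show "(a \<otimes> b) \<odot>\<^bsub>?Q\<^esub> C = a \<odot>\<^bsub>?Q\<^esub> (b \<odot>\<^bsub>?Q\<^esub> C)"
      using a b x by (simp add: smult_assoc)
  next
    fix a C D assume a: "a \<in> carrier R" and "C \<in> carrier ?Q" "D \<in> carrier ?Q"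
    then obtain x y where x: "x \<in> carrier M" "C = A +>\<^bsub>M\<^esub> x" and y: "y \<in> carrier M" "D = A +>\<^bsub>M\<^esub> y"
      by auto
    show "a \<odot>\<^bsub>?Q\<^esub> (C \<oplus>\<^bsub>?Q\<^esub> D) = a \<odot>\<^bsub>?Q\<^esub> C \<oplus>\<^bsub>?Q\<^esub> a \<odot>\<^bsub>?Q\<^esub> D"
      using a x y by (simp add: smult_r_distr)
  next
    fix a C assume a: "a \<in> carrier R" and "C \<in> carrier ?Q"
    then obtain x where x: "x \<in> carrier M" "C = A +>\<^bsub>M\<^esub> x" by auto
    show "a \<odot>\<^bsub>?Q\<^esub> C \<in> carrier ?Q" using a x by auto
  next
    fix C assume "C \<in> carrier ?Q"
    then obtain x where x: "x \<in> carrier M" "C = A +>\<^bsub>M\<^esub> x" by auto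
    show "\<one> \<odot>\<^bsub>?Q\<^esub> C = C" using x by (simp add: smult_one)
  qed
  ultimately show ?thesis
    by (simp add: left_module_def R.ring_axioms)
qed

text \<open>Submodules of the quotient correspond to the submodules between A and M, by images in
  one direction and preimages in the other. That A is proper reflects the nonvanishing contained in
  \<open>irreducible_module\<close>.\<close>

lemma irreducible_quotient_iff:
  "irreducible_module R (quotient_module M A) \<longleftrightarrow>
     A \<noteq> carrier M \<and> (\<forall>C. Module.submodule C R M \<and> A \<subseteq> C \<longrightarrow> C = A \<or> C = carrier M)"
  (is "?L \<longleftrightarrow> ?R")
proof -
  let ?Q = "quotient_module M A"
  interpret Q: left_module R ?Q by (rule left_module_quotient)
  note A' = submodule_closed[OF A]
  note [simp] = quotient_module_simps quotient_module_add quotient_module_smult smult_closed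
  have ne: "carrier ?Q \<noteq> {\<zero>\<^bsub>?Q\<^esub>} \<longleftrightarrow> A \<noteq> carrier M"
  proof
    assume "carrier ?Q \<noteq> {\<zero>\<^bsub>?Q\<^esub>}"
    then obtain C where "C \<in> carrier ?Q" "C \<noteq> A" using Q.M.zero_closed by fastforce
    then obtain x where "x \<in> carrier M" "A +>\<^bsub>M\<^esub> x \<noteq> A" by auto
    then show "A \<noteq> carrier M" using coset_eq_zero_iff by metis
  next
    assume "A \<noteq> carrier M"
    then obtain x where x: "x \<in> carrier M" "x \<notin> A" using A'(1) by auto
    then have "A +>\<^bsub>M\<^esub> x \<in> carrier ?Q" "A +>\<^bsub>M\<^esub> x \<noteq> \<zero>\<^bsub>?Q\<^esub>"
      using coset_eq_zero_iff by auto
    then show "carrier ?Q \<noteq> {\<zero>\<^bsub>?Q\<^esub>}" by blast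
  qed
  show ?thesis
  proof
    assume L: ?L
    have "C = A \<or> C = carrier M" if C: "Module.submodule C R M" "A \<subseteq> C" for C
    proof -
      note C' = submodule_closed[OF C(1)]
      have Cs: "x \<in> carrier M" if "x \<in> C" for x using that C'(1) by auto
      let ?D = "{A +>\<^bsub>M\<^esub> x | x. x \<in> C}"
      have "Module.submodule ?D R ?Q"
      proof (rule Q.submoduleI)
        show "?D \<subseteq> carrier ?Q" using Cs by auto
        show "\<zero>\<^bsub>?Q\<^esub> \<in> ?D" using C'(2) coset_eq_zero_iff[of "\<zero>\<^bsub>M\<^esub>"] A'(2) by force
        show "x \<oplus>\<^bsub>?Q\<^esub> y \<in> ?D" if "x \<in> ?D" "y \<in> ?D" for x y using that C'(3) Cs by auto
        show "a \<odot>\<^bsub>?Q\<^esub> x \<in> ?D" if "a \<in> carrier R" "x \<in> ?D" for a x using that C'(6) Cs by auto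
      qed
      then consider "?D = {A}" | "?D = carrier ?Q"
        using L by (auto simp: irreducible_module_def)
      then show ?thesis
      proof cases
        case 1
        have "x \<in> A" if "x \<in> C" for x
          using 1 that coset_eq_zero_iff[OF Cs[OF that]] by blast
        then show ?thesis using C(2) by auto
      next
        case 2
        have "x \<in> C" if x: "x \<in> carrier M" for x
        proof -
          have "A +>\<^bsub>M\<^esub> x \<in> ?D" using 2 x by auto
          then obtain y where y: "y \<in> C" "A +>\<^bsub>M\<^esub> x = A +>\<^bsub>M\<^esub> y" by auto
          then have "x \<ominus>\<^bsub>M\<^esub> y \<in> C" using coset_eq_iff[OF x] Cs C(2) by auto
          then show ?thesis using minus_minus_cancel(2)[OF x Cs[OF y(1)] M.zero_closed] C'(3) y(1) by metis
        qed
        then show ?thesis using C'(1) by auto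
      qed
    qed
    then show ?R using L ne by (auto simp: irreducible_module_def)
  next
    assume R: ?R
    have "D = {A} \<or> D = carrier ?Q" if D: "Module.submodule D R ?Q" for D
    proof -
      note D' = submodule_closed[OF D]
      let ?C = "{x \<in> carrier M. A +>\<^bsub>M\<^esub> x \<in> D}"
      have C: "Module.submodule ?C R M"
      proof (rule submoduleI)
        show "\<zero>\<^bsub>M\<^esub> \<in> ?C" using D'(2) coset_eq_zero_iff[of "\<zero>\<^bsub>M\<^esub>"] A'(2) by simp
        show "x \<oplus>\<^bsub>M\<^esub> y \<in> ?C" if "x \<in> ?C" "y \<in> ?C" for x y
          using that D'(3)[of "A +>\<^bsub>M\<^esub> x" "A +>\<^bsub>M\<^esub> y"] by simp
        show "a \<odot>\<^bsub>M\<^esub> x \<in> ?C" if "a \<in> carrier R" "x \<in> ?C" for a x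
          using that D'(6)[of a "A +>\<^bsub>M\<^esub> x"] by simp
      qed auto
      have DC: "D = {A +>\<^bsub>M\<^esub> x | x. x \<in> ?C}" using D'(1) by auto
      have "A +>\<^bsub>M\<^esub> x = A" if "x \<in> A" for x
        using coset_eq_zero_iff[OF A_sub[OF that]] that by simp
      then have "A \<subseteq> ?C" using D'(2) A_sub by auto
      then consider "?C = A" | "?C = carrier M" using R C by auto
      then show ?thesis
      proof cases
        case 1
        have "D = {A +>\<^bsub>M\<^esub> x | x. x \<in> A}" using DC unfolding 1 .
        then show ?thesis using coset_eq_zero_iff A_sub A'(2) by blast
      next
        case 2
        have "D = {A +>\<^bsub>M\<^esub> x | x. x \<in> carrier M}" using DC unfolding 2 .
        then show ?thesis by simp
      qed
    qed
    then show ?L using R ne Q.left_module_axioms by (auto simp: irreducible_module_def)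
  qed
qed

end

end

section \<open>Modules for group algebras\<close>

text \<open>The multiple c g of a group element. These generate kG additively, which is the source
  of the induction rules below; the scalars are the multiples of the identity of G.\<close>

definition single :: "'g \<Rightarrow> 'k::field \<Rightarrow> 'g \<Rightarrow> 'k" where
  "single g c = (\<lambda>x. if x = g then c else 0)"

lemma group_elem_eq_single: "group_elem g = single g 1"
  by (simp add: group_elem_def single_def)

lemma group_algebra_simps:
  "a \<in> carrier (group_algebra G) \<longleftrightarrow> (\<forall>x. x \<notin> carrier G \<longrightarrow> a x = 0)"
  "\<zero>\<^bsub>group_algebra G\<^esub> = (\<lambda>x. 0)"
  "\<one>\<^bsub>group_algebra G\<^esub> = single \<one>\<^bsub>G\<^esub> 1"
  "a \<oplus>\<^bsub>group_algebra G\<^esub> b = (\<lambda>x. a x + b x)"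
  by (simp_all add: group_algebra_def single_def)

lemma single_closed: "g \<in> carrier G \<Longrightarrow> single g c \<in> carrier (group_algebra G)"
  by (auto simp: group_algebra_simps single_def)

text \<open>In the convolution over G only y in T contribute, as a vanishes elsewhere. For such y
  and x outside T the element y^-1 x is outside T, where b vanishes.\<close>

lemma group_algebra_mult_subgroup:
  assumes "group G" "finite (carrier G)" "subgroup T G"
    and a: "a \<in> carrier (group_algebra (G\<lparr>carrier := T\<rparr>))"
    and b: "b \<in> carrier (group_algebra (G\<lparr>carrier := T\<rparr>))"
  shows "a \<otimes>\<^bsub>group_algebra (G\<lparr>carrier := T\<rparr>)\<^esub> b = a \<otimes>\<^bsub>group_algebra G\<^esub> b"
proof
  fix x
  interpret group G by fact
  interpret T: subgroup T G by fact
  have sum: "(\<Sum>y\<in>carrier G. a y * b (inv\<^bsub>G\<^esub> y \<otimes>\<^bsub>G\<^esub> x)) = (\<Sum>y\<in>T. a y * b (inv\<^bsub>G\<^esub> y \<otimes>\<^bsub>G\<^esub> x))"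
    by (rule sum.mono_neutral_right) (use assms(2) T.subset a in \<open>auto simp: group_algebra_simps\<close>)
  have "a y * b (inv\<^bsub>G\<^esub> y \<otimes>\<^bsub>G\<^esub> x) = 0" if "x \<notin> T" "x \<in> carrier G" "y \<in> T" for y
  proof -
    have "inv\<^bsub>G\<^esub> y \<otimes>\<^bsub>G\<^esub> x \<notin> T"
    proof
      assume "inv\<^bsub>G\<^esub> y \<otimes>\<^bsub>G\<^esub> x \<in> T"
      then have "y \<otimes>\<^bsub>G\<^esub> (inv\<^bsub>G\<^esub> y \<otimes>\<^bsub>G\<^esub> x) \<in> T" using that(3) by blast
      then show False using that T.mem_carrier by (simp add: m_assoc[symmetric])
    qed
    then show ?thesis using b by (simp add: group_algebra_simps)
  qed
  then show "(a \<otimes>\<^bsub>group_algebra (G\<lparr>carrier := T\<rparr>)\<^esub> b) x = (a \<otimes>\<^bsub>group_algebra G\<^esub> b) x"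
    using sum T.subset assms(3)
    by (auto simp: group_algebra_def m_inv_consistent cong: if_cong sum.cong)
qed

lemma single_mult:
  assumes "group G" "finite (carrier G)" "g \<in> carrier G" "h \<in> carrier G"
  shows "single g c \<otimes>\<^bsub>group_algebra G\<^esub> single h d = single (g \<otimes>\<^bsub>G\<^esub> h) (c * d)"
proof
  fix x
  interpret group G by fact
  have "(\<Sum>y\<in>carrier G. single g c y * single h d (inv\<^bsub>G\<^esub> y \<otimes>\<^bsub>G\<^esub> x)) = c * single h d (inv\<^bsub>G\<^esub> g \<otimes>\<^bsub>G\<^esub> x)"
    using assms(2,3) by (simp add: single_def if_distrib[of "\<lambda>c. c * _"] sum.delta cong: if_cong)
  moreover have "inv\<^bsub>G\<^esub> g \<otimes>\<^bsub>G\<^esub> x = h \<longleftrightarrow> x = g \<otimes>\<^bsub>G\<^esub> h" if "x \<in> carrier G"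
    using that assms by (metis inv_solve_left)
  ultimately show "(single g c \<otimes>\<^bsub>group_algebra G\<^esub> single h d) x = single (g \<otimes>\<^bsub>G\<^esub> h) (c * d) x"
    using assms by (auto simp: group_algebra_def single_def)
qed

lemma single_mult_left:
  assumes "group G" "finite (carrier G)" "g \<in> carrier G"
  shows "single g c \<otimes>\<^bsub>group_algebra G\<^esub> a =
    (\<lambda>x. if x \<in> carrier G then c * a (inv\<^bsub>G\<^esub> g \<otimes>\<^bsub>G\<^esub> x) else 0)"
proof
  fix x
  have "(\<Sum>y\<in>carrier G. single g c y * a (inv\<^bsub>G\<^esub> y \<otimes>\<^bsub>G\<^esub> x)) = c * a (inv\<^bsub>G\<^esub> g \<otimes>\<^bsub>G\<^esub> x)"
    using assms(2,3) by (simp add: single_def if_distrib[of "\<lambda>c. c * _"] sum.delta cong: if_cong)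
  then show "(single g c \<otimes>\<^bsub>group_algebra G\<^esub> a) x =
      (if x \<in> carrier G then c * a (inv\<^bsub>G\<^esub> g \<otimes>\<^bsub>G\<^esub> x) else 0)"
    by (simp add: group_algebra_def)
qed

lemma single_mult_right:
  assumes "group G" "finite (carrier G)" "g \<in> carrier G"
  shows "a \<otimes>\<^bsub>group_algebra G\<^esub> single g c =
    (\<lambda>x. if x \<in> carrier G then a (x \<otimes>\<^bsub>G\<^esub> inv\<^bsub>G\<^esub> g) * c else 0)"
proof
  fix x
  interpret group G by fact
  have "(\<Sum>y\<in>carrier G. a y * single g c (inv\<^bsub>G\<^esub> y \<otimes>\<^bsub>G\<^esub> x)) = a (x \<otimes>\<^bsub>G\<^esub> inv\<^bsub>G\<^esub> g) * c"
    if x: "x \<in> carrier G"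
  proof -
    have "inv\<^bsub>G\<^esub> y \<otimes>\<^bsub>G\<^esub> x = g \<longleftrightarrow> y = x \<otimes>\<^bsub>G\<^esub> inv\<^bsub>G\<^esub> g" if y: "y \<in> carrier G" for y
    proof
      assume "inv\<^bsub>G\<^esub> y \<otimes>\<^bsub>G\<^esub> x = g"
      then have "x = y \<otimes>\<^bsub>G\<^esub> g" using x y assms(3) by (metis inv_solve_left')
      then show "y = x \<otimes>\<^bsub>G\<^esub> inv\<^bsub>G\<^esub> g" using y assms(3) by (simp add: m_assoc)
    next
      assume "y = x \<otimes>\<^bsub>G\<^esub> inv\<^bsub>G\<^esub> g"
      then show "inv\<^bsub>G\<^esub> y \<otimes>\<^bsub>G\<^esub> x = g" using x assms(3) by (simp add: inv_mult_group m_assoc)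
    qed
    then have "(\<Sum>y\<in>carrier G. a y * single g c (inv\<^bsub>G\<^esub> y \<otimes>\<^bsub>G\<^esub> x)) =
        (\<Sum>y\<in>carrier G. if y = x \<otimes>\<^bsub>G\<^esub> inv\<^bsub>G\<^esub> g then a y * c else 0)"
      by (intro sum.cong refl) (simp add: single_def)
    then show ?thesis using x assms(2,3) by simp
  qed
  then show "(a \<otimes>\<^bsub>group_algebra G\<^esub> single g c) x =
      (if x \<in> carrier G then a (x \<otimes>\<^bsub>G\<^esub> inv\<^bsub>G\<^esub> g) * c else 0)"
    by (simp add: group_algebra_def)
qed

text \<open>The ring axioms for kG come with any kG-module, as \<open>left_module\<close> contains
  them. They pass to kT because kT is closed under the operations of kG and these agree with its
  own.\<close>

lemma (in group) ring_group_algebra_subgroup: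
  assumes fin: "finite (carrier G)" and R: "ring (group_algebra G :: ('a \<Rightarrow> 'k::field) ring)"
    and T: "subgroup T G"
  shows "ring (group_algebra (G\<lparr>carrier := T\<rparr>) :: ('a \<Rightarrow> 'k) ring)"
proof -
  let ?R = "group_algebra G :: ('a \<Rightarrow> 'k) ring"
  let ?S = "group_algebra (G\<lparr>carrier := T\<rparr>) :: ('a \<Rightarrow> 'k) ring"
  interpret R: ring ?R by fact
  have sub: "a \<in> carrier ?R" if "a \<in> carrier ?S" for a
    using that subgroup.subset[OF T] by (auto simp: group_algebra_simps)
  have add: "a \<oplus>\<^bsub>?S\<^esub> b = a \<oplus>\<^bsub>?R\<^esub> b" for a b by (simp add: group_algebra_simps)
  have one: "\<one>\<^bsub>?S\<^esub> = \<one>\<^bsub>?R\<^esub>" by (simp add: group_algebra_simps)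
  have zero: "\<zero>\<^bsub>?S\<^esub> = \<zero>\<^bsub>?R\<^esub>" by (simp add: group_algebra_simps)
  have mult: "a \<otimes>\<^bsub>?S\<^esub> b = a \<otimes>\<^bsub>?R\<^esub> b" if "a \<in> carrier ?S" "b \<in> carrier ?S" for a b
    by (rule group_algebra_mult_subgroup[OF group_axioms fin T that])
  have add_closed: "a \<oplus>\<^bsub>?R\<^esub> b \<in> carrier ?S" if "a \<in> carrier ?S" "b \<in> carrier ?S" for a b
    using that by (simp add: group_algebra_simps)
  have "a \<otimes>\<^bsub>?S\<^esub> b \<in> carrier ?S" for a b
    by (simp add: group_algebra_def)
  then have mult_closed: "a \<otimes>\<^bsub>?R\<^esub> b \<in> carrier ?S" if "a \<in> carrier ?S" "b \<in> carrier ?S" for a b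
    using mult[OF that] by metis
  have one_closed: "\<one>\<^bsub>?R\<^esub> \<in> carrier ?S"
    using subgroup.one_closed[OF T] by (auto simp: group_algebra_simps single_def)
  show ?thesis
  proof (rule ringI)
    show "abelian_group ?S"
    proof (rule abelian_groupI)
      fix a assume "a \<in> carrier ?S"
      then have "(\<lambda>x. - a x) \<in> carrier ?S" "(\<lambda>x. - a x) \<oplus>\<^bsub>?S\<^esub> a = \<zero>\<^bsub>?S\<^esub>"
        by (auto simp: group_algebra_simps)
      then show "\<exists>b\<in>carrier ?S. b \<oplus>\<^bsub>?S\<^esub> a = \<zero>\<^bsub>?S\<^esub>" by blast
    qed (auto simp: group_algebra_simps)
    show "monoid ?S"
      by (rule monoidI)
        (simp_all add: mult one sub mult_closed one_closed R.m_assoc)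
  qed (simp_all add: mult add sub mult_closed add_closed R.l_distr R.r_distr)
qed

text \<open>Induction over a finite set of group elements requires functions that are cut off
  outside this set: enlarging the set by g adds the single term a(g) g.\<close>

lemma group_algebra_restrict_induct:
  assumes "finite A" "A \<subseteq> carrier G"
    and "P (\<lambda>x. 0)" "\<And>g c. g \<in> A \<Longrightarrow> P (single g c)"
    and "\<And>a b. a \<in> carrier (group_algebra G) \<Longrightarrow> b \<in> carrier (group_algebra G) \<Longrightarrow>
          P a \<Longrightarrow> P b \<Longrightarrow> P (a \<oplus>\<^bsub>group_algebra G\<^esub> b)"
  shows "P (\<lambda>x. if x \<in> A then a x else 0)"
  using assms(1,2,4)
proof (induction A)
  case empty
  then show ?case using assms(3) by simp
next
  case (insert g A)
  have eq: "(\<lambda>x. if x \<in> insert g A then a x else 0) =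
      single g (a g) \<oplus>\<^bsub>group_algebra G\<^esub> (\<lambda>x. if x \<in> A then a x else 0)"
    using insert.hyps by (auto simp: group_algebra_simps single_def)
  show ?case
    unfolding eq
    by (rule assms(5)) (use insert in \<open>auto simp: group_algebra_simps single_def\<close>)
qed

lemma group_algebra_induct:
  assumes "finite (carrier G)" "a \<in> carrier (group_algebra G)"
    and "P (\<lambda>x. 0)" "\<And>g c. g \<in> carrier G \<Longrightarrow> P (single g c)"
    and "\<And>a b. a \<in> carrier (group_algebra G) \<Longrightarrow> b \<in> carrier (group_algebra G) \<Longrightarrow>
          P a \<Longrightarrow> P b \<Longrightarrow> P (a \<oplus>\<^bsub>group_algebra G\<^esub> b)"
  shows "P a"
proof -
  have "a = (\<lambda>x. if x \<in> carrier G then a x else 0)"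
    using assms(2) by (auto simp: group_algebra_simps)
  then show ?thesis
    using group_algebra_restrict_induct[of "carrier G" G P a] assms by simp
qed

section \<open>Modules over kG as vector spaces with a linear action of G\<close>

locale group_algebra_module = G: group G + M: left_module "group_algebra G" M
  for G :: "('g, 'c) monoid_scheme" (structure)
    and M :: "('g \<Rightarrow> 'k::field, 'm, 'd) module_scheme" +
  assumes fin: "finite (carrier G)"
begin

abbreviation "kG \<equiv> group_algebra G :: ('g \<Rightarrow> 'k) ring"

definition act :: "'g \<Rightarrow> 'm \<Rightarrow> 'm" where
  "act g x = group_elem g \<odot>\<^bsub>M\<^esub> x"

definition scal :: "'k \<Rightarrow> 'm \<Rightarrow> 'm" where
  "scal c x = single \<one> c \<odot>\<^bsub>M\<^esub> x"

lemma act_closed [simp]: "g \<in> carrier G \<Longrightarrow> x \<in> carrier M \<Longrightarrow> act g x \<in> carrier M"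
  by (simp add: act_def group_elem_eq_single single_closed M.smult_closed)

lemma scal_closed [simp]: "x \<in> carrier M \<Longrightarrow> scal c x \<in> carrier M"
  by (simp add: scal_def single_closed M.smult_closed)

lemma act_act:
  "g \<in> carrier G \<Longrightarrow> h \<in> carrier G \<Longrightarrow> x \<in> carrier M \<Longrightarrow> act g (act h x) = act (g \<otimes> h) x"
  by (simp add: act_def group_elem_eq_single single_closed single_mult G.group_axioms fin
      flip: M.smult_assoc)

lemma scal_scal: "x \<in> carrier M \<Longrightarrow> scal c (scal d x) = scal (c * d) x"
  by (simp add: scal_def single_closed single_mult G.group_axioms fin flip: M.smult_assoc)

lemma act_scal: "g \<in> carrier G \<Longrightarrow> x \<in> carrier M \<Longrightarrow> act g (scal c x) = scal c (act g x)"
  by (simp add: act_def group_elem_eq_single scal_def single_closed single_mult G.group_axioms fin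
      flip: M.smult_assoc)

lemma single_smult:
  "g \<in> carrier G \<Longrightarrow> x \<in> carrier M \<Longrightarrow> single g c \<odot>\<^bsub>M\<^esub> x = scal c (act g x)"
  by (simp add: act_def group_elem_eq_single scal_def single_closed single_mult G.group_axioms fin
      flip: M.smult_assoc)

lemma act_one [simp]: "x \<in> carrier M \<Longrightarrow> act \<one> x = x"
  using M.smult_one by (simp add: act_def group_elem_eq_single group_algebra_simps)

lemma scal_one [simp]: "x \<in> carrier M \<Longrightarrow> scal 1 x = x"
  using M.smult_one by (simp add: scal_def group_algebra_simps)

lemma scal_zero_left [simp]: "x \<in> carrier M \<Longrightarrow> scal 0 x = \<zero>\<^bsub>M\<^esub>"
  using M.smult_l_null by (simp add: scal_def group_algebra_simps single_def)

lemma act_add: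
  "g \<in> carrier G \<Longrightarrow> x \<in> carrier M \<Longrightarrow> y \<in> carrier M \<Longrightarrow> act g (x \<oplus>\<^bsub>M\<^esub> y) = act g x \<oplus>\<^bsub>M\<^esub> act g y"
  by (simp add: act_def group_elem_eq_single single_closed M.smult_r_distr)

lemma scal_add:
  "x \<in> carrier M \<Longrightarrow> y \<in> carrier M \<Longrightarrow> scal c (x \<oplus>\<^bsub>M\<^esub> y) = scal c x \<oplus>\<^bsub>M\<^esub> scal c y"
  by (simp add: scal_def single_closed M.smult_r_distr)

lemma scal_add_left:
  "x \<in> carrier M \<Longrightarrow> scal (c + d) x = scal c x \<oplus>\<^bsub>M\<^esub> scal d x"
proof -
  have "single \<one> (c + d) = single \<one> c \<oplus>\<^bsub>kG\<^esub> (single \<one> d :: 'g \<Rightarrow> 'k)"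
    by (auto simp: single_def group_algebra_simps)
  then show "x \<in> carrier M \<Longrightarrow> ?thesis"
    by (simp add: scal_def single_closed M.smult_l_distr)
qed

lemma scal_zero [simp]: "scal c \<zero>\<^bsub>M\<^esub> = \<zero>\<^bsub>M\<^esub>"
  by (simp add: scal_def single_closed M.smult_r_null)

lemma act_zero [simp]: "g \<in> carrier G \<Longrightarrow> act g \<zero>\<^bsub>M\<^esub> = \<zero>\<^bsub>M\<^esub>"
  by (simp add: act_def group_elem_eq_single single_closed M.smult_r_null)

lemma scal_minus: "x \<in> carrier M \<Longrightarrow> scal c (\<ominus>\<^bsub>M\<^esub> x) = \<ominus>\<^bsub>M\<^esub> scal c x"
  by (simp add: scal_def single_closed M.smult_r_minus)

lemma scal_minus_left: "x \<in> carrier M \<Longrightarrow> scal (- c) x = \<ominus>\<^bsub>M\<^esub> scal c x"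
  using scal_add_left[of x "- c" c] M.M.minus_equality[of "scal (- c) x" "scal c x"] by simp

lemma scal_diff: "x \<in> carrier M \<Longrightarrow> scal (c - d) x = scal c x \<ominus>\<^bsub>M\<^esub> scal d x"
  using scal_add_left[of x c "- d"] scal_minus_left[of x d] by (simp add: a_minus_def)

text \<open>As kG is additively generated by the elements c g, stability under G and under scalars
  implies stability under kG.\<close>

lemma submodule_actI:
  assumes S: "S \<subseteq> carrier M" "\<zero>\<^bsub>M\<^esub> \<in> S"
    and add: "\<And>x y. x \<in> S \<Longrightarrow> y \<in> S \<Longrightarrow> x \<oplus>\<^bsub>M\<^esub> y \<in> S"
    and act: "\<And>g x. g \<in> carrier G \<Longrightarrow> x \<in> S \<Longrightarrow> act g x \<in> S"
    and scal: "\<And>c x. x \<in> S \<Longrightarrow> scal c x \<in> S"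
  shows "Module.submodule S kG M"
proof (rule M.submoduleI[OF S add])
  fix a x assume a: "a \<in> carrier kG" and x: "x \<in> S"
  have xM: "x \<in> carrier M" using x S by auto
  show "a \<odot>\<^bsub>M\<^esub> x \<in> S"
  proof (rule group_algebra_induct[OF fin a])
    show "(\<lambda>g. 0) \<odot>\<^bsub>M\<^esub> x \<in> S" using M.smult_l_null[OF xM] S by (simp add: group_algebra_simps)
    show "single g c \<odot>\<^bsub>M\<^esub> x \<in> S" if "g \<in> carrier G" for g c
      using single_smult[OF that xM] act[OF that x] scal by simp
    show "(a \<oplus>\<^bsub>kG\<^esub> b) \<odot>\<^bsub>M\<^esub> x \<in> S"
      if "a \<in> carrier kG" "b \<in> carrier kG" "a \<odot>\<^bsub>M\<^esub> x \<in> S" "b \<odot>\<^bsub>M\<^esub> x \<in> S" for a b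
      using that add xM by (simp add: M.smult_l_distr)
  qed
qed

lemma submodule_act:
  assumes "Module.submodule S kG M"
  shows "g \<in> carrier G \<Longrightarrow> x \<in> S \<Longrightarrow> act g x \<in> S" "x \<in> S \<Longrightarrow> scal c x \<in> S"
  using submodule_closed(6)[OF assms] by (auto simp: act_def group_elem_eq_single scal_def single_closed)

lemma smult_eq_finsum:
  assumes A: "finite A" "A \<subseteq> carrier G" and x: "x \<in> carrier M"
  shows "(\<lambda>g. if g \<in> A then a g else 0) \<odot>\<^bsub>M\<^esub> x = (\<Oplus>\<^bsub>M\<^esub>g\<in>A. scal (a g) (act g x))"
  using A
proof (induction A)
  case empty
  then show ?case using M.smult_l_null[OF x] by (simp add: group_algebra_simps)
next
  case (insert g A)
  have eq: "(\<lambda>x. if x \<in> insert g A then a x else 0) =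
      single g (a g) \<oplus>\<^bsub>group_algebra G\<^esub> (\<lambda>x. if x \<in> A then a x else 0)"
    using insert.hyps by (auto simp: group_algebra_simps single_def)
  have "(\<lambda>x. if x \<in> A then a x else 0) \<in> carrier kG"
    using insert.prems by (auto simp: group_algebra_simps)
  moreover have "(\<Oplus>\<^bsub>M\<^esub>g\<in>insert g A. scal (a g) (act g x)) =
      scal (a g) (act g x) \<oplus>\<^bsub>M\<^esub> (\<Oplus>\<^bsub>M\<^esub>g\<in>A. scal (a g) (act g x))"
    by (rule M.M.finsum_insert) (use insert x in \<open>auto simp: subset_iff\<close>)
  ultimately show ?case
    unfolding eq using insert x by (simp add: M.smult_l_distr single_closed single_smult)
qed

text \<open>Counting modulo S: each term with P contributes b, the others contribute nothing. The
  count becomes a scalar of k, so only its residue modulo the characteristic matters.\<close>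

lemma finsum_congruence:
  assumes S: "S \<subseteq> carrier M" "\<zero>\<^bsub>M\<^esub> \<in> S"
    and add: "\<And>x y. x \<in> S \<Longrightarrow> y \<in> S \<Longrightarrow> x \<oplus>\<^bsub>M\<^esub> y \<in> S"
    and A: "finite A" and f: "f \<in> A \<rightarrow> carrier M" and b: "b \<in> carrier M"
    and good: "\<And>v. v \<in> A \<Longrightarrow> P v \<Longrightarrow> f v \<ominus>\<^bsub>M\<^esub> b \<in> S"
    and bad: "\<And>v. v \<in> A \<Longrightarrow> \<not> P v \<Longrightarrow> f v \<in> S"
  shows "finsum M f A \<ominus>\<^bsub>M\<^esub> scal (of_nat (card {v \<in> A. P v})) b \<in> S"
  using A f good bad
proof (induction A)
  case empty
  then show ?case using b S by (simp add: M.M.r_neg a_minus_def)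
next
  case (insert v A)
  let ?n = "of_nat (card {v \<in> A. P v}) :: 'k"
  have IH: "finsum M f A \<ominus>\<^bsub>M\<^esub> scal ?n b \<in> S" using insert by auto
  have c: "finsum M f A \<in> carrier M" "f v \<in> carrier M" using insert by (auto intro!: M.M.finsum_closed)
  have sum: "finsum M f (insert v A) = f v \<oplus>\<^bsub>M\<^esub> finsum M f A"
    using insert by (auto intro!: M.M.finsum_insert)
  show ?case
  proof (cases "P v")
    case True
    then have "{w \<in> insert v A. P w} = insert v {w \<in> A. P w}" by auto
    then have "card {w \<in> insert v A. P w} = Suc (card {w \<in> A. P w})"
      using insert by simp
    then have "finsum M f (insert v A) \<ominus>\<^bsub>M\<^esub> scal (of_nat (card {w \<in> insert v A. P w})) b =
        (f v \<ominus>\<^bsub>M\<^esub> b) \<oplus>\<^bsub>M\<^esub> (finsum M f A \<ominus>\<^bsub>M\<^esub> scal ?n b)"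
      using c b by (simp add: sum scal_add_left a_minus_def M.M.minus_add M.M.a_ac)
    then show ?thesis using add IH insert.prems True by simp
  next
    case False
    then have "{w \<in> insert v A. P w} = {w \<in> A. P w}" by auto
    then have "finsum M f (insert v A) \<ominus>\<^bsub>M\<^esub> scal (of_nat (card {w \<in> insert v A. P w})) b =
        f v \<oplus>\<^bsub>M\<^esub> (finsum M f A \<ominus>\<^bsub>M\<^esub> scal ?n b)"
      using c b by (simp add: sum a_minus_def M.M.a_assoc)
    then show ?thesis using add IH insert.prems False by simp
  qed
qed

text \<open>The common core of the averaging arguments. It is applied to the sum over U, to the
  product of two such sums with a conjugation in between, and to the weight elements; in each case
  the number of good terms is invertible in k.\<close>

lemma finsum_congruence_mem:
  assumes S: "S \<subseteq> carrier M" "\<zero>\<^bsub>M\<^esub> \<in> S"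
    and add: "\<And>x y. x \<in> S \<Longrightarrow> y \<in> S \<Longrightarrow> x \<oplus>\<^bsub>M\<^esub> y \<in> S"
    and scal: "\<And>c x. x \<in> S \<Longrightarrow> scal c x \<in> S"
    and A: "finite A" and f: "f \<in> A \<rightarrow> carrier M" and b: "b \<in> carrier M"
    and good: "\<And>v. v \<in> A \<Longrightarrow> P v \<Longrightarrow> f v \<ominus>\<^bsub>M\<^esub> b \<in> S"
    and bad: "\<And>v. v \<in> A \<Longrightarrow> \<not> P v \<Longrightarrow> f v \<in> S"
    and n: "of_nat (card {v \<in> A. P v}) \<noteq> (0 :: 'k)"
    and sum: "finsum M f A \<in> S"
  shows "b \<in> S"
proof -
  let ?n = "of_nat (card {v \<in> A. P v}) :: 'k"
  let ?s = "finsum M f A"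
  have s: "?s \<in> carrier M" using sum S by auto
  have "?s \<ominus>\<^bsub>M\<^esub> scal ?n b \<in> S"
    by (rule finsum_congruence[OF S add A f b good bad])
  \<comment> \<open>The multiple n b is s - (s - n b), a combination of elements of S; division by n
    then yields b.\<close>
  then have "scal (- 1) (?s \<ominus>\<^bsub>M\<^esub> scal ?n b) \<oplus>\<^bsub>M\<^esub> ?s \<in> S"
    using add scal sum by blast
  also have "scal (- 1) (?s \<ominus>\<^bsub>M\<^esub> scal ?n b) \<oplus>\<^bsub>M\<^esub> ?s = scal ?n b"
    using s b by (simp add: scal_minus_left a_minus_def M.M.minus_add M.M.a_ac M.M.r_neg1 M.M.r_neg2 M.M.l_neg)
  finally have "scal (inverse ?n) (scal ?n b) \<in> S" by (rule scal)
  then show ?thesis using n b by (simp add: scal_scal)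
qed

end

section \<open>Composition factors of dimension one\<close>

lemma irreducible_subquotient_iff:
  assumes M: "left_module R M" and A: "Module.submodule A R M" and B: "Module.submodule B R M"
    and AB: "A \<subseteq> B"
  shows "irreducible_module R (quotient_module (M\<lparr>carrier := B\<rparr>) A) \<longleftrightarrow>
     A \<noteq> B \<and> (\<forall>C. Module.submodule C R M \<and> A \<subseteq> C \<and> C \<subseteq> B \<longrightarrow> C = A \<or> C = B)"
proof -
  have N: "left_module R (M\<lparr>carrier := B\<rparr>)" by (rule left_module_submodule[OF M B])
  have "Module.submodule A R (M\<lparr>carrier := B\<rparr>)"
    using submodule_restrict_iff[OF M B] A AB by simp
  from left_module.irreducible_quotient_iff[OF N this] show ?thesis
    using submodule_restrict_iff[OF M B] by auto
qed

text \<open>Irreducibility of the factors becomes a covering relation among submodules of M. In this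
  form a series can be moved along a bijection of M without touching quotients.\<close>

lemma composition_series_iff:
  assumes M: "left_module R M"
  shows "composition_series R M l S \<longleftrightarrow>
     S 0 = {\<zero>\<^bsub>M\<^esub>} \<and> S l = carrier M \<and> (\<forall>i\<le>l. Module.submodule (S i) R M) \<and>
     (\<forall>i<l. S i \<subset> S (Suc i) \<and>
        (\<forall>C. Module.submodule C R M \<and> S i \<subseteq> C \<and> C \<subseteq> S (Suc i) \<longrightarrow> C = S i \<or> C = S (Suc i)))"
proof -
  have *: "S i \<subseteq> S (Suc i) \<and> irreducible_module R (quotient_module (M\<lparr>carrier := S (Suc i)\<rparr>) (S i)) \<longleftrightarrow>
      S i \<subset> S (Suc i) \<and>
        (\<forall>C. Module.submodule C R M \<and> S i \<subseteq> C \<and> C \<subseteq> S (Suc i) \<longrightarrow> C = S i \<or> C = S (Suc i))"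
    if "i < l" "\<forall>i\<le>l. Module.submodule (S i) R M" for i
  proof -
    have "Module.submodule (S i) R M" "Module.submodule (S (Suc i)) R M" using that by auto
    from irreducible_subquotient_iff[OF M this] show ?thesis by blast
  qed
  show ?thesis
    unfolding composition_series_def by (intro conj_cong refl all_cong1 imp_cong *)
qed

context group_algebra_module
begin

text \<open>The character \<chi> occurs as a composition factor, expressed by an eigenvector modulo
  S i instead of an isomorphism with a quotient. This depends on \<chi> only and not on a module
  affording it.\<close>

definition weight_factor :: "('g \<Rightarrow> 'k) \<Rightarrow> bool" where
  "weight_factor \<chi> \<longleftrightarrow> (\<exists>l S i b. composition_series kG M l S \<and> i < l \<and> b \<in> S (Suc i) \<and> b \<notin> S i \<and>
     (\<forall>g\<in>carrier G. act g b \<ominus>\<^bsub>M\<^esub> scal (\<chi> g) b \<in> S i))"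

text \<open>A k-linear bijection that twists the action of G by \<sigma> maps submodules to
  submodules, and so do preimages, since \<sigma> is onto. It therefore carries a composition series
  to a composition series and an eigenvector for \<chi> to one for the twisted character.\<close>

lemma weight_factor_transport:
  assumes bij: "bij_betw \<tau> (carrier M) (carrier M)"
    and add: "\<And>x y. x \<in> carrier M \<Longrightarrow> y \<in> carrier M \<Longrightarrow> \<tau> (x \<oplus>\<^bsub>M\<^esub> y) = \<tau> x \<oplus>\<^bsub>M\<^esub> \<tau> y"
    and scal: "\<And>c x. x \<in> carrier M \<Longrightarrow> \<tau> (scal c x) = scal c (\<tau> x)"
    and act: "\<And>g x. g \<in> carrier G \<Longrightarrow> x \<in> carrier M \<Longrightarrow> \<tau> (act g x) = act (\<sigma> g) (\<tau> x)"
    and \<sigma>: "\<sigma> ` carrier G = carrier G"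
    and \<chi>: "\<And>g. g \<in> carrier G \<Longrightarrow> \<psi> (\<sigma> g) = \<chi> g"
    and wf: "weight_factor \<chi>"
  shows "weight_factor \<psi>"
proof -
  have im: "\<tau> ` carrier M = carrier M" and inj: "inj_on \<tau> (carrier M)"
    using bij by (auto simp: bij_betw_def)
  have clos: "\<tau> x \<in> carrier M" if "x \<in> carrier M" for x using im that by auto
  have zero: "\<tau> \<zero>\<^bsub>M\<^esub> = \<zero>\<^bsub>M\<^esub>"
    using scal[of "\<zero>\<^bsub>M\<^esub>" 0] clos[OF M.M.zero_closed] by simp
  have minus: "\<tau> (x \<ominus>\<^bsub>M\<^esub> y) = \<tau> x \<ominus>\<^bsub>M\<^esub> \<tau> y" if "x \<in> carrier M" "y \<in> carrier M" for x y
    using add[OF that(1), of "\<ominus>\<^bsub>M\<^esub> y"] scal[OF that(2), of "-1"] that clos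
    by (simp add: a_minus_def scal_minus_left)
  have \<sigma>G: "\<sigma> g \<in> carrier G" if "g \<in> carrier G" for g using \<sigma> that by auto
  have image: "Module.submodule (\<tau> ` C) kG M" if C: "Module.submodule C kG M" for C
  proof -
    note C' = submodule_closed[OF C] and C'' = submodule_act[OF C]
    have Cs: "x \<in> carrier M" if "x \<in> C" for x using C'(1) that by auto
    show ?thesis
    proof (rule submodule_actI)
      show "\<tau> ` C \<subseteq> carrier M" using Cs clos by auto
      show "\<zero>\<^bsub>M\<^esub> \<in> \<tau> ` C" using zero C'(2) by force
      show "x \<oplus>\<^bsub>M\<^esub> y \<in> \<tau> ` C" if "x \<in> \<tau> ` C" "y \<in> \<tau> ` C" for x y
        using that add Cs C'(3) by (auto simp flip: add)
      show "scal c x \<in> \<tau> ` C" if "x \<in> \<tau> ` C" for c x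
        using that Cs C''(2) by (auto simp flip: scal)
      show "act g x \<in> \<tau> ` C" if g: "g \<in> carrier G" and x: "x \<in> \<tau> ` C" for g x
      proof -
        obtain h where "h \<in> carrier G" "g = \<sigma> h" using \<sigma> g by blast
        then show ?thesis using x Cs C''(1) by (auto simp flip: act)
      qed
    qed
  qed
  have preimage: "Module.submodule {x \<in> carrier M. \<tau> x \<in> C} kG M" if C: "Module.submodule C kG M" for C
  proof -
    note C' = submodule_closed[OF C] and C'' = submodule_act[OF C]
    show ?thesis
      by (rule submodule_actI) (use zero C' C'' add scal act \<sigma>G in auto)
  qed
  obtain l S i b where cs: "composition_series kG M l S" and i: "i < l"
    and b: "b \<in> S (Suc i)" "b \<notin> S i" and wb: "\<And>g. g \<in> carrier G \<Longrightarrow> act g b \<ominus>\<^bsub>M\<^esub> scal (\<chi> g) b \<in> S i"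
    using wf by (auto simp: weight_factor_def)
  note cs' = cs[unfolded composition_series_iff[OF M.left_module_axioms]]
  have Ss: "S j \<subseteq> carrier M" if "j \<le> l" for j
  proof -
    have "Module.submodule (S j) kG M" using cs' that by simp
    then show ?thesis by (rule submodule_closed(1))
  qed
  \<comment> \<open>A submodule between two consecutive images is pulled back to one between S j and
    S (Suc j), where the covering relation is known.\<close>
  have max: "C = \<tau> ` S j \<or> C = \<tau> ` S (Suc j)"
    if j: "j < l" and C: "Module.submodule C kG M" "\<tau> ` S j \<subseteq> C" "C \<subseteq> \<tau> ` S (Suc j)" for j C
  proof -
    let ?D = "{x \<in> carrier M. \<tau> x \<in> C}"
    have D: "\<tau> ` ?D = C" using im submodule_closed(1)[OF C(1)] by auto
    have "S j \<subseteq> ?D" using C(2) Ss[of j] j by auto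
    moreover have "?D \<subseteq> S (Suc j)"
      using C(3) inj_on_image_mem_iff[OF inj _ Ss[of "Suc j"]] j by auto
    ultimately have "?D = S j \<or> ?D = S (Suc j)"
      using cs' j preimage[OF C(1)] by blast
    then show ?thesis using D by auto
  qed
  have "composition_series kG M l (\<lambda>j. \<tau> ` S j)"
    unfolding composition_series_iff[OF M.left_module_axioms]
  proof (intro conjI allI impI)
    show "\<tau> ` S 0 = {\<zero>\<^bsub>M\<^esub>}" using cs' zero by simp
    show "\<tau> ` S l = carrier M" using cs' im by simp
    show "Module.submodule (\<tau> ` S j) kG M" if "j \<le> l" for j using image cs' that by blast
    show "\<tau> ` S j \<subset> \<tau> ` S (Suc j)" if "j < l" for j
      using cs' that inj_on_subset[OF inj Ss[of "Suc j"]]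
      by (intro image_strict_mono) auto
  qed (use max in auto)
  moreover have "\<tau> b \<in> \<tau> ` S (Suc i)" using b by auto
  moreover have bM: "b \<in> carrier M" using b(1) Ss[of "Suc i"] i by auto
  have "\<tau> b \<notin> \<tau> ` S i" using b(2) inj_on_image_mem_iff[OF inj bM Ss[of i]] i by auto
  moreover have "act g (\<tau> b) \<ominus>\<^bsub>M\<^esub> scal (\<psi> g) (\<tau> b) \<in> \<tau> ` S i" if g: "g \<in> carrier G" for g
  proof -
    obtain h where h: "h \<in> carrier G" "g = \<sigma> h" using \<sigma> g by blast
    have "act g (\<tau> b) \<ominus>\<^bsub>M\<^esub> scal (\<psi> g) (\<tau> b) = \<tau> (act h b \<ominus>\<^bsub>M\<^esub> scal (\<chi> h) b)"
      using h bM by (simp add: minus scal act \<chi>)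
    then show ?thesis using wb[OF h(1)] by simp
  qed
  ultimately show ?thesis using i unfolding weight_factor_def by blast
qed

section \<open>One-dimensional modules and their characters\<close>

lemma one_dimensional_generator:
  assumes "one_dimensional G M"
  shows "\<exists>x0\<in>carrier M. x0 \<noteq> \<zero>\<^bsub>M\<^esub> \<and> (\<forall>x\<in>carrier M. \<exists>c. x = scal c x0)"
proof -
  let ?V = "underlying_space G M"
  have V: "carrier ?V = carrier M" "\<zero>\<^bsub>?V\<^esub> = \<zero>\<^bsub>M\<^esub>" "x \<oplus>\<^bsub>?V\<^esub> y = x \<oplus>\<^bsub>M\<^esub> y" "c \<odot>\<^bsub>?V\<^esub> x = scal c x"
    for x y c
    by (simp_all add: underlying_space_def scal_def group_elem_def single_def if_distrib cong: if_cong)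
  have "\<exists>y\<in>carrier M. x \<oplus>\<^bsub>M\<^esub> y = \<zero>\<^bsub>M\<^esub>" if "x \<in> carrier M" for x
    using M.M.r_neg[OF that] M.M.a_inv_closed[OF that] by blast
  then have "vectorspace class_ring ?V"
    by (intro vs_criteria)
      (auto simp: V class_field class_ring_simps scal_scal scal_add scal_add_left M.M.a_ac)
  then interpret V: vectorspace "class_ring :: 'k ring" ?V .
  have "V.fin_dim" "V.dim = 1"
    using assms by (auto simp: one_dimensional_def kG_module_def)
  then obtain B where B: "finite B" "V.basis B"
    using V.finite_basis_exists by auto
  then obtain x0 where x0: "B = {x0}"
    using V.dim_basis \<open>V.dim = 1\<close> card_1_singletonE by metis
  have x0V: "x0 \<in> carrier M" using B x0 by (simp add: V.basis_def V)
  moreover have "x0 \<noteq> \<zero>\<^bsub>M\<^esub>"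
    using B V.vs_zero_lin_dep[of B] x0 by (auto simp: V.basis_def V)
  moreover have "\<exists>c. x = scal c x0" if "x \<in> carrier M" for x
  proof -
    have "x \<in> V.span {x0}" using B x0 that by (auto simp: V.basis_def V)
    then obtain a where "x = V.lincomb a {x0}"
      using V.finite_span[of "{x0}"] x0V by (auto simp: V)
    then show ?thesis using x0V by (auto simp: V.lincomb_def V)
  qed
  ultimately show ?thesis by blast
qed

lemma scal_inject:
  assumes "x \<in> carrier M" "x \<notin> A" "Module.submodule A kG M" "scal c x \<ominus>\<^bsub>M\<^esub> scal d x \<in> A"
  shows "c = d"
proof (rule ccontr)
  assume "c \<noteq> d"
  have "scal (c - d) x \<in> A" using assms by (simp add: scal_diff)
  then have "scal (inverse (c - d)) (scal (c - d) x) \<in> A"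
    by (rule submodule_act(2)[OF assms(3)])
  then show False using \<open>c \<noteq> d\<close> assms by (simp add: scal_scal)
qed

lemma scal_inject_zero:
  assumes "x \<in> carrier M" "x \<noteq> \<zero>\<^bsub>M\<^esub>" "scal c x = scal d x"
  shows "c = d"
proof (rule scal_inject[OF assms(1)])
  show "Module.submodule {\<zero>\<^bsub>M\<^esub>} kG M" by (rule submodule_actI) auto
  show "scal c x \<ominus>\<^bsub>M\<^esub> scal d x \<in> {\<zero>\<^bsub>M\<^esub>}" using assms by (simp add: a_minus_def M.M.r_neg)
qed (use assms in auto)

lemma one_dimensional_character:
  assumes "one_dimensional G M"
  obtains x0 \<chi> where "x0 \<in> carrier M" "x0 \<noteq> \<zero>\<^bsub>M\<^esub>" "\<And>x. x \<in> carrier M \<Longrightarrow> \<exists>c. x = scal c x0"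
    "\<And>g. g \<in> carrier G \<Longrightarrow> act g x0 = scal (\<chi> g) x0"
    "\<And>g h. g \<in> carrier G \<Longrightarrow> h \<in> carrier G \<Longrightarrow> \<chi> (g \<otimes> h) = \<chi> g * \<chi> h" "\<chi> \<one> = 1"
proof -
  obtain x0 where x0: "x0 \<in> carrier M" "x0 \<noteq> \<zero>\<^bsub>M\<^esub>" and gen: "\<forall>x\<in>carrier M. \<exists>c. x = scal c x0"
    using one_dimensional_generator[OF assms] by blast
  have "\<forall>g\<in>carrier G. \<exists>c. act g x0 = scal c x0" using gen x0 by simp
  then obtain \<chi> where \<chi>: "\<And>g. g \<in> carrier G \<Longrightarrow> act g x0 = scal (\<chi> g) x0" by metis
  have "\<chi> (g \<otimes> h) = \<chi> g * \<chi> h" if gh: "g \<in> carrier G" "h \<in> carrier G" for g h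
  proof (rule scal_inject_zero[OF x0])
    have "scal (\<chi> (g \<otimes> h)) x0 = act g (act h x0)" using gh x0 by (simp add: \<chi>[symmetric] act_act)
    also have "\<dots> = scal (\<chi> g * \<chi> h) x0"
      using gh x0 by (simp add: \<chi> act_scal scal_scal mult.commute)
    finally show "scal (\<chi> (g \<otimes> h)) x0 = scal (\<chi> g * \<chi> h) x0" .
  qed
  moreover have "\<chi> \<one> = 1"
    by (rule scal_inject_zero[OF x0]) (use x0 \<chi>[of \<one>] in simp)
  ultimately show thesis using that x0 gen \<chi> by blast
qed

text \<open>An isomorphism yields b as a representative of the image of x0. Conversely, sending c x0
  to the coset of c b is well defined because x0 is nonzero, injective because b is not in A, and
  onto because its image is a nonzero submodule of an irreducible quotient. Thus the dimension of
  the quotient is a consequence and not an assumption.\<close>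

lemma left_iso_quotient_iff:
  fixes X :: "('g \<Rightarrow> 'k, 'x, 'e) module_scheme"
  assumes X: "group_algebra_module G X"
    and x0: "x0 \<in> carrier X" "x0 \<noteq> \<zero>\<^bsub>X\<^esub>"
    and gen: "\<And>x. x \<in> carrier X \<Longrightarrow> \<exists>c. x = group_algebra_module.scal G X c x0"
    and \<chi>: "\<And>g. g \<in> carrier G \<Longrightarrow> group_algebra_module.act X g x0 = group_algebra_module.scal G X (\<chi> g) x0"
    and A: "Module.submodule A kG M"
    and irr: "irreducible_module kG (quotient_module M A)"
  shows "left_iso kG X (quotient_module M A) \<longleftrightarrow>
    (\<exists>b\<in>carrier M - A. \<forall>g\<in>carrier G. act g b \<ominus>\<^bsub>M\<^esub> scal (\<chi> g) b \<in> A)"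
proof -
  let ?Q = "quotient_module M A"
  interpret X: group_algebra_module G X by fact
  have Q: "left_module kG ?Q" by (rule M.left_module_quotient[OF A])
  interpret Q: left_module kG ?Q by fact
  note Qs = M.quotient_module_simps[OF A] and Qadd = M.quotient_module_add[OF A]
    and Qsmult = M.quotient_module_smult[OF A] and eq = M.coset_eq_iff[OF A]
    and eq0 = M.coset_eq_zero_iff[OF A]
  have Qact: "group_elem g \<odot>\<^bsub>?Q\<^esub> (A +>\<^bsub>M\<^esub> b) = A +>\<^bsub>M\<^esub> act g b" if "g \<in> carrier G" "b \<in> carrier M" for g b
    using that by (simp add: group_elem_eq_single Qsmult single_closed act_def)
  have Qscal: "single \<one> c \<odot>\<^bsub>?Q\<^esub> (A +>\<^bsub>M\<^esub> b) = A +>\<^bsub>M\<^esub> scal c b" if "b \<in> carrier M" for c b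
    using that by (simp add: Qsmult single_closed scal_def)
  show ?thesis
  proof
    assume "left_iso kG X ?Q"
    then obtain f where f: "f \<in> left_hom kG X ?Q" "bij_betw f (carrier X) (carrier ?Q)"
      by (auto simp: left_iso_def)
    note f' = left_homD[OF f(1)]
    obtain b where b: "b \<in> carrier M" "f x0 = A +>\<^bsub>M\<^esub> b"
      using f'(1)[OF x0(1)] by (auto simp: Qs)
    have "f \<zero>\<^bsub>X\<^esub> = A"
      using left_hom_zero[OF X.M.left_module_axioms Q f(1)] by (simp add: Qs)
    then have "f x0 \<noteq> A"
      using f(2) x0 X.M.M.zero_closed by (metis bij_betw_inv_into_left)
    then have "b \<notin> A" using b eq0 by simp
    moreover have "act g b \<ominus>\<^bsub>M\<^esub> scal (\<chi> g) b \<in> A" if g: "g \<in> carrier G" for g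
    proof -
      have "A +>\<^bsub>M\<^esub> act g b = f (X.act g x0)"
        using g b x0 by (simp add: X.act_def f' Qact group_elem_eq_single single_closed flip: Qact)
      also have "\<dots> = A +>\<^bsub>M\<^esub> scal (\<chi> g) b"
        using g b x0 by (simp add: \<chi> X.scal_def f' single_closed Qscal)
      finally show ?thesis using eq g b by simp
    qed
    ultimately show "\<exists>b\<in>carrier M - A. \<forall>g\<in>carrier G. act g b \<ominus>\<^bsub>M\<^esub> scal (\<chi> g) b \<in> A"
      using b by blast
  next
    assume "\<exists>b\<in>carrier M - A. \<forall>g\<in>carrier G. act g b \<ominus>\<^bsub>M\<^esub> scal (\<chi> g) b \<in> A"
    then obtain b where b: "b \<in> carrier M" "b \<notin> A"
      and wb: "\<And>g. g \<in> carrier G \<Longrightarrow> act g b \<ominus>\<^bsub>M\<^esub> scal (\<chi> g) b \<in> A" by blast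
    define f where "f = (\<lambda>x\<in>carrier X. A +>\<^bsub>M\<^esub> scal (SOME c. x = X.scal c x0) b)"
    have f: "f (X.scal c x0) = A +>\<^bsub>M\<^esub> scal c b" for c
    proof -
      have "(SOME d. X.scal c x0 = X.scal d x0) = c"
        by (rule some_equality) (use X.scal_inject_zero[OF x0] in auto)
      then show ?thesis using x0 by (simp add: f_def)
    qed
    have f_single: "f (single g c \<odot>\<^bsub>X\<^esub> x) = single g c \<odot>\<^bsub>?Q\<^esub> f x"
      if g: "g \<in> carrier G" and x: "x \<in> carrier X" for g c x
    proof -
      obtain d where d: "x = X.scal d x0" using gen[OF x] by auto
      have "single g c \<odot>\<^bsub>X\<^esub> x = X.scal (c * d * \<chi> g) x0"
        using g x0 by (simp add: d X.single_smult X.act_scal \<chi> X.scal_scal mult.assoc)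
      moreover have "single g c \<odot>\<^bsub>?Q\<^esub> f x = A +>\<^bsub>M\<^esub> scal (c * d) (act g b)"
        using g b by (simp add: d f Qsmult single_closed single_smult act_scal scal_scal)
      moreover have "scal (c * d) (act g b) \<ominus>\<^bsub>M\<^esub> scal (c * d * \<chi> g) b \<in> A"
        using submodule_act(2)[OF A wb[OF g], of "c * d"] g b
        by (simp add: a_minus_def scal_add scal_minus scal_scal)
      then have "A +>\<^bsub>M\<^esub> scal (c * d) (act g b) = A +>\<^bsub>M\<^esub> scal (c * d * \<chi> g) b"
        using eq g b by simp
      ultimately show ?thesis by (simp only: f)
    qed
    have fQ: "f x \<in> carrier ?Q" if x: "x \<in> carrier X" for x
    proof -
      obtain c where "x = X.scal c x0" using gen[OF x] by auto
      then have "f x = A +>\<^bsub>M\<^esub> scal c b" by (simp only: f)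
      then show ?thesis using b scal_closed[of b c] unfolding Qs by blast
    qed
    have f_add: "f (x \<oplus>\<^bsub>X\<^esub> y) = f x \<oplus>\<^bsub>?Q\<^esub> f y" if xy: "x \<in> carrier X" "y \<in> carrier X" for x y
    proof -
      obtain c d where cd: "x = X.scal c x0" "y = X.scal d x0" using gen[OF xy(1)] gen[OF xy(2)] by auto
      then have "x \<oplus>\<^bsub>X\<^esub> y = X.scal (c + d) x0" using x0 by (simp add: X.scal_add_left)
      then show ?thesis using cd b by (simp add: f Qadd scal_add_left)
    qed
    have f0: "f \<zero>\<^bsub>X\<^esub> = \<zero>\<^bsub>?Q\<^esub>"
    proof -
      have "A +>\<^bsub>M\<^esub> \<zero>\<^bsub>M\<^esub> = A" using eq0[of "\<zero>\<^bsub>M\<^esub>"] submodule_closed(2)[OF A] by simp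
      then show ?thesis using f[of 0] x0 b by (simp add: Qs)
    qed
    have f_smult: "f (a \<odot>\<^bsub>X\<^esub> x) = a \<odot>\<^bsub>?Q\<^esub> f x" if a: "a \<in> carrier kG" and x: "x \<in> carrier X" for a x
    proof (rule group_algebra_induct[OF fin a])
      show "f ((\<lambda>x. 0) \<odot>\<^bsub>X\<^esub> x) = (\<lambda>x. 0) \<odot>\<^bsub>?Q\<^esub> f x"
        using X.M.smult_l_null[OF x] Q.smult_l_null[OF fQ[OF x]] f0 by (simp add: group_algebra_simps)
      show "f ((a \<oplus>\<^bsub>kG\<^esub> a') \<odot>\<^bsub>X\<^esub> x) = (a \<oplus>\<^bsub>kG\<^esub> a') \<odot>\<^bsub>?Q\<^esub> f x"
        if "a \<in> carrier kG" "a' \<in> carrier kG" "f (a \<odot>\<^bsub>X\<^esub> x) = a \<odot>\<^bsub>?Q\<^esub> f x"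
          "f (a' \<odot>\<^bsub>X\<^esub> x) = a' \<odot>\<^bsub>?Q\<^esub> f x" for a a'
        using that x fQ[OF x] by (simp add: X.M.smult_l_distr Q.smult_l_distr f_add X.M.smult_closed)
    qed (rule f_single[OF _ x])
    have hom: "f \<in> left_hom kG X ?Q"
      unfolding left_hom_def using fQ f_add f_smult by (auto simp: f_def)
    have "inj_on f (carrier X)"
    proof (rule inj_onI)
      fix x y assume xy: "x \<in> carrier X" "y \<in> carrier X" "f x = f y"
      obtain c d where cd: "x = X.scal c x0" "y = X.scal d x0" using gen[OF xy(1)] gen[OF xy(2)] by auto
      then have "scal c b \<ominus>\<^bsub>M\<^esub> scal d b \<in> A" using xy(3) f eq b by simp
      then have "c = d" by (rule scal_inject[OF b A])
      then show "x = y" using cd by simp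
    qed
    moreover have "f ` carrier X = carrier ?Q"
    proof -
      have "Module.submodule (f ` carrier X) kG ?Q"
      proof (rule Q.submoduleI)
        show "f ` carrier X \<subseteq> carrier ?Q" using fQ by auto
        show "\<zero>\<^bsub>?Q\<^esub> \<in> f ` carrier X" using f0 X.M.M.zero_closed by (metis imageI)
        show "x \<oplus>\<^bsub>?Q\<^esub> y \<in> f ` carrier X" if "x \<in> f ` carrier X" "y \<in> f ` carrier X" for x y
          using that X.M.M.a_closed by (auto simp flip: f_add)
        show "a \<odot>\<^bsub>?Q\<^esub> x \<in> f ` carrier X" if "a \<in> carrier kG" "x \<in> f ` carrier X" for a x
          using that X.M.smult_closed by (auto simp flip: f_smult)
      qed
      moreover have "f x0 \<noteq> \<zero>\<^bsub>?Q\<^esub>"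
        using f[of 1] x0 b eq0 by (simp add: Qs)
      ultimately show ?thesis
        using irr x0(1) unfolding irreducible_module_def by blast
    qed
    ultimately show "left_iso kG X ?Q"
      using hom by (auto simp: left_iso_def bij_betw_def)
  qed
qed

lemma composition_factor_iff_weight_factor:
  fixes X :: "('g \<Rightarrow> 'k, 'x, 'e) module_scheme"
  assumes X: "group_algebra_module G X"
    and x0: "x0 \<in> carrier X" "x0 \<noteq> \<zero>\<^bsub>X\<^esub>"
    and gen: "\<And>x. x \<in> carrier X \<Longrightarrow> \<exists>c. x = group_algebra_module.scal G X c x0"
    and \<chi>: "\<And>g. g \<in> carrier G \<Longrightarrow> group_algebra_module.act X g x0 = group_algebra_module.scal G X (\<chi> g) x0"
  shows "composition_factor kG X M \<longleftrightarrow> weight_factor \<chi>"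
proof -
  have "left_iso kG X (quotient_module (M\<lparr>carrier := S (Suc i)\<rparr>) (S i)) \<longleftrightarrow>
      (\<exists>b. b \<in> S (Suc i) \<and> b \<notin> S i \<and> (\<forall>g\<in>carrier G. act g b \<ominus>\<^bsub>M\<^esub> scal (\<chi> g) b \<in> S i))"
    if cs: "composition_series kG M l S" and i: "i < l" for l S i
  proof -
    have S: "Module.submodule (S i) kG M" "Module.submodule (S (Suc i)) kG M" "S i \<subseteq> S (Suc i)"
      "irreducible_module kG (quotient_module (M\<lparr>carrier := S (Suc i)\<rparr>) (S i))"
      using cs i by (auto simp: composition_series_def)
    let ?N = "M\<lparr>carrier := S (Suc i)\<rparr>"
    interpret N: group_algebra_module G ?N
      using left_module_submodule[OF M.left_module_axioms S(2)] fin G.group_axioms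
      by (simp add: group_algebra_module_def group_algebra_module_axioms_def)
    note S' = submodule_closed[OF S(2)]
    \<comment> \<open>Additive inverses are defined relative to the carrier, so those of the
      submodule and of M have to be identified before differences can be compared.\<close>
    have inv: "\<ominus>\<^bsub>?N\<^esub> x = \<ominus>\<^bsub>M\<^esub> x" if "x \<in> S (Suc i)" for x
      by (rule N.M.M.minus_equality) (use that S' M.M.l_neg in auto)
    have ops: "N.act g x = act g x" "N.scal c x = scal c x" for g c x
      by (simp_all add: N.act_def act_def N.scal_def scal_def)
    have sA: "Module.submodule (S i) kG ?N"
      using submodule_restrict_iff[OF M.left_module_axioms S(2)] S by blast
    have "act g b \<ominus>\<^bsub>?N\<^esub> scal (\<chi> g) b = act g b \<ominus>\<^bsub>M\<^esub> scal (\<chi> g) b"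
      if "b \<in> S (Suc i)" "g \<in> carrier G" for b g
      using that submodule_act(2)[OF S(2)] by (simp add: a_minus_def inv)
    with N.left_iso_quotient_iff[OF X x0 gen \<chi> sA S(4)] show ?thesis
      by (auto simp: ops)
  qed
  then show ?thesis
    unfolding composition_factor_def weight_factor_def by blast
qed

end

section \<open>Groups with a split BN-pair\<close>

definition double_coset :: "('g, 'm) monoid_scheme \<Rightarrow> 'g set \<Rightarrow> 'g \<Rightarrow> 'g set" where
  "double_coset G B n = {b \<otimes>\<^bsub>G\<^esub> n \<otimes>\<^bsub>G\<^esub> c | b c. b \<in> B \<and> c \<in> B}"

lemma (in group) double_coset_mult:
  assumes "subgroup B G" "b \<in> B" "c \<in> B" "n \<in> carrier G" "x \<in> double_coset G B n"
  shows "b \<otimes> x \<otimes> c \<in> double_coset G B n"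
proof -
  interpret B: subgroup B G by fact
  obtain d e where "d \<in> B" "e \<in> B" "x = d \<otimes> n \<otimes> e"
    using assms by (auto simp: double_coset_def)
  then have "b \<otimes> x \<otimes> c = (b \<otimes> d) \<otimes> n \<otimes> (e \<otimes> c)" "b \<otimes> d \<in> B" "e \<otimes> c \<in> B"
    using assms B.mem_carrier by (auto simp: m_assoc)
  then show ?thesis unfolding double_coset_def by blast
qed

lemma (in group) pow_conj:
  assumes "g \<in> carrier G" "x \<in> carrier G"
  shows "(g \<otimes> x \<otimes> inv g) [^] (i::nat) = g \<otimes> x [^] i \<otimes> inv g"
proof (induction i)
  case (Suc i)
  have "inv g \<otimes> (g \<otimes> (x \<otimes> inv g)) = x \<otimes> inv g"
    using assms by (simp add: m_assoc[symmetric])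
  then show ?case using Suc assms by (simp add: m_assoc)
qed (use assms in simp)

text \<open>Cauchy's theorem: if r divided the order of H, Sylow's theorem with exponent 1 would
  give a subgroup of order r, and the order of a nontrivial element of it would divide both r and
  m.\<close>

lemma (in group) card_exponent_coprime:
  assumes H: "subgroup H G" "finite H" and r: "prime r" "\<not> r dvd m"
    and exponent: "\<And>x. x \<in> H \<Longrightarrow> x [^] (m::nat) = \<one>"
  shows "\<not> r dvd card H"
proof
  assume "r dvd card H"
  then obtain k where k: "Coset.order (G\<lparr>carrier := H\<rparr>) = r ^ 1 * k" by (auto simp: Coset.order_def)
  have grp: "group (G\<lparr>carrier := H\<rparr>)" by (rule subgroup.subgroup_is_group[OF H(1) is_group])
  obtain K where K: "subgroup K (G\<lparr>carrier := H\<rparr>)" "card K = r"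
    using sylow_thm[OF r(1) grp k] H(2) by auto
  have KH: "K \<subseteq> H" using subgroup.subset[OF K(1)] by simp
  have KG: "subgroup K G" by (rule incl_subgroup[OF H(1) K(1)])
  have "K \<noteq> {\<one>}" using K(2) r(1) by auto
  then obtain x where x: "x \<in> K" "x \<noteq> \<one>" using subgroup.one_closed[OF KG] by blast
  have xG: "x \<in> carrier G" using x subgroup.mem_carrier[OF KG] by simp
  have "group (G\<lparr>carrier := K\<rparr>)" by (rule subgroup.subgroup_is_group[OF KG is_group])
  then have "x [^]\<^bsub>G\<lparr>carrier := K\<rparr>\<^esub> r = \<one>"
    using group.pow_order_eq_1[of "G\<lparr>carrier := K\<rparr>" x] x K(2) by (simp add: Coset.order_def)
  then have "x [^] r = \<one>" by (metis nat_pow_consistent)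
  then have "ord x dvd r" using xG pow_eq_id by simp
  moreover have "ord x dvd m" using exponent x KH xG pow_eq_id by auto
  moreover have "coprime r m" using r prime_imp_coprime by blast
  ultimately have "ord x = 1" by (metis coprime_common_divisor_nat)
  then show False using x(2) xG pow_eq_id[OF xG, of 1] by simp
qed

section \<open>Elementwise form of the BN-pair axioms and the Bruhat decomposition\<close>

locale BN_group = group G for G (structure) +
  fixes B N
  assumes BN: "BN_pair G B N"
begin

sublocale B: subgroup B G using BN by (simp add: BN_pair_def)
sublocale N: subgroup N G using BN by (simp add: BN_pair_def)

abbreviation "T \<equiv> B \<inter> N"
abbreviation "GN \<equiv> G\<lparr>carrier := N\<rparr>"
abbreviation "W \<equiv> GN Mod T"

lemma T_normal: "T \<lhd> GN" using BN by (simp add: BN_pair_def)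

lemma T_subgroup: "subgroup T G"
  using subgroups_Inter_pair[OF B.subgroup_axioms N.subgroup_axioms] .

lemma conj_T: "n \<in> N \<Longrightarrow> t \<in> T \<Longrightarrow> n \<otimes> t \<otimes> inv n \<in> T"
  using normal.inv_op_closed2[OF T_normal, of n t] m_inv_consistent[OF N.subgroup_axioms] by simp

lemma conj_T': "n \<in> N \<Longrightarrow> t \<in> T \<Longrightarrow> inv n \<otimes> t \<otimes> n \<in> T"
  using conj_T[of "inv n" t] by simp

lemma coset_GN [simp]: "T #>\<^bsub>GN\<^esub> n = T #> n"
  by (simp add: r_coset_def)

lemma coset_N: "T #> n = {t \<otimes> n | t. t \<in> T}"
  by (auto simp: r_coset_def)

lemma coset_self: "n \<in> N \<Longrightarrow> n \<in> T #> n"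
  by (rule rcos_self[OF _ T_subgroup]) simp

lemma carrier_W: "carrier W = {T #> n | n. n \<in> N}"
  by (auto simp: FactGroup_def RCOSETS_def)

lemma carrier_W_eq: "w \<in> carrier W \<Longrightarrow> n \<in> w \<Longrightarrow> n \<in> N \<and> w = T #> n"
proof -
  assume "w \<in> carrier W" "n \<in> w"
  then obtain m where m: "m \<in> N" "w = T #> m" by (auto simp: carrier_W)
  have T: "subgroup T GN" using T_normal by (rule normal_imp_subgroup)
  have GN: "group GN" by (rule N.subgroup_is_group[OF is_group])
  have "n \<in> N" using \<open>n \<in> w\<close> m by (auto simp: coset_N)
  then show ?thesis
    using group.repr_independence[OF GN, of n T m] T m \<open>n \<in> w\<close> by simp
qed

lemma W_mult:
  "n \<in> N \<Longrightarrow> m \<in> N \<Longrightarrow> (T #> n) \<otimes>\<^bsub>W\<^esub> (T #> m) = T #> (n \<otimes> m)"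
  using normal.rcos_sum[OF T_normal, of n m] by (simp add: FactGroup_def)

lemma W_inv:
  "n \<in> N \<Longrightarrow> inv\<^bsub>W\<^esub> (T #> n) = T #> (inv n)"
  using normal.inv_FactGroup[OF T_normal, of "T #> n"] normal.rcos_inv[OF T_normal, of n]
    m_inv_consistent[OF N.subgroup_axioms] by (auto simp: carrier_W)

text \<open>The BN-pair axioms for the simple reflections, restated for elements of N instead of
  cosets of T. Generation is phrased as an induction principle over T, \<Sigma> and products;
  inverses do not appear in it because \<Sigma> is closed under them.\<close>

definition is_generators :: "'a set \<Rightarrow> bool" where
  "is_generators \<Sigma> \<longleftrightarrow> \<Sigma> \<subseteq> N \<and>
     (\<forall>P. (\<forall>n\<in>T. P n) \<longrightarrow> (\<forall>n\<in>\<Sigma>. P n) \<longrightarrow> (\<forall>n\<in>N. \<forall>m\<in>N. P n \<longrightarrow> P m \<longrightarrow> P (n \<otimes> m)) \<longrightarrow> (\<forall>n\<in>N. P n)) \<and>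
     (\<forall>n\<in>\<Sigma>. \<forall>m\<in>N. \<forall>b\<in>B. n \<otimes> b \<otimes> m \<in> double_coset G B m \<union> double_coset G B (n \<otimes> m)) \<and>
     (\<forall>n\<in>\<Sigma>. inv n \<in> \<Sigma> \<and> inv n \<in> double_coset G B n)"

text \<open>The union of the cosets in S serves as \<Sigma>.\<close>

lemma ex_generators: "\<exists>\<Sigma>. is_generators \<Sigma>"
proof -
  from BN have "\<exists>S \<subseteq> carrier W.
        generate W S = carrier W \<and>
        (\<forall>s\<in>S. s \<noteq> \<one>\<^bsub>W\<^esub> \<and> s \<otimes>\<^bsub>W\<^esub> s = \<one>\<^bsub>W\<^esub>) \<and>
        (\<forall>s\<in>S. \<forall>w\<in>carrier W.
           s <#> B <#> w \<subseteq> (B <#> w <#> B) \<union> (B <#> (s \<otimes>\<^bsub>W\<^esub> w) <#> B)) \<and>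
        (\<forall>s\<in>S. s <#> B <#> s \<noteq> B)"
    by (simp only: BN_pair_def Let_def)
  then obtain S where S: "S \<subseteq> carrier W" "generate W S = carrier W"
    and "\<forall>s\<in>S. s \<noteq> \<one>\<^bsub>W\<^esub> \<and> s \<otimes>\<^bsub>W\<^esub> s = \<one>\<^bsub>W\<^esub>"
    and "\<forall>s\<in>S. \<forall>w\<in>carrier W.
           s <#> B <#> w \<subseteq> (B <#> w <#> B) \<union> (B <#> (s \<otimes>\<^bsub>W\<^esub> w) <#> B)"
    by (elim exE conjE)
  then have invol: "\<And>s. s \<in> S \<Longrightarrow> s \<otimes>\<^bsub>W\<^esub> s = \<one>\<^bsub>W\<^esub>"
    and ax: "\<And>s w. s \<in> S \<Longrightarrow> w \<in> carrier W \<Longrightarrow>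
           s <#> B <#> w \<subseteq> (B <#> w <#> B) \<union> (B <#> (s \<otimes>\<^bsub>W\<^esub> w) <#> B)"
    by simp_all
  interpret W: group W by (rule normal.factorgroup_is_group[OF T_normal])
  have Sinv: "inv\<^bsub>W\<^esub> s = s" if "s \<in> S" for s
    using invol[OF that] S(1) that W.inv_equality by blast
  have SN: "s = T #> n" "n \<in> N" if "s \<in> S" "n \<in> s" for s n
    using carrier_W_eq[of s n] S(1) that by auto
  \<comment> \<open>The factor T in B T m B is absorbed by B.\<close>
  have dc: "x \<in> double_coset G B m" if x: "x \<in> B <#> (T #> m) <#> B" and m: "m \<in> N" for x m
  proof -
    obtain b t c where *: "b \<in> B" "t \<in> T" "c \<in> B" "x = b \<otimes> (t \<otimes> m) \<otimes> c"
      using x by (auto simp: coset_N set_mult_def)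
    then have "x = (b \<otimes> t) \<otimes> m \<otimes> c" "b \<otimes> t \<in> B"
      using m by (auto simp: m_assoc)
    then show ?thesis using * unfolding double_coset_def by blast
  qed
  have step: "n \<otimes> b \<otimes> m \<in> double_coset G B m \<union> double_coset G B (n \<otimes> m)"
    if n: "n \<in> \<Union>S" and m: "m \<in> N" and b: "b \<in> B" for n m b
  proof -
    obtain s where s: "s \<in> S" "n \<in> s" using n by auto
    note s' = SN[OF s]
    let ?w = "T #> m"
    have w: "?w \<in> carrier W" using m by (auto simp: carrier_W)
    have "m \<in> ?w" using m by (rule coset_self)
    then have "n \<otimes> b \<otimes> m \<in> s <#> B <#> ?w" using s(2) b by (auto simp: set_mult_def)
    then have "n \<otimes> b \<otimes> m \<in> (B <#> ?w <#> B) \<union> (B <#> (s \<otimes>\<^bsub>W\<^esub> ?w) <#> B)"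
      using ax[OF s(1) w] by (rule rev_subsetD)
    then have "n \<otimes> b \<otimes> m \<in> B <#> ?w <#> B \<or> n \<otimes> b \<otimes> m \<in> B <#> (T #> (n \<otimes> m)) <#> B"
      using W_mult[OF s'(2) m] by (simp add: s'(1))
    then show ?thesis using dc m s'(2) by blast
  qed
  \<comment> \<open>As s is an involution of W, the inverse of n lies in the same coset T n and has
    the form t n with t in T.\<close>
  have inv: "inv n \<in> \<Union>S \<and> inv n \<in> double_coset G B n" if n: "n \<in> \<Union>S" for n
  proof -
    obtain s where s: "s \<in> S" "n \<in> s" using n by auto
    note s' = SN[OF s]
    have "inv n \<in> T #> (inv n)"
      using s'(2) by (intro coset_self) simp
    then have *: "inv n \<in> s" using Sinv[OF s(1)] W_inv[OF s'(2)] s'(1) by simp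
    then obtain t where "t \<in> T" "inv n = t \<otimes> n" using s'(1) by (auto simp: coset_N)
    then have "inv n = t \<otimes> n \<otimes> \<one>" "t \<in> B" using s'(2) by auto
    then have "inv n \<in> double_coset G B n" using B.one_closed unfolding double_coset_def by blast
    then show ?thesis using * s(1) by blast
  qed
  have induct: "\<forall>n\<in>N. P n" if T: "\<forall>n\<in>T. P n" and \<Sigma>: "\<forall>n\<in>\<Union>S. P n"
    and mult: "\<forall>n\<in>N. \<forall>m\<in>N. P n \<longrightarrow> P m \<longrightarrow> P (n \<otimes> m)" for P
  proof -
    have "\<forall>n\<in>w. P n" if "w \<in> generate W S" for w
      using that
    proof induction
      case one
      then show ?case using T by (simp add: FactGroup_def)
    next
      case (incl h)
      then show ?case using \<Sigma> by blast
    next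
      case (inv h)
      then show ?case using \<Sigma> Sinv by auto
    next
      case (eng v w)
      have vw: "v \<in> carrier W" "w \<in> carrier W" using eng S by auto
      show ?case
      proof
        fix n assume "n \<in> v \<otimes>\<^bsub>W\<^esub> w"
        then obtain x y where "x \<in> v" "y \<in> w" "n = x \<otimes> y"
          by (auto simp: FactGroup_def set_mult_def)
        then show "P n" using mult eng.IH carrier_W_eq[OF vw(1)] carrier_W_eq[OF vw(2)] by blast
      qed
    qed
    moreover have "T #> n \<in> generate W S" if "n \<in> N" for n
      using S(2) that by (auto simp: carrier_W)
    ultimately show ?thesis using coset_self by blast
  qed
  have "is_generators (\<Union>S)"
    unfolding is_generators_def
  proof (intro conjI allI impI)
    show "\<Union>S \<subseteq> N" using SN by blast
    show "\<forall>n\<in>\<Union>S. \<forall>m\<in>N. \<forall>b\<in>B. n \<otimes> b \<otimes> m \<in> double_coset G B m \<union> double_coset G B (n \<otimes> m)"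
      by (intro ballI step)
    show "\<forall>n\<in>\<Union>S. inv n \<in> \<Union>S \<and> inv n \<in> double_coset G B n"
      by (intro ballI inv)
  qed (rule induct)
  then show ?thesis by blast
qed

definition generators :: "'a set" where
  "generators = (SOME \<Sigma>. is_generators \<Sigma>)"

lemma is_generators_generators: "is_generators generators"
  unfolding generators_def using ex_generators by (rule someI_ex)

lemmas generators_props = is_generators_generators[unfolded is_generators_def]

lemma generators_N: "n \<in> generators \<Longrightarrow> n \<in> N"
  using conjunct1[OF generators_props] by (rule subsetD)

lemma N_induct [consumes 1, case_names T gen mult]:
  assumes n: "n \<in> N" and "\<And>t. t \<in> T \<Longrightarrow> P t" "\<And>n. n \<in> generators \<Longrightarrow> P n"
    "\<And>n m. n \<in> N \<Longrightarrow> m \<in> N \<Longrightarrow> P n \<Longrightarrow> P m \<Longrightarrow> P (n \<otimes> m)"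
  shows "P n"
proof -
  have "(\<forall>n\<in>T. P n) \<longrightarrow> (\<forall>n\<in>generators. P n) \<longrightarrow>
      (\<forall>n\<in>N. \<forall>m\<in>N. P n \<longrightarrow> P m \<longrightarrow> P (n \<otimes> m)) \<longrightarrow> (\<forall>n\<in>N. P n)"
    by (rule spec[OF conjunct1[OF conjunct2[OF generators_props]]])
  moreover have "\<forall>n\<in>T. P n" by (intro ballI assms(2))
  moreover have "\<forall>n\<in>generators. P n" by (intro ballI assms(3))
  moreover have "\<forall>n\<in>N. \<forall>m\<in>N. P n \<longrightarrow> P m \<longrightarrow> P (n \<otimes> m)" by (intro ballI impI assms(4))
  ultimately show ?thesis using n by blast
qed

lemma generators_mult:
  assumes "n \<in> generators" "m \<in> N" "b \<in> B"
  shows "n \<otimes> b \<otimes> m \<in> double_coset G B m \<or> n \<otimes> b \<otimes> m \<in> double_coset G B (n \<otimes> m)"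
  using conjunct1[OF conjunct2[OF conjunct2[OF generators_props]], rule_format, OF assms] by simp

lemma generators_inv:
  assumes "n \<in> generators"
  shows "inv n \<in> generators" "inv n \<in> double_coset G B n"
  using bspec[OF conjunct2[OF conjunct2[OF conjunct2[OF generators_props]]] assms] by simp_all

lemma double_coset_one: "double_coset G B \<one> = B"
proof
  show "B \<subseteq> double_coset G B \<one>"
  proof
    fix b assume "b \<in> B"
    then have "b = b \<otimes> \<one> \<otimes> \<one>" by auto
    then show "b \<in> double_coset G B \<one>" using \<open>b \<in> B\<close> B.one_closed unfolding double_coset_def by blast
  qed
qed (auto simp: double_coset_def)

text \<open>The multiplication axiom with m = n^-1, together with B n^-1 B = B n B. That only the
  two double cosets B and B n B occur is what makes the relation for e n e n^-1 quadratic.\<close>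

lemma generators_conj:
  assumes n: "n \<in> generators" and b: "b \<in> B"
  shows "n \<otimes> b \<otimes> inv n \<in> B \<union> double_coset G B n" "inv n \<otimes> b \<otimes> n \<in> B \<union> double_coset G B n"
proof -
  have nN: "n \<in> N" and nG: "n \<in> carrier G" using generators_N[OF n] by auto
  obtain c d where cd: "c \<in> B" "d \<in> B" "inv n = c \<otimes> n \<otimes> d"
    using generators_inv(2)[OF n] by (auto simp: double_coset_def)
  \<comment> \<open>Since n^-1 lies in B n B, so does all of B n^-1 B.\<close>
  have sub: "double_coset G B (inv n) \<subseteq> double_coset G B n"
    using double_coset_mult[OF B.subgroup_axioms _ _ nG generators_inv(2)[OF n]]
    by (auto simp: double_coset_def[of G B "inv n"])
  show "n \<otimes> b \<otimes> inv n \<in> B \<union> double_coset G B n"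
    using generators_mult[OF n N.m_inv_closed[OF nN] b] sub nG by (auto simp: double_coset_one)
  show "inv n \<otimes> b \<otimes> n \<in> B \<union> double_coset G B n"
    using generators_mult[OF generators_inv(1)[OF n] nN b] nG by (auto simp: double_coset_one)
qed

text \<open>As B and N generate G and B N B contains the identity, it suffices that B N B is stable
  under left multiplication by B and by N. For a generator this is the multiplication axiom, and
  \<open>N_induct\<close> extends it to N.\<close>

lemma Bruhat:
  assumes g: "g \<in> carrier G"
  shows "\<exists>n\<in>N. g \<in> double_coset G B n"
proof -
  define D where "D = (\<Union>n\<in>N. double_coset G B n)"
  have DG: "D \<subseteq> carrier G" by (auto simp: D_def double_coset_def)
  have B: "b \<otimes> x \<otimes> c \<in> D" if bc: "b \<in> B" "c \<in> B" and x: "x \<in> D" for b c x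
  proof -
    obtain n where "n \<in> N" "x \<in> double_coset G B n" using x by (auto simp: D_def)
    then show ?thesis
      using double_coset_mult[OF B.subgroup_axioms bc, of n x] by (auto simp: D_def)
  qed
  have Bl: "b \<otimes> x \<in> D" if b: "b \<in> B" and x: "x \<in> D" for b x
  proof -
    have "b \<otimes> x \<in> carrier G" using b x DG by auto
    then show ?thesis using B[OF b B.one_closed x] by simp
  qed
  have N: "\<forall>x\<in>D. n \<otimes> x \<in> D" if "n \<in> N" for n
    using that
  proof (induction n rule: N_induct)
    case (T t)
    then show ?case using Bl by auto
  next
    case (gen n)
    have nG: "n \<in> carrier G" using generators_N[OF gen] by auto
    show ?case
    proof
      fix x assume "x \<in> D"
      then obtain m b c where m: "m \<in> N" and bc: "b \<in> B" "c \<in> B" "x = b \<otimes> m \<otimes> c"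
        by (auto simp: D_def double_coset_def)
      have "n \<otimes> b \<otimes> m \<in> D"
        using generators_mult[OF gen m bc(1)] m generators_N[OF gen] by (auto simp: D_def)
      then have "\<one> \<otimes> (n \<otimes> b \<otimes> m) \<otimes> c \<in> D" by (rule B[OF B.one_closed bc(2)])
      moreover have "\<one> \<otimes> (n \<otimes> b \<otimes> m) \<otimes> c = n \<otimes> x" using bc m nG by (simp add: m_assoc)
      ultimately show "n \<otimes> x \<in> D" by simp
    qed
  next
    case (mult n m)
    then show ?case using DG by (auto simp: m_assoc subset_iff)
  qed
  have "\<forall>x\<in>D. g \<otimes> x \<in> D" if "g \<in> generate G (B \<union> N)" for g
    using that
  proof induction
    case one
    then show ?case using DG by auto
  next
    case (incl h)
    then show ?case using Bl N by auto
  next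
    case (inv h)
    then show ?case using Bl N by auto
  next
    case (eng h1 h2)
    have "generate G (B \<union> N) \<subseteq> carrier G"
      by (rule generate_incl) auto
    then have "h1 \<in> carrier G" "h2 \<in> carrier G" using eng.hyps by auto
    then show ?case using eng.IH DG by (auto simp: m_assoc subset_iff)
  qed
  moreover have "generate G (B \<union> N) = carrier G" using BN by (simp add: BN_pair_def)
  moreover have "\<one> \<in> D"
    using double_coset_one N.one_closed B.one_closed unfolding D_def by blast
  ultimately have "g \<otimes> \<one> \<in> D" using g by blast
  then show ?thesis using g by (simp add: D_def)
qed

end

section \<open>The semidirect product B = U T and its p-elements\<close>

locale split_BN_group = BN_group +
  fixes p :: nat and U
  assumes prime: "prime p" and fin: "finite (carrier G)"
    and T_comm: "comm_group (G\<lparr>carrier := T\<rparr>)"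
    and U_largest: "largest_normal_p_subgroup p (G\<lparr>carrier := B\<rparr>) U"
    and UT: "U <#> T = B" and U_Int_T: "U \<inter> T = {\<one>}"
begin

abbreviation "GB \<equiv> G\<lparr>carrier := B\<rparr>"

lemma U_normal: "U \<lhd> GB" using U_largest by (simp add: largest_normal_p_subgroup_def)

lemma card_U: "\<exists>a. card U = p ^ a" using U_largest by (simp add: largest_normal_p_subgroup_def)

lemma U_subset_B: "U \<subseteq> B"
  using subgroup.subset[OF normal_imp_subgroup[OF U_normal]] by simp

sublocale U: subgroup U G
  using incl_subgroup[OF B.subgroup_axioms normal_imp_subgroup[OF U_normal]] .

sublocale T: subgroup T G by (rule T_subgroup)

lemma conj_U: "b \<in> B \<Longrightarrow> u \<in> U \<Longrightarrow> b \<otimes> u \<otimes> inv b \<in> U"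
  using normal.inv_op_closed2[OF U_normal, of b u] m_inv_consistent[OF B.subgroup_axioms] by simp

lemma conj_U': "b \<in> B \<Longrightarrow> u \<in> U \<Longrightarrow> inv b \<otimes> u \<otimes> b \<in> U"
  using conj_U[of "inv b" u] by simp

lemma T_commute: "s \<in> T \<Longrightarrow> t \<in> T \<Longrightarrow> s \<otimes> t = t \<otimes> s"
  using comm_monoid.m_comm[of "G\<lparr>carrier := T\<rparr>" s t] T_comm by (simp add: comm_group_def)

lemma finite_U: "finite U" using fin U.subset finite_subset by blast
lemma finite_T: "finite T" using fin T.subset finite_subset by blast

lemma B_cases:
  assumes "b \<in> B"
  obtains u t where "u \<in> U" "t \<in> T" "b = u \<otimes> t"
proof -
  have "b \<in> U <#> T" using assms by (simp only: UT)
  then show thesis using that by (auto simp: set_mult_def)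
qed

lemma UT_unique:
  assumes "u \<in> U" "v \<in> U" "s \<in> T" "t \<in> T" "u \<otimes> s = v \<otimes> t"
  shows "u = v" "s = t"
proof -
  have c: "u \<in> carrier G" "v \<in> carrier G" "s \<in> carrier G" "t \<in> carrier G" using assms by auto
  have "inv v \<otimes> u = t \<otimes> inv s"
  proof -
    have "inv v \<otimes> u = inv v \<otimes> (u \<otimes> s) \<otimes> inv s" using c by (simp add: m_assoc)
    also have "\<dots> = t \<otimes> inv s" using c by (simp add: assms(5)) (simp add: m_assoc[symmetric])
    finally show ?thesis .
  qed
  moreover have "inv v \<otimes> u \<in> U" "t \<otimes> inv s \<in> T" using assms(1-4) by blast+
  ultimately have "inv v \<otimes> u = \<one>" "t \<otimes> inv s = \<one>" using U_Int_T by auto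
  moreover have "u = v \<otimes> (inv v \<otimes> u)" "t = (t \<otimes> inv s) \<otimes> s"
    using c by (simp add: m_assoc[symmetric], simp add: m_assoc)
  ultimately show "u = v" "s = t" using c by simp_all
qed

text \<open>The homomorphism from B to B/U, identified with T; it is multiplicative because U is
  normal in B.\<close>

definition proj :: "'a \<Rightarrow> 'a" where
  "proj b = (THE t. t \<in> T \<and> (\<exists>u\<in>U. b = u \<otimes> t))"

lemma proj_eq: "u \<in> U \<Longrightarrow> t \<in> T \<Longrightarrow> proj (u \<otimes> t) = t"
  unfolding proj_def using UT_unique by (intro the_equality) auto

lemma proj_T: "t \<in> T \<Longrightarrow> proj t = t"
  using proj_eq[of \<one> t] by simp

lemma proj_U: "u \<in> U \<Longrightarrow> proj u = \<one>"
  using proj_eq[of u \<one>] by simp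

lemma proj_closed: "b \<in> B \<Longrightarrow> proj b \<in> T"
  by (elim B_cases) (simp add: proj_eq)

lemma proj_mult:
  assumes "b \<in> B" "c \<in> B" shows "proj (b \<otimes> c) = proj b \<otimes> proj c"
proof -
  obtain u s v t where *: "u \<in> U" "s \<in> T" "b = u \<otimes> s" "v \<in> U" "t \<in> T" "c = v \<otimes> t"
    using B_cases assms by metis
  have "b \<otimes> c = (u \<otimes> (s \<otimes> v \<otimes> inv s)) \<otimes> (s \<otimes> t)"
    using * U.mem_carrier T.mem_carrier by (simp add: m_assoc inv_solve_left)
  moreover have "s \<otimes> v \<otimes> inv s \<in> U" using conj_U * by auto
  then have "u \<otimes> (s \<otimes> v \<otimes> inv s) \<in> U" "s \<otimes> t \<in> T" using *(1,2,5) by blast+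
  ultimately show ?thesis using proj_eq * by simp
qed

lemma proj_inv: "b \<in> B \<Longrightarrow> proj (inv b) = inv (proj b)"
proof -
  assume b: "b \<in> B"
  have "proj (inv b) \<otimes> proj b = \<one>"
    using proj_mult[of "inv b" b] b proj_T[of \<one>] by simp
  then show ?thesis
    using b proj_closed[of b] proj_closed[of "inv b"] T.mem_carrier by (metis B.m_inv_closed inv_equality)
qed

lemma proj_one_iff: "b \<in> B \<Longrightarrow> proj b = \<one> \<longleftrightarrow> b \<in> U"
proof -
  assume "b \<in> B"
  then obtain u t where *: "u \<in> U" "t \<in> T" "b = u \<otimes> t" by (rule B_cases)
  then show ?thesis using proj_U[of b] by (auto simp: proj_eq)
qed

lemma proj_pow: "b \<in> B \<Longrightarrow> proj (b [^] (i::nat)) = proj b [^] i"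
proof (induction i)
  case 0
  then show ?case using proj_T[of \<one>] by simp
next
  case (Suc i)
  have "b [^] i \<in> B" using Suc.prems by (induction i) simp_all
  then show ?case using Suc proj_mult by simp
qed

definition preimage :: "'a set \<Rightarrow> 'a set" where
  "preimage C = {b \<in> B. proj b \<in> C}"

lemma card_preimage:
  assumes "C \<subseteq> T" shows "card (preimage C) = card U * card C"
proof -
  have "bij_betw (\<lambda>(u, t). u \<otimes> t) (U \<times> C) (preimage C)"
    unfolding bij_betw_def
  proof
    show "inj_on (\<lambda>(u, t). u \<otimes> t) (U \<times> C)"
    proof (rule inj_onI, clarify)
      fix u s v t assume "u \<in> U" "s \<in> C" "v \<in> U" "t \<in> C" "u \<otimes> s = v \<otimes> t"
      then show "u = v \<and> s = t" using UT_unique[of u v s t] assms by blast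
    qed
    show "(\<lambda>(u, t). u \<otimes> t) ` (U \<times> C) = preimage C"
    proof
      show "(\<lambda>(u, t). u \<otimes> t) ` (U \<times> C) \<subseteq> preimage C"
        using assms U_subset_B proj_eq by (auto simp: preimage_def subset_iff)
      show "preimage C \<subseteq> (\<lambda>(u, t). u \<otimes> t) ` (U \<times> C)"
      proof
        fix b assume b: "b \<in> preimage C"
        then obtain u t where "u \<in> U" "t \<in> T" "b = u \<otimes> t"
          using B_cases by (auto simp: preimage_def)
        then show "b \<in> (\<lambda>(u, t). u \<otimes> t) ` (U \<times> C)"
          using b proj_eq by (force simp: preimage_def)
      qed
    qed
  qed
  then show ?thesis
    using bij_betw_same_card card_cartesian_product by metis
qed

lemma preimage_subgroup:
  assumes "subgroup C G" "C \<subseteq> T" shows "subgroup (preimage C) G"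
proof -
  interpret C: subgroup C G by fact
  show ?thesis
    by (rule subgroupI)
      (auto simp: preimage_def proj_mult proj_inv intro: exI[of _ \<one>] simp: proj_T)
qed

text \<open>Conjugation in B does not change the image under \<open>proj\<close>, because T is
  commutative. Hence every subgroup of T, normal or not in a larger group, has a normal preimage in
  B.\<close>

lemma preimage_normal:
  assumes C: "subgroup C G" "C \<subseteq> T" shows "preimage C \<lhd> GB"
proof -
  interpret GB: group GB by (rule B.subgroup_is_group[OF is_group])
  show ?thesis
    unfolding GB.normal_inv_iff
  proof (intro conjI ballI)
    have "preimage C \<subseteq> B" by (auto simp: preimage_def)
    then show "subgroup (preimage C) GB"
      using subgroup_incl[OF preimage_subgroup[OF C] B.subgroup_axioms] by simp
    fix x h assume "x \<in> carrier GB" "h \<in> preimage C"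
    then have *: "x \<in> B" "h \<in> B" "proj h \<in> C" by (auto simp: preimage_def)
    have px: "proj x \<in> T" "proj h \<in> T" using * proj_closed by auto
    have "proj (x \<otimes> h \<otimes> inv x) = proj x \<otimes> proj h \<otimes> inv (proj x)"
      using * by (simp add: proj_mult proj_inv)
    also have "\<dots> = proj h"
      using px T_commute[OF px] T.mem_carrier by (simp add: m_assoc)
    finally show "x \<otimes>\<^bsub>GB\<^esub> h \<otimes>\<^bsub>GB\<^esub> inv\<^bsub>GB\<^esub> x \<in> preimage C"
      using * m_inv_consistent[OF B.subgroup_axioms] by (simp add: preimage_def)
  qed
qed

text \<open>Adjoining a \<open>p\<close>-element of \<open>T\<close> to \<open>U\<close> would give a larger normal \<open>p\<close>-subgroup of \<open>B\<close>.\<close>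

lemma T_no_p_element:
  assumes t: "t \<in> T" and pow: "t [^] (p ^ j) = \<one>"
  shows "t = \<one>"
proof -
  have tG: "t \<in> carrier G" using t by auto
  let ?C = "generate G {t}"
  have C: "subgroup ?C G" "?C \<subseteq> T"
    using generate_is_subgroup[of "{t}"] tG generate_subgroup_incl[OF _ T_subgroup, of "{t}"] t by auto
  have "ord t dvd p ^ j" using pow pow_eq_id[OF tG] by simp
  then obtain i where "ord t = p ^ i" using divides_primepow_nat[OF prime] by auto
  then have "card ?C = p ^ i" using generate_pow_card[OF tG] by simp
  then have "\<exists>a. card (preimage ?C) = p ^ a"
    using card_preimage[OF C(2)] card_U by (metis power_add)
  then have "preimage ?C \<subseteq> U"
    using U_largest preimage_normal[OF C] by (auto simp: largest_normal_p_subgroup_def)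
  moreover have "t \<in> preimage ?C"
    using t proj_T[OF t] generate.incl[of t "{t}" G] by (auto simp: preimage_def)
  ultimately show ?thesis using t U_Int_T by auto
qed

text \<open>The image of b in T is a p-element, hence trivial, and U is the kernel of
  \<open>proj\<close>.\<close>

lemma p_element_B:
  assumes "b \<in> B" "b [^] (p ^ j) = \<one>" shows "b \<in> U"
proof -
  have "proj b [^] (p ^ j) = \<one>"
    using proj_pow[OF assms(1), of "p ^ j"] proj_T[of \<one>] by (simp add: assms(2))
  then show ?thesis
    using T_no_p_element[OF proj_closed[OF assms(1)]] proj_one_iff[OF assms(1)] by simp
qed

text \<open>The order of u divides the order of U, so its conjugates are p-elements, and those lying
  in B lie in U. Elements of U that a conjugation moves into B therefore still act trivially on Y^U
  after the conjugation.\<close>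

lemma conj_U_B:
  assumes "u \<in> U" "g \<in> carrier G" "g \<otimes> u \<otimes> inv g \<in> B"
  shows "g \<otimes> u \<otimes> inv g \<in> U"
proof -
  have uG: "u \<in> carrier G" using assms by auto
  obtain a where a: "card U = p ^ a" using card_U by auto
  have "group (G\<lparr>carrier := U\<rparr>)" by (rule U.subgroup_is_group[OF is_group])
  then have "u [^]\<^bsub>G\<lparr>carrier := U\<rparr>\<^esub> card U = \<one>"
    using group.pow_order_eq_1[of "G\<lparr>carrier := U\<rparr>" u] assms(1) by (simp add: Coset.order_def)
  then have "u [^] (p ^ a) = \<one>" using a nat_pow_consistent by metis
  then have "(g \<otimes> u \<otimes> inv g) [^] (p ^ a) = \<one>"
    using pow_conj[OF assms(2) uG] assms(2) by simp
  then show ?thesis using p_element_B assms(3) by blast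
qed

text \<open>The U-parts are moved to the two outer ends and both T-parts are collected to the left
  of n, the second one after conjugation by n.\<close>

lemma Bruhat_U:
  assumes "g \<in> double_coset G B n" "n \<in> N"
  obtains u v t where "u \<in> U" "v \<in> U" "t \<in> T" "g = u \<otimes> (t \<otimes> n) \<otimes> v"
proof -
  obtain b c where bc: "b \<in> B" "c \<in> B" "g = b \<otimes> n \<otimes> c"
    using assms by (auto simp: double_coset_def)
  obtain u s where us: "u \<in> U" "s \<in> T" "b = u \<otimes> s" using B_cases bc by metis
  obtain v' t where vt: "v' \<in> U" "t \<in> T" "c = v' \<otimes> t" using B_cases bc by metis
  \<comment> \<open>Rewrites c = v' t as t v, with the factor from U on the right.\<close>
  define v where "v = inv t \<otimes> v' \<otimes> t"
  have v: "v \<in> U" using conj_U'[of t v'] vt by (simp add: v_def)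
  have c: "c = t \<otimes> v"
    using vt U.mem_carrier T.mem_carrier by (simp add: v_def m_assoc[symmetric])
  have G: "u \<in> carrier G" "v \<in> carrier G" "s \<in> carrier G" "t \<in> carrier G" "n \<in> carrier G"
    using us v vt assms(2) by auto
  have nt: "n \<otimes> t \<otimes> inv n \<in> T" using conj_T assms(2) vt by auto
  have "g = u \<otimes> ((s \<otimes> (n \<otimes> t \<otimes> inv n)) \<otimes> n) \<otimes> v"
    using G by (simp add: bc(3) us(3) c m_assoc)
  moreover have "s \<otimes> (n \<otimes> t \<otimes> inv n) \<in> T" using us(2) nt by blast
  ultimately show thesis using that us v by blast
qed

end

section \<open>Conjugation of the weights of the invariants\<close>

locale split_BN_module = split_BN_group G B N p U + Y: group_algebra_module G Y
  for G :: "('g, 'c) monoid_scheme" (structure) and B N p U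
    and Y :: "('g \<Rightarrow> 'k::field, 'm, 'd) module_scheme" +
  assumes char: "of_nat p \<noteq> (0 :: 'k)"
begin

abbreviation "kG \<equiv> group_algebra G :: ('g \<Rightarrow> 'k) ring"
abbreviation "GT \<equiv> G\<lparr>carrier := T\<rparr>"
abbreviation "kT \<equiv> group_algebra GT :: ('g \<Rightarrow> 'k) ring"
abbreviation "Z \<equiv> invariants U Y"

lemma Z_iff: "z \<in> carrier Z \<longleftrightarrow> z \<in> carrier Y \<and> (\<forall>u\<in>U. Y.act u z = z)"
  by (simp add: invariants_def Y.act_def)

lemma Z_simps [simp]:
  "\<zero>\<^bsub>Z\<^esub> = \<zero>\<^bsub>Y\<^esub>" "x \<oplus>\<^bsub>Z\<^esub> y = x \<oplus>\<^bsub>Y\<^esub> y" "a \<odot>\<^bsub>Z\<^esub> x = a \<odot>\<^bsub>Y\<^esub> x"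
  by (simp_all add: invariants_def)

lemma act_T_Z:
  assumes t: "t \<in> T" and z: "z \<in> carrier Z" shows "Y.act t z \<in> carrier Z"
proof -
  have zY: "z \<in> carrier Y" using z by (simp add: Z_iff)
  have "Y.act u (Y.act t z) = Y.act t z" if u: "u \<in> U" for u
  proof -
    have *: "inv t \<otimes> u \<otimes> t \<in> U" using conj_U'[of t u] t u by simp
    have "u \<otimes> t = t \<otimes> (inv t \<otimes> u \<otimes> t)" using t u by (simp add: m_assoc[symmetric])
    then have "Y.act u (Y.act t z) = Y.act t (Y.act (inv t \<otimes> u \<otimes> t) z)"
      using t u zY by (simp add: Y.act_act)
    then show ?thesis using z * by (simp add: Z_iff)
  qed
  then show ?thesis using zY t by (simp add: Z_iff)
qed

lemma scal_Z: "z \<in> carrier Z \<Longrightarrow> Y.scal c z \<in> carrier Z"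
  by (simp add: Z_iff Y.act_scal)

lemma add_Z: "x \<in> carrier Z \<Longrightarrow> y \<in> carrier Z \<Longrightarrow> x \<oplus>\<^bsub>Y\<^esub> y \<in> carrier Z"
  by (simp add: Z_iff Y.act_add)

lemma Z_Y: "z \<in> carrier Z \<Longrightarrow> z \<in> carrier Y"
  by (simp add: Z_iff)

lemma group_GT: "group GT" by (rule T.subgroup_is_group[OF is_group])

text \<open>T normalises U and so preserves the fixed points. Since kT acts through its inclusion in
  kG, the module axioms are inherited from Y.\<close>

lemma invariants_module: "group_algebra_module GT Z"
proof -
  interpret GT: group GT by (rule group_GT)
  have sub: "a \<in> carrier kG" if a: "a \<in> carrier kT" for a
  proof -
    have "a x = 0" if "x \<notin> carrier G" for x
      using a T.mem_carrier[of x] that by (auto simp: group_algebra_simps)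
    then show ?thesis by (simp add: group_algebra_simps)
  qed
  have smult: "a \<odot>\<^bsub>Y\<^esub> z \<in> carrier Z" if a: "a \<in> carrier kT" and z: "z \<in> carrier Z" for a z
  proof -
    have fT: "finite (carrier GT)" using finite_T by simp
    show ?thesis
    proof (rule group_algebra_induct[OF fT a])
      show "(\<lambda>x. 0) \<odot>\<^bsub>Y\<^esub> z \<in> carrier Z"
        using Y.M.smult_l_null[OF Z_Y[OF z]] by (simp add: group_algebra_simps Z_iff)
      show "single t c \<odot>\<^bsub>Y\<^esub> z \<in> carrier Z" if "t \<in> carrier GT" for t c
        using that z by (simp add: Y.single_smult Z_Y scal_Z act_T_Z)
      show "(a \<oplus>\<^bsub>kT\<^esub> b) \<odot>\<^bsub>Y\<^esub> z \<in> carrier Z"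
        if "a \<in> carrier kT" "b \<in> carrier kT" "a \<odot>\<^bsub>Y\<^esub> z \<in> carrier Z" "b \<odot>\<^bsub>Y\<^esub> z \<in> carrier Z" for a b
      proof -
        have "(a \<oplus>\<^bsub>kT\<^esub> b) \<odot>\<^bsub>Y\<^esub> z = a \<odot>\<^bsub>Y\<^esub> z \<oplus>\<^bsub>Y\<^esub> b \<odot>\<^bsub>Y\<^esub> z"
          using Y.M.smult_l_distr[OF sub[OF that(1)] sub[OF that(2)] Z_Y[OF z]]
          by (simp add: group_algebra_simps)
        then show ?thesis using that add_Z by simp
      qed
    qed
  qed
  have "abelian_group Z"
  proof (rule abelian_groupI)
    fix z assume z: "z \<in> carrier Z"
    have "Y.scal (- 1) z \<oplus>\<^bsub>Z\<^esub> z = \<zero>\<^bsub>Z\<^esub>"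
      using z by (simp add: Y.scal_minus_left Z_Y Y.M.M.l_neg)
    then show "\<exists>y\<in>carrier Z. y \<oplus>\<^bsub>Z\<^esub> z = \<zero>\<^bsub>Z\<^esub>" using scal_Z[OF z] by blast
  next
    show "\<zero>\<^bsub>Z\<^esub> \<in> carrier Z" by (simp add: Z_iff)
  qed (simp_all add: add_Z Z_Y Y.M.M.a_ac)
  moreover have "ring kT"
    by (rule ring_group_algebra_subgroup[OF fin Y.M.R.ring_axioms T_subgroup])
  moreover have "left_module_axioms kT Z"
  proof
    fix a b z assume ab: "a \<in> carrier kT" "b \<in> carrier kT" and z: "z \<in> carrier Z"
    show "(a \<oplus>\<^bsub>kT\<^esub> b) \<odot>\<^bsub>Z\<^esub> z = a \<odot>\<^bsub>Z\<^esub> z \<oplus>\<^bsub>Z\<^esub> b \<odot>\<^bsub>Z\<^esub> z"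
      using Y.M.smult_l_distr[OF sub[OF ab(1)] sub[OF ab(2)] Z_Y[OF z]]
      by (simp add: group_algebra_simps)
    show "(a \<otimes>\<^bsub>kT\<^esub> b) \<odot>\<^bsub>Z\<^esub> z = a \<odot>\<^bsub>Z\<^esub> (b \<odot>\<^bsub>Z\<^esub> z)"
      using Y.M.smult_assoc[OF sub[OF ab(1)] sub[OF ab(2)] Z_Y[OF z]]
        group_algebra_mult_subgroup[OF group_axioms fin T_subgroup ab] by simp
  next
    fix a x y assume "a \<in> carrier kT" "x \<in> carrier Z" "y \<in> carrier Z"
    then show "a \<odot>\<^bsub>Z\<^esub> (x \<oplus>\<^bsub>Z\<^esub> y) = a \<odot>\<^bsub>Z\<^esub> x \<oplus>\<^bsub>Z\<^esub> a \<odot>\<^bsub>Z\<^esub> y"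
      by (simp add: Y.M.smult_r_distr sub Z_Y)
  next
    fix z assume "z \<in> carrier Z"
    then show "\<one>\<^bsub>kT\<^esub> \<odot>\<^bsub>Z\<^esub> z = z"
      using Y.M.smult_one[OF Z_Y] by (simp add: group_algebra_simps)
  qed (simp add: smult)
  ultimately show ?thesis
    using finite_T GT.group_axioms
    by (simp add: group_algebra_module_def group_algebra_module_axioms_def left_module_def)
qed

sublocale Z: group_algebra_module GT Z by (rule invariants_module)

lemma Z_ops [simp]: "Z.act t z = Y.act t z" "Z.scal c z = Y.scal c z"
  by (simp_all add: Z.act_def Y.act_def Z.scal_def Y.scal_def)

lemma of_nat_p_power: "of_nat (p ^ i) \<noteq> (0 :: 'k)"
  using char by simp

lemma of_nat_card_U: "of_nat (card U) \<noteq> (0 :: 'k)"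
  using card_U of_nat_p_power by metis

section \<open>The sum of the elements of U as an operator on Y\<close>

definition sum_U :: "'g \<Rightarrow> 'k" where
  "sum_U = (\<lambda>x. if x \<in> U then 1 else 0)"

definition E :: "'m \<Rightarrow> 'm" where
  "E x = sum_U \<odot>\<^bsub>Y\<^esub> x"

lemma sum_U_closed: "sum_U \<in> carrier kG"
  by (auto simp: sum_U_def group_algebra_simps)

lemma E_closed [simp]: "x \<in> carrier Y \<Longrightarrow> E x \<in> carrier Y"
  by (simp add: E_def sum_U_closed Y.M.smult_closed)

lemma E_add: "x \<in> carrier Y \<Longrightarrow> y \<in> carrier Y \<Longrightarrow> E (x \<oplus>\<^bsub>Y\<^esub> y) = E x \<oplus>\<^bsub>Y\<^esub> E y"
  by (simp add: E_def sum_U_closed Y.M.smult_r_distr)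

lemma U_mult_iff:
  assumes "x \<in> carrier G" "u \<in> U" shows "u \<otimes> x \<in> U \<longleftrightarrow> x \<in> U" "x \<otimes> u \<in> U \<longleftrightarrow> x \<in> U"
proof -
  have uG: "u \<in> carrier G" using assms(2) by simp
  have "inv u \<otimes> (u \<otimes> x) = x" "(x \<otimes> u) \<otimes> inv u = x"
    using assms(1) uG by (simp add: m_assoc[symmetric], simp add: m_assoc)
  then show "u \<otimes> x \<in> U \<longleftrightarrow> x \<in> U" "x \<otimes> u \<in> U \<longleftrightarrow> x \<in> U"
    using assms U.m_closed U.m_inv_closed by metis+
qed

lemma sum_U_mult_U:
  assumes u: "u \<in> U" shows "sum_U \<otimes>\<^bsub>kG\<^esub> single u 1 = sum_U" "single u 1 \<otimes>\<^bsub>kG\<^esub> sum_U = sum_U"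
proof -
  have uG: "u \<in> carrier G" using u by simp
  show "sum_U \<otimes>\<^bsub>kG\<^esub> single u 1 = sum_U" "single u 1 \<otimes>\<^bsub>kG\<^esub> sum_U = sum_U"
    using u U_mult_iff[of _ "inv u"]
    by (auto simp: single_mult_left[OF group_axioms fin uG] single_mult_right[OF group_axioms fin uG] sum_U_def)
qed

lemma sum_U_mult_T:
  assumes t: "t \<in> T" shows "sum_U \<otimes>\<^bsub>kG\<^esub> single t 1 = single t 1 \<otimes>\<^bsub>kG\<^esub> sum_U"
proof -
  have tG: "t \<in> carrier G" and tB: "t \<in> B" using t by auto
  have "x \<otimes> inv t \<in> U \<longleftrightarrow> inv t \<otimes> x \<in> U" if x: "x \<in> carrier G" for x
  proof -
    have "inv t \<otimes> (x \<otimes> inv t) \<otimes> t = inv t \<otimes> x" "t \<otimes> (inv t \<otimes> x) \<otimes> inv t = x \<otimes> inv t"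
      using x tG by (simp add: m_assoc, simp add: m_assoc[symmetric])
    then show ?thesis
      using conj_U[OF tB, of "inv t \<otimes> x"] conj_U'[OF tB, of "x \<otimes> inv t"] by auto
  qed
  then show ?thesis
    by (auto simp: single_mult_left[OF group_axioms fin tG] single_mult_right[OF group_axioms fin tG] sum_U_def)
qed

lemma sum_U_mult_scalar: "sum_U \<otimes>\<^bsub>kG\<^esub> single \<one> c = single \<one> c \<otimes>\<^bsub>kG\<^esub> sum_U"
  by (auto simp: single_mult_left[OF group_axioms fin one_closed]
      single_mult_right[OF group_axioms fin one_closed] sum_U_def)

lemma E_act_U: "u \<in> U \<Longrightarrow> x \<in> carrier Y \<Longrightarrow> E (Y.act u x) = E x"
  using sum_U_mult_U(1)[of u] Y.M.smult_assoc[OF sum_U_closed single_closed[of u G 1], of x]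
  by (simp add: E_def Y.act_def group_elem_eq_single)

lemma act_U_E: "u \<in> U \<Longrightarrow> x \<in> carrier Y \<Longrightarrow> Y.act u (E x) = E x"
  using sum_U_mult_U(2)[of u] Y.M.smult_assoc[OF single_closed[of u G 1] sum_U_closed, of x]
  by (simp add: E_def Y.act_def group_elem_eq_single)

lemma act_T_E: "t \<in> T \<Longrightarrow> x \<in> carrier Y \<Longrightarrow> Y.act t (E x) = E (Y.act t x)"
  using sum_U_mult_T[of t] Y.M.smult_assoc[OF single_closed[of t G 1] sum_U_closed, of x]
    Y.M.smult_assoc[OF sum_U_closed single_closed[of t G 1], of x]
  by (simp add: E_def Y.act_def group_elem_eq_single)

lemma E_scal: "x \<in> carrier Y \<Longrightarrow> E (Y.scal c x) = Y.scal c (E x)"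
  using sum_U_mult_scalar[of c] Y.M.smult_assoc[OF single_closed[of \<one> G c] sum_U_closed, of x]
    Y.M.smult_assoc[OF sum_U_closed single_closed[of \<one> G c], of x]
  by (simp add: E_def Y.scal_def)

lemma E_Z: "x \<in> carrier Y \<Longrightarrow> E x \<in> carrier Z"
  by (simp add: Z_iff act_U_E)

lemma E_zero: "E \<zero>\<^bsub>Y\<^esub> = \<zero>\<^bsub>Y\<^esub>"
  by (simp add: E_def sum_U_closed Y.M.smult_r_null)

lemma E_sum: "x \<in> carrier Y \<Longrightarrow> E x = (\<Oplus>\<^bsub>Y\<^esub>u\<in>U. Y.act u x)"
proof -
  assume x: "x \<in> carrier Y"
  have "E x = (\<Oplus>\<^bsub>Y\<^esub>u\<in>U. Y.scal 1 (Y.act u x))"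
    unfolding E_def sum_U_def
    using Y.smult_eq_finsum[OF finite_U U.subset x, of "\<lambda>_. 1"] .
  also have "\<dots> = (\<Oplus>\<^bsub>Y\<^esub>u\<in>U. Y.act u x)"
    by (rule Y.M.M.finsum_cong') (use x in auto)
  finally show ?thesis .
qed

text \<open>On Y^U the operator E is multiplication by the order of U, a power of p and thus
  invertible in k.\<close>

lemma E_mem_imp_mem:
  assumes S: "S \<subseteq> carrier Y" "\<zero>\<^bsub>Y\<^esub> \<in> S"
    and add: "\<And>x y. x \<in> S \<Longrightarrow> y \<in> S \<Longrightarrow> x \<oplus>\<^bsub>Y\<^esub> y \<in> S"
    and scal: "\<And>c x. x \<in> S \<Longrightarrow> Y.scal c x \<in> S"
    and z: "z \<in> carrier Z" and Ez: "E z \<in> S"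
  shows "z \<in> S"
proof (rule Y.finsum_congruence_mem[OF S add scal finite_U, of "\<lambda>u. Y.act u z" z "\<lambda>_. True"])
  show "(\<lambda>u. Y.act u z) \<in> U \<rightarrow> carrier Y" "z \<in> carrier Y" using z by (auto simp: Z_Y)
  show "Y.act u z \<ominus>\<^bsub>Y\<^esub> z \<in> S" if "u \<in> U" for u
    using z that S by (simp add: Z_iff a_minus_def Y.M.M.r_neg)
  show "(\<Oplus>\<^bsub>Y\<^esub>u\<in>U. Y.act u z) \<in> S" using Ez z E_sum by (simp add: Z_Y)
qed (use of_nat_card_U in simp_all)

text \<open>The elements of \<open>U\<close> that are conjugated into \<open>B\<close> are conjugated into \<open>U\<close> by
  \<open>conj_U_B\<close>, and they contribute a multiple of \<open>E z\<close> that is prime to the characteristic.\<close>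

lemma E_conj_E_mem:
  assumes S: "S \<subseteq> carrier Y" "\<zero>\<^bsub>Y\<^esub> \<in> S"
    and add: "\<And>x y. x \<in> S \<Longrightarrow> y \<in> S \<Longrightarrow> x \<oplus>\<^bsub>Y\<^esub> y \<in> S"
    and scal: "\<And>c x. x \<in> S \<Longrightarrow> Y.scal c x \<in> S"
    and g: "g \<in> carrier G" and z: "z \<in> carrier Z"
    and mem: "E (Y.act g (E (Y.act (inv g) z))) \<in> S"
    and bad: "\<And>v. v \<in> U \<Longrightarrow> g \<otimes> v \<otimes> inv g \<notin> B \<Longrightarrow> E (Y.act (g \<otimes> v \<otimes> inv g) z) \<in> S"
  shows "z \<in> S"
proof -
  have zY: "z \<in> carrier Y" using z by (rule Z_Y)
  let ?f = "\<lambda>v. E (Y.act (g \<otimes> v \<otimes> inv g) z)"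
  let ?P = "\<lambda>v. g \<otimes> v \<otimes> inv g \<in> B"
  have E_act: "E (Y.act g x) = (sum_U \<otimes>\<^bsub>kG\<^esub> single g 1) \<odot>\<^bsub>Y\<^esub> x" if "x \<in> carrier Y" for x
    using g that by (simp add: Y.M.smult_assoc sum_U_closed single_closed E_def Y.act_def group_elem_eq_single)
  \<comment> \<open>The inner sum over U is expanded, so that the term of v becomes e (g v g^-1)
    z.\<close>
  have "E (Y.act g (E (Y.act (inv g) z))) =
      (sum_U \<otimes>\<^bsub>kG\<^esub> single g 1) \<odot>\<^bsub>Y\<^esub> (\<Oplus>\<^bsub>Y\<^esub>v\<in>U. Y.act v (Y.act (inv g) z))"
    using g zY by (simp add: E_act flip: E_sum)
  also have "\<dots> = (\<Oplus>\<^bsub>Y\<^esub>v\<in>U. (sum_U \<otimes>\<^bsub>kG\<^esub> single g 1) \<odot>\<^bsub>Y\<^esub> Y.act v (Y.act (inv g) z))"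
    by (rule Y.M.smult_finsum) (use g zY finite_U in \<open>auto simp: sum_U_closed single_closed\<close>)
  also have "\<dots> = (\<Oplus>\<^bsub>Y\<^esub>v\<in>U. ?f v)"
  proof (rule Y.M.M.finsum_cong'[OF refl])
    show "(sum_U \<otimes>\<^bsub>kG\<^esub> single g 1) \<odot>\<^bsub>Y\<^esub> Y.act v (Y.act (inv g) z) = ?f v" if "v \<in> U" for v
      using g zY that by (simp add: Y.act_act m_assoc flip: E_act)
  qed (use g zY in auto)
  finally have sum: "(\<Oplus>\<^bsub>Y\<^esub>v\<in>U. ?f v) \<in> S" using mem by simp
  \<comment> \<open>The good v form the group of elements of U that g conjugates into B; its order
    divides that of U and is a power of p.\<close>
  have "subgroup {v \<in> U. ?P v} (G\<lparr>carrier := U\<rparr>)"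
  proof -
    have inv_g: "inv g \<otimes> (g \<otimes> x) = x" if "x \<in> carrier G" for x
      using that g by (simp add: m_assoc[symmetric])
    have "subgroup {v \<in> U. ?P v} G"
    proof (rule subgroupI)
      show "inv v \<in> {v \<in> U. ?P v}" if v: "v \<in> {v \<in> U. ?P v}" for v
      proof -
        have "v \<in> carrier G" using v by auto
        then have "g \<otimes> inv v \<otimes> inv g = inv (g \<otimes> v \<otimes> inv g)"
          using g by (simp add: inv_mult_group m_assoc)
        then show ?thesis using v B.m_inv_closed by simp
      qed
      show "v \<otimes> w \<in> {v \<in> U. ?P v}" if vw: "v \<in> {v \<in> U. ?P v}" "w \<in> {v \<in> U. ?P v}" for v w
      proof -
        have "v \<in> carrier G" "w \<in> carrier G" using vw by auto
        then have "g \<otimes> (v \<otimes> w) \<otimes> inv g = (g \<otimes> v \<otimes> inv g) \<otimes> (g \<otimes> w \<otimes> inv g)"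
          using g by (simp add: m_assoc inv_g)
        then show ?thesis using vw B.m_closed by simp
      qed
      show "{v \<in> U. ?P v} \<noteq> {}" using g by (auto intro!: exI[of _ \<one>])
    qed auto
    then show ?thesis by (rule subgroup_incl) (auto intro: U.subgroup_axioms)
  qed
  then have "card {v \<in> U. ?P v} dvd card U"
    using group.lagrange[OF U.subgroup_is_group[OF is_group]]
    by (metis Coset.order_def dvd_triv_right partial_object.select_convs(1) partial_object.update_convs(1) monoid.surjective)
  then obtain i where "card {v \<in> U. ?P v} = p ^ i"
    using card_U divides_primepow_nat[OF prime] by metis
  then have n: "of_nat (card {v \<in> U. ?P v}) \<noteq> (0 :: 'k)" using of_nat_p_power by simp
  have "E z \<in> S"
  proof (rule Y.finsum_congruence_mem[OF S add scal finite_U, of ?f "E z" ?P])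
    show "?f \<in> U \<rightarrow> carrier Y" "E z \<in> carrier Y" using g zY by auto
    show "?f v \<ominus>\<^bsub>Y\<^esub> E z \<in> S" if "v \<in> U" "?P v" for v
    proof -
      have "Y.act (g \<otimes> v \<otimes> inv g) z = z"
        using conj_U_B[OF that(1) g that(2)] z by (simp add: Z_iff)
      then show ?thesis using zY S by (simp add: a_minus_def Y.M.M.r_neg)
    qed
  qed (use bad sum n in auto)
  show ?thesis by (rule E_mem_imp_mem[of S]) fact+
qed

text \<open>Write x = u t n v: the factor v fixes z, the factor u is absorbed by E, and t commutes
  with E because T normalises U. These t, one for each bad element of U, make up \<theta>.\<close>

lemma E_act_double_coset:
  assumes "x \<in> double_coset G B n" "n \<in> N" "z \<in> carrier Z"
  obtains t where "t \<in> T" "E (Y.act x z) = Y.act t (E (Y.act n z))"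
proof -
  obtain u v t where *: "u \<in> U" "v \<in> U" "t \<in> T" "x = u \<otimes> (t \<otimes> n) \<otimes> v"
    using Bruhat_U[OF assms(1,2)] by metis
  have nG: "n \<in> carrier G" using assms by simp
  have tG: "t \<in> carrier G" using * by simp
  have zY: "z \<in> carrier Y" using assms Z_Y by simp
  have "E (Y.act x z) = E (Y.act u (Y.act t (Y.act n (Y.act v z))))"
    using * nG tG zY by (simp add: Y.act_act m_assoc)
  also have "\<dots> = Y.act t (E (Y.act n z))"
    using * nG tG zY assms(3) by (simp add: E_act_U act_T_E Z_iff)
  finally show thesis using that * by blast
qed

text \<open>The map \<tau> = e n is k-linear on Y^U and twists T by n, so only its bijectivity is at
  stake. Injectivity and surjectivity are two instances of \<open>E_conj_E_mem\<close>, with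
  opposite conjugations and different S.\<close>

lemma weight_factor_generator:
  assumes n: "n \<in> generators" and wf: "Z.weight_factor \<chi>"
    and \<psi>: "\<And>t. t \<in> T \<Longrightarrow> \<psi> (n \<otimes> t \<otimes> inv n) = \<chi> t"
  shows "Z.weight_factor \<psi>"
proof -
  have nN: "n \<in> N" by (rule generators_N[OF n])
  then have nG: "n \<in> carrier G" by simp
  define \<tau> where "\<tau> z = E (Y.act n z)" for z
  have \<tau>_closed: "\<tau> z \<in> carrier Z" if "z \<in> carrier Z" for z
    using that nG by (simp add: \<tau>_def E_Z Z_Y)
  have \<tau>_add: "\<tau> (x \<oplus>\<^bsub>Y\<^esub> y) = \<tau> x \<oplus>\<^bsub>Y\<^esub> \<tau> y" if "x \<in> carrier Z" "y \<in> carrier Z" for x y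
    using that nG by (simp add: \<tau>_def Y.act_add E_add Z_Y)
  have \<tau>_scal: "\<tau> (Y.scal c x) = Y.scal c (\<tau> x)" if "x \<in> carrier Z" for c x
    using that nG by (simp add: \<tau>_def Y.act_scal E_scal Z_Y)
  have \<tau>_act: "\<tau> (Y.act t x) = Y.act (n \<otimes> t \<otimes> inv n) (\<tau> x)" if t: "t \<in> T" and x: "x \<in> carrier Z" for t x
  proof -
    have tG: "t \<in> carrier G" using t by simp
    have "Y.act n (Y.act t x) = Y.act (n \<otimes> t \<otimes> inv n) (Y.act n x)"
      using tG nG x by (simp add: Y.act_act Z_Y m_assoc)
    then show ?thesis using act_T_E[OF conj_T[OF nN t]] nG x by (simp add: \<tau>_def Z_Y)
  qed
  \<comment> \<open>Here S = 0 and the conjugation is by n^-1: if e n z = 0, then e n^-1 e n z = 0,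
    and the bad terms are of the form t (e n z), so they vanish too.\<close>
  have ker: "z = \<zero>\<^bsub>Y\<^esub>" if z: "z \<in> carrier Z" "\<tau> z = \<zero>\<^bsub>Y\<^esub>" for z
  proof -
    have "z \<in> {\<zero>\<^bsub>Y\<^esub>}"
    proof (rule E_conj_E_mem[of _ "inv n" z])
      show "E (Y.act (inv n) (E (Y.act (inv (inv n)) z))) \<in> {\<zero>\<^bsub>Y\<^esub>}"
        using z nG by (simp add: \<tau>_def E_zero)
      show "E (Y.act (inv n \<otimes> v \<otimes> inv (inv n)) z) \<in> {\<zero>\<^bsub>Y\<^esub>}"
        if v: "v \<in> U" "inv n \<otimes> v \<otimes> inv (inv n) \<notin> B" for v
      proof -
        have "inv n \<otimes> v \<otimes> n \<in> double_coset G B n"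
          using generators_conj(2)[OF n, of v] v nG U_subset_B by auto
        then obtain t where "t \<in> T" "E (Y.act (inv n \<otimes> v \<otimes> n) z) = Y.act t (\<tau> z)"
          using E_act_double_coset[OF _ nN z(1)] \<tau>_def by metis
        then show ?thesis using z nG by simp
      qed
    qed (use z nG in auto)
    then show ?thesis by simp
  qed
  have inj: "inj_on \<tau> (carrier Z)"
  proof (rule inj_onI)
    fix x y assume xy: "x \<in> carrier Z" "y \<in> carrier Z" "\<tau> x = \<tau> y"
    let ?d = "x \<oplus>\<^bsub>Y\<^esub> Y.scal (- 1) y"
    have "\<tau> ?d = \<tau> x \<oplus>\<^bsub>Y\<^esub> Y.scal (- 1) (\<tau> y)"
      using xy(1,2) by (simp add: \<tau>_add \<tau>_scal scal_Z)
    also have "\<dots> = \<zero>\<^bsub>Y\<^esub>"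
      using xy(3) \<tau>_closed[OF xy(2)] by (simp add: Y.scal_minus_left Z_Y Y.M.M.r_neg)
    finally have "\<tau> ?d = \<zero>\<^bsub>Y\<^esub>" .
    then have "?d = \<zero>\<^bsub>Y\<^esub>" using ker xy add_Z scal_Z by blast
    then have "x \<ominus>\<^bsub>Y\<^esub> y = \<zero>\<^bsub>Y\<^esub>" using xy by (simp add: Y.scal_minus_left Z_Y a_minus_def)
    then show "x = y" using Y.M.minus_minus_cancel(2)[of x y "\<zero>\<^bsub>Y\<^esub>"] xy by (simp add: Z_Y)
  qed
  \<comment> \<open>Here S is the image of \<tau> and the conjugation is by n: e n e n^-1 z is in
    the image by its form, and the bad terms t (\<tau> z) are in it because \<tau> commutes with T
    up to conjugation by n.\<close>
  have "z \<in> \<tau> ` carrier Z" if z: "z \<in> carrier Z" for z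
  proof (rule E_conj_E_mem[of _ n z])
    show "\<tau> ` carrier Z \<subseteq> carrier Y" using \<tau>_closed Z_Y by blast
    show "\<zero>\<^bsub>Y\<^esub> \<in> \<tau> ` carrier Z"
      using nG by (intro image_eqI[of _ _ "\<zero>\<^bsub>Y\<^esub>"]) (auto simp: \<tau>_def E_zero Z_iff)
    show "x \<oplus>\<^bsub>Y\<^esub> y \<in> \<tau> ` carrier Z" if "x \<in> \<tau> ` carrier Z" "y \<in> \<tau> ` carrier Z" for x y
      using that add_Z by (auto simp flip: \<tau>_add)
    show "Y.scal c x \<in> \<tau> ` carrier Z" if "x \<in> \<tau> ` carrier Z" for c x
      using that scal_Z by (auto simp flip: \<tau>_scal)
    show "E (Y.act n (E (Y.act (inv n) z))) \<in> \<tau> ` carrier Z"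
      using z nG by (simp add: \<tau>_def[symmetric] E_Z Z_Y)
    show "E (Y.act (n \<otimes> v \<otimes> inv n) z) \<in> \<tau> ` carrier Z" if v: "v \<in> U" "n \<otimes> v \<otimes> inv n \<notin> B" for v
    proof -
      have "n \<otimes> v \<otimes> inv n \<in> double_coset G B n"
        using generators_conj(1)[OF n, of v] v nG U_subset_B by auto
      then obtain t where t: "t \<in> T" "E (Y.act (n \<otimes> v \<otimes> inv n) z) = Y.act t (\<tau> z)"
        using E_act_double_coset[OF _ nN z] \<tau>_def by metis
      have "n \<otimes> (inv n \<otimes> t \<otimes> n) \<otimes> inv n = t"
        using t nG by (simp add: m_assoc) (simp add: m_assoc[symmetric])
      then have "Y.act t (\<tau> z) = \<tau> (Y.act (inv n \<otimes> t \<otimes> n) z)"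
        using \<tau>_act[OF conj_T'[OF nN t(1)] z] by simp
      then show ?thesis using t act_T_Z[OF conj_T'[OF nN t(1)] z] by simp
    qed
  qed (use z nG in auto)
  then have "\<tau> ` carrier Z = carrier Z" using \<tau>_closed by blast
  then have bij: "bij_betw \<tau> (carrier Z) (carrier Z)" using inj by (simp add: bij_betw_def)
  have im: "(\<lambda>t. n \<otimes> t \<otimes> inv n) ` carrier GT = carrier GT"
  proof
    show "carrier GT \<subseteq> (\<lambda>t. n \<otimes> t \<otimes> inv n) ` carrier GT"
    proof
      fix t assume "t \<in> carrier GT"
      then have t: "t \<in> T" by simp
      have "t = n \<otimes> (inv n \<otimes> t \<otimes> n) \<otimes> inv n"
        using t nG by (simp add: m_assoc) (simp add: m_assoc[symmetric])
      then show "t \<in> (\<lambda>t. n \<otimes> t \<otimes> inv n) ` carrier GT"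
        using conj_T'[OF nN t] by (intro image_eqI) auto
    qed
  qed (use conj_T[OF nN] in auto)
  show ?thesis
    by (rule Z.weight_factor_transport[OF bij _ _ _ im _ wf])
      (use \<tau>_add \<tau>_scal \<tau>_act \<psi> in simp_all)
qed

text \<open>Twists compose, so the case of generators suffices. Elements of T act trivially by
  conjugation since T is commutative.\<close>

lemma weight_factor_conj:
  assumes "n \<in> N" "Z.weight_factor \<chi>"
    and "\<And>t. t \<in> T \<Longrightarrow> \<psi> (n \<otimes> t \<otimes> inv n) = \<chi> t"
  shows "Z.weight_factor \<psi>"
  using assms
proof (induction n arbitrary: \<chi> \<psi> rule: N_induct)
  case (T s)
  have "s \<otimes> t \<otimes> inv s = t" if t: "t \<in> T" for t
    using T_commute[OF T(1) t] T(1) t by (simp add: m_assoc)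
  then have eq: "\<psi> t = \<chi> t" if "t \<in> T" for t using T(3)[OF that] that by simp
  show ?case
    by (rule Z.weight_factor_transport[of "\<lambda>z. z" "\<lambda>t. t" \<psi> \<chi>]) (use T(2) eq in \<open>auto simp: bij_betw_def\<close>)
next
  case (gen n)
  then show ?case by (rule weight_factor_generator)
next
  case (mult n m)
  have G: "n \<in> carrier G" "m \<in> carrier G" using mult.hyps by auto
  \<comment> \<open>The intermediate character for the product n m: the twist of \<chi> by m, from
    which \<psi> is obtained by twisting with n.\<close>
  let ?\<omega> = "\<lambda>t. \<chi> (inv m \<otimes> t \<otimes> m)"
  have "Z.weight_factor ?\<omega>"
  proof (rule mult.IH(2)[OF mult.prems(1)])
    show "?\<omega> (m \<otimes> t \<otimes> inv m) = \<chi> t" if "t \<in> T" for t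
    proof -
      have "inv m \<otimes> (m \<otimes> t \<otimes> inv m) \<otimes> m = t"
        using that G by (simp add: m_assoc) (simp add: m_assoc[symmetric])
      then show ?thesis by simp
    qed
  qed
  then show ?case
  proof (rule mult.IH(1))
    show "\<psi> (n \<otimes> t \<otimes> inv n) = ?\<omega> t" if t: "t \<in> T" for t
    proof -
      have "n \<otimes> m \<otimes> (inv m \<otimes> t \<otimes> m) \<otimes> inv (n \<otimes> m) = n \<otimes> (m \<otimes> (inv m \<otimes> t \<otimes> m) \<otimes> inv m) \<otimes> inv n"
        using t G by (simp add: inv_mult_group m_assoc) (simp add: m_assoc[symmetric])
      also have "m \<otimes> (inv m \<otimes> t \<otimes> m) \<otimes> inv m = t"
        using t G by (simp add: m_assoc) (simp add: m_assoc[symmetric])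
      finally show ?thesis using mult.prems(2)[OF conj_T'[OF mult.hyps(2) t]] by simp
    qed
  qed
qed

end

section \<open>Principal series\<close>

context split_BN_group
begin

section \<open>Characters of T and the weight elements of the group algebra\<close>

definition is_char :: "('a \<Rightarrow> 'k::field) \<Rightarrow> bool" where
  "is_char \<chi> \<longleftrightarrow> (\<forall>s\<in>T. \<forall>t\<in>T. \<chi> (s \<otimes> t) = \<chi> s * \<chi> t) \<and> \<chi> \<one> = 1"

lemma is_charD:
  assumes "is_char \<chi>"
  shows "s \<in> T \<Longrightarrow> t \<in> T \<Longrightarrow> \<chi> (s \<otimes> t) = \<chi> s * \<chi> t" "\<chi> \<one> = 1"
    "t \<in> T \<Longrightarrow> \<chi> (inv t) * \<chi> t = 1" "t \<in> T \<Longrightarrow> \<chi> (t [^] (i::nat)) = \<chi> t ^ i"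
proof -
  show mult: "s \<in> T \<Longrightarrow> t \<in> T \<Longrightarrow> \<chi> (s \<otimes> t) = \<chi> s * \<chi> t" for s t
    using assms unfolding is_char_def by blast
  show one: "\<chi> \<one> = 1" using assms by (simp add: is_char_def)
  show "\<chi> (inv t) * \<chi> t = 1" if t: "t \<in> T"
    using mult[of "inv t" t] one t T.m_inv_closed T.mem_carrier by simp
  show "\<chi> (t [^] i) = \<chi> t ^ i" if t: "t \<in> T" for i :: nat
  proof (induction i)
    case (Suc i)
    have "t [^] i \<in> T" using t by (induction i) simp_all
    then show ?case using mult[OF _ t] Suc by simp
  qed (simp add: one)
qed

text \<open>If m is the part of the order of T prime to r, this is the r'-part T' of T.\<close>

definition tors :: "nat \<Rightarrow> 'a set" where
  "tors m = {t \<in> T. t [^] m = \<one>}"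

lemma tors_T: "tors m \<subseteq> T"
  by (auto simp: tors_def)

lemma tors_subgroup: "subgroup (tors m) G"
proof (rule subgroupI)
  show "tors m \<subseteq> carrier G" by (auto simp: tors_def)
  show "tors m \<noteq> {}" using T.one_closed by (auto simp: tors_def intro!: exI[of _ \<one>])
  show "inv t \<in> tors m" if t: "t \<in> tors m" for t
    using t nat_pow_inv[of t m] by (auto simp: tors_def)
  show "s \<otimes> t \<in> tors m" if s: "s \<in> tors m" and t: "t \<in> tors m" for s t
  proof -
    have "s \<in> T" "t \<in> T" using s t by (auto simp: tors_def)
    then have "(s \<otimes> t) [^] m = s [^] m \<otimes> t [^] m"
      by (intro pow_mult_distrib T_commute) auto
    then show ?thesis using s t by (simp add: tors_def)
  qed
qed

lemma card_tors: "prime r \<Longrightarrow> \<not> r dvd m \<Longrightarrow> \<not> r dvd card (tors m)"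
  by (rule card_exponent_coprime[OF tors_subgroup])
    (auto simp: tors_def intro: finite_subset[OF _ finite_T])

lemma pow_mem_tors:
  assumes t: "t \<in> T" and card: "card T = l * m"
  shows "t [^] l \<in> tors m"
proof -
  have tG: "t \<in> carrier G" using t by simp
  have "group (G\<lparr>carrier := T\<rparr>)" by (rule T.subgroup_is_group[OF is_group])
  then have "t [^]\<^bsub>G\<lparr>carrier := T\<rparr>\<^esub> card T = \<one>"
    using group.pow_order_eq_1[of "G\<lparr>carrier := T\<rparr>" t] t by (simp add: Coset.order_def)
  then have "t [^] card T = \<one>" by (metis nat_pow_consistent)
  moreover have "t [^] l \<in> T" using t by (induction l) simp_all
  ultimately show ?thesis using tG by (simp add: tors_def card nat_pow_pow)
qed

text \<open>An unnormalised multiple of the idempotent of \<open>k[U tors m]\<close> that belongs to the inflation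
  of the restriction of \<open>\<chi>\<close>.\<close>

definition wt_elem :: "nat \<Rightarrow> ('a \<Rightarrow> 'k::field) \<Rightarrow> 'a \<Rightarrow> 'k" where
  "wt_elem m \<chi> = (\<lambda>x. if x \<in> preimage (tors m) then \<chi> (inv (proj x)) else 0)"

lemma preimage_tors: "subgroup (preimage (tors m)) G"
  by (rule preimage_subgroup[OF tors_subgroup tors_T])

lemma wt_elem_closed: "wt_elem m \<chi> \<in> carrier (group_algebra G)"
  using subgroup.mem_carrier[OF preimage_tors] by (auto simp: wt_elem_def group_algebra_simps)

text \<open>Translation by d on either side permutes the preimage of \<open>tors m\<close>. As
  \<open>proj\<close> and \<chi> are multiplicative and the values lie in a field, both translations
  change the coefficients by the same factor.\<close>

lemma wt_elem_mult:
  assumes \<chi>: "is_char \<chi>" and d: "d \<in> preimage (tors m)"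
  shows "single d 1 \<otimes>\<^bsub>group_algebra G\<^esub> wt_elem m \<chi> = single \<one> (\<chi> (proj d)) \<otimes>\<^bsub>group_algebra G\<^esub> wt_elem m \<chi>"
    "wt_elem m \<chi> \<otimes>\<^bsub>group_algebra G\<^esub> single d 1 = single \<one> (\<chi> (proj d)) \<otimes>\<^bsub>group_algebra G\<^esub> wt_elem m \<chi>"
proof -
  interpret D: subgroup "preimage (tors m)" G by (rule preimage_tors)
  have dG: "d \<in> carrier G" and dB: "d \<in> B" using d by (auto simp: preimage_def)
  have pd: "proj d \<in> T" by (rule proj_closed[OF dB])
  have l: "inv d \<otimes> x \<in> preimage (tors m) \<longleftrightarrow> x \<in> preimage (tors m)"
    and r: "x \<otimes> inv d \<in> preimage (tors m) \<longleftrightarrow> x \<in> preimage (tors m)" if x: "x \<in> carrier G" for x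
  proof -
    have "d \<otimes> (inv d \<otimes> x) = x" "(x \<otimes> inv d) \<otimes> d = x"
      using x dG by (simp add: m_assoc[symmetric], simp add: m_assoc)
    then show "inv d \<otimes> x \<in> preimage (tors m) \<longleftrightarrow> x \<in> preimage (tors m)"
      "x \<otimes> inv d \<in> preimage (tors m) \<longleftrightarrow> x \<in> preimage (tors m)"
      using d D.m_closed D.m_inv_closed by metis+
  qed
  have val: "\<chi> (inv (proj (inv d \<otimes> x))) = \<chi> (proj d) * \<chi> (inv (proj x))"
    "\<chi> (inv (proj (x \<otimes> inv d))) = \<chi> (proj d) * \<chi> (inv (proj x))"
    if x: "x \<in> preimage (tors m)" for x
  proof -
    have xB: "x \<in> B" using x by (simp add: preimage_def)
    have px: "proj x \<in> T" by (rule proj_closed[OF xB])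
    have G: "proj x \<in> carrier G" "proj d \<in> carrier G" using px pd T.mem_carrier by blast+
    have "inv (proj (inv d \<otimes> x)) = inv (proj x) \<otimes> proj d"
      "inv (proj (x \<otimes> inv d)) = proj d \<otimes> inv (proj x)"
      using xB dB G by (simp_all add: proj_mult proj_inv inv_mult_group)
    then show "\<chi> (inv (proj (inv d \<otimes> x))) = \<chi> (proj d) * \<chi> (inv (proj x))"
      "\<chi> (inv (proj (x \<otimes> inv d))) = \<chi> (proj d) * \<chi> (inv (proj x))"
      using is_charD(1)[OF \<chi>] pd T.m_inv_closed[OF px] by (simp_all add: mult.commute)
  qed
  show "single d 1 \<otimes>\<^bsub>group_algebra G\<^esub> wt_elem m \<chi> = single \<one> (\<chi> (proj d)) \<otimes>\<^bsub>group_algebra G\<^esub> wt_elem m \<chi>"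
    "wt_elem m \<chi> \<otimes>\<^bsub>group_algebra G\<^esub> single d 1 = single \<one> (\<chi> (proj d)) \<otimes>\<^bsub>group_algebra G\<^esub> wt_elem m \<chi>"
    by (auto simp: single_mult_left[OF is_group fin] single_mult_right[OF is_group fin] dG
        wt_elem_def l r val fun_eq_iff)
qed

lemma scalar_central:
  "a \<otimes>\<^bsub>group_algebra G\<^esub> single \<one> c = single \<one> c \<otimes>\<^bsub>group_algebra G\<^esub> a"
  by (auto simp: single_mult_left[OF is_group fin] single_mult_right[OF is_group fin])

lemma scalar_mult_inject:
  assumes z: "z \<in> carrier (group_algebra G)" and cd: "c \<noteq> d"
    and eq: "single \<one> c \<otimes>\<^bsub>group_algebra G\<^esub> z = single \<one> d \<otimes>\<^bsub>group_algebra G\<^esub> z"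
  shows "z = \<zero>\<^bsub>group_algebra G\<^esub>"
proof
  fix x
  have "c * z x = d * z x" if "x \<in> carrier G"
    using fun_cong[OF eq, of x] that by (simp add: single_mult_left[OF is_group fin])
  then show "z x = \<zero>\<^bsub>group_algebra G\<^esub> x" using z cd by (auto simp: group_algebra_simps)
qed

text \<open>By linearity and the Bruhat decomposition a may be taken to be a multiple of u n v with
  n in N, and the weight elements d and c absorb u and v. If t separates the characters, moving it
  across n in d t n c gives \<psi>(t) d n c = \<chi>(n^-1 t n) d n c, whence d n c = 0.\<close>

lemma wt_elem_orthogonal:
  fixes \<chi> \<psi> :: "'a \<Rightarrow> 'k::field"
  assumes R: "ring (group_algebra G :: ('a \<Rightarrow> 'k) ring)"
    and \<chi>: "is_char \<chi>" and \<psi>: "is_char \<psi>"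
    and sep: "\<And>n. n \<in> N \<Longrightarrow> \<exists>t\<in>tors m. \<psi> t \<noteq> \<chi> (inv n \<otimes> t \<otimes> n)"
    and a: "a \<in> carrier (group_algebra G)"
  shows "wt_elem m \<psi> \<otimes>\<^bsub>group_algebra G\<^esub> a \<otimes>\<^bsub>group_algebra G\<^esub> wt_elem m \<chi> = \<zero>\<^bsub>group_algebra G\<^esub>"
proof -
  let ?R = "group_algebra G :: ('a \<Rightarrow> 'k) ring"
  interpret R: ring ?R by fact
  let ?d = "wt_elem m \<psi>" and ?c = "wt_elem m \<chi>"
  note mem = wt_elem_closed[of m \<psi>] wt_elem_closed[of m \<chi>] single_closed
  have U: "single u 1 \<otimes>\<^bsub>?R\<^esub> ?c = ?c" "?d \<otimes>\<^bsub>?R\<^esub> single u 1 = ?d" if u: "u \<in> U" for u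
  proof -
    have "u \<in> preimage (tors m)"
      using u U_subset_B proj_U[OF u] subgroup.one_closed[OF tors_subgroup] by (auto simp: preimage_def)
    from wt_elem_mult(1)[OF \<chi> this] wt_elem_mult(2)[OF \<psi> this]
    show "single u 1 \<otimes>\<^bsub>?R\<^esub> ?c = ?c" "?d \<otimes>\<^bsub>?R\<^esub> single u 1 = ?d"
      using proj_U[OF u] is_charD(2)[OF \<chi>] is_charD(2)[OF \<psi>] mem(1,2) R.l_one
      by (simp_all add: group_algebra_simps)
  qed
  have N: "?d \<otimes>\<^bsub>?R\<^esub> single n w \<otimes>\<^bsub>?R\<^esub> ?c = \<zero>\<^bsub>?R\<^esub>" if n: "n \<in> N" for n w
  proof -
    obtain t where t: "t \<in> tors m" "\<psi> t \<noteq> \<chi> (inv n \<otimes> t \<otimes> n)" using sep[OF n] by blast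
    let ?s = "inv n \<otimes> t \<otimes> n"
    have nG: "n \<in> carrier G" using n by simp
    have tT: "t \<in> T" using t(1) tors_T by blast
    have tG: "t \<in> carrier G" using tT by simp
    have sT: "?s \<in> T" by (rule conj_T'[OF n tT])
    have "?s [^] m = inv n \<otimes> t [^] m \<otimes> n" using pow_conj[of "inv n" t m] nG tG by simp
    then have s: "?s \<in> tors m" using sT t(1) nG by (simp add: tors_def)
    have pre: "x \<in> preimage (tors m)" "proj x = x" if x: "x \<in> tors m" for x
    proof -
      have xT: "x \<in> T" using x tors_T by blast
      then show "proj x = x" by (rule proj_T)
      then show "x \<in> preimage (tors m)" using x xT by (simp add: preimage_def)
    qed
    let ?X = "?d \<otimes>\<^bsub>?R\<^esub> single n w \<otimes>\<^bsub>?R\<^esub> ?c"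
    have cl: "single t 1 \<in> carrier ?R" "single n w \<in> carrier ?R" "single ?s 1 \<in> carrier ?R"
      "single \<one> (\<chi> ?s) \<in> carrier ?R" "single \<one> (\<psi> t) \<in> carrier ?R"
      using nG tG by (simp_all add: single_closed)
    have "n \<otimes> ?s = t \<otimes> n" using nG tG by (simp add: m_assoc[symmetric])
    then have comm: "single t 1 \<otimes>\<^bsub>?R\<^esub> single n w = single n w \<otimes>\<^bsub>?R\<^esub> single ?s 1"
      using nG tG by (simp add: single_mult[OF is_group fin])
    have "?d \<otimes>\<^bsub>?R\<^esub> single t 1 \<otimes>\<^bsub>?R\<^esub> single n w \<otimes>\<^bsub>?R\<^esub> ?c =
        ?d \<otimes>\<^bsub>?R\<^esub> (single t 1 \<otimes>\<^bsub>?R\<^esub> single n w) \<otimes>\<^bsub>?R\<^esub> ?c"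
      using cl mem(1,2) by (simp add: R.m_assoc)
    also have "\<dots> = ?d \<otimes>\<^bsub>?R\<^esub> (single n w \<otimes>\<^bsub>?R\<^esub> single ?s 1) \<otimes>\<^bsub>?R\<^esub> ?c"
      by (simp only: comm)
    also have "\<dots> = ?d \<otimes>\<^bsub>?R\<^esub> single n w \<otimes>\<^bsub>?R\<^esub> (single ?s 1 \<otimes>\<^bsub>?R\<^esub> ?c)"
      using cl mem(1,2) by (simp add: R.m_assoc)
    also have "\<dots> = ?d \<otimes>\<^bsub>?R\<^esub> single n w \<otimes>\<^bsub>?R\<^esub> (single \<one> (\<chi> ?s) \<otimes>\<^bsub>?R\<^esub> ?c)"
      using wt_elem_mult(1)[OF \<chi> pre(1)[OF s]] pre(2)[OF s] by simp
    also have "\<dots> = (?d \<otimes>\<^bsub>?R\<^esub> single n w) \<otimes>\<^bsub>?R\<^esub> single \<one> (\<chi> ?s) \<otimes>\<^bsub>?R\<^esub> ?c"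
      using cl mem(1,2) by (simp add: R.m_assoc)
    also have "\<dots> = single \<one> (\<chi> ?s) \<otimes>\<^bsub>?R\<^esub> (?d \<otimes>\<^bsub>?R\<^esub> single n w) \<otimes>\<^bsub>?R\<^esub> ?c"
      using scalar_central[of "?d \<otimes>\<^bsub>?R\<^esub> single n w" "\<chi> ?s"] cl(2) mem(1) by simp
    also have "\<dots> = single \<one> (\<chi> ?s) \<otimes>\<^bsub>?R\<^esub> ?X"
      using cl mem(1,2) by (simp add: R.m_assoc)
    also have "?d \<otimes>\<^bsub>?R\<^esub> single t 1 \<otimes>\<^bsub>?R\<^esub> single n w \<otimes>\<^bsub>?R\<^esub> ?c = single \<one> (\<psi> t) \<otimes>\<^bsub>?R\<^esub> ?X"
      using wt_elem_mult(2)[OF \<psi> pre(1)[OF t(1)]] pre(2)[OF t(1)] cl mem(1,2) by (simp add: R.m_assoc)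
    finally show ?thesis
      using scalar_mult_inject[OF _ t(2), of ?X] cl(2) mem(1,2) by simp
  qed
  show ?thesis
  proof (rule group_algebra_induct[OF fin a])
    show "?d \<otimes>\<^bsub>?R\<^esub> (\<lambda>x. 0) \<otimes>\<^bsub>?R\<^esub> ?c = \<zero>\<^bsub>?R\<^esub>"
      using R.r_null[OF mem(1)] R.l_null[OF mem(2)] by (simp add: group_algebra_simps)
    show "?d \<otimes>\<^bsub>?R\<^esub> (a \<oplus>\<^bsub>?R\<^esub> b) \<otimes>\<^bsub>?R\<^esub> ?c = \<zero>\<^bsub>?R\<^esub>"
      if "a \<in> carrier ?R" "b \<in> carrier ?R" "?d \<otimes>\<^bsub>?R\<^esub> a \<otimes>\<^bsub>?R\<^esub> ?c = \<zero>\<^bsub>?R\<^esub>"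
        "?d \<otimes>\<^bsub>?R\<^esub> b \<otimes>\<^bsub>?R\<^esub> ?c = \<zero>\<^bsub>?R\<^esub>" for a b
      using that mem(1,2) by (simp add: R.r_distr R.l_distr)
    show "?d \<otimes>\<^bsub>?R\<^esub> single g w \<otimes>\<^bsub>?R\<^esub> ?c = \<zero>\<^bsub>?R\<^esub>" if g: "g \<in> carrier G" for g w
    proof -
      obtain n where n: "n \<in> N" "g \<in> double_coset G B n" using Bruhat[OF g] by blast
      obtain u v t where *: "u \<in> U" "v \<in> U" "t \<in> T" "g = u \<otimes> (t \<otimes> n) \<otimes> v"
        using Bruhat_U[OF n(2,1)] by metis
      have tn: "t \<otimes> n \<in> N" using *(3) n(1) by blast
      have G: "u \<in> carrier G" "v \<in> carrier G" "t \<otimes> n \<in> carrier G" using * tn by auto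
      then have cl: "single u 1 \<in> carrier ?R" "single v 1 \<in> carrier ?R"
        "single (t \<otimes> n) w \<in> carrier ?R" by (simp_all add: single_closed)
      have "single g w = single u 1 \<otimes>\<^bsub>?R\<^esub> single (t \<otimes> n) w \<otimes>\<^bsub>?R\<^esub> single v 1"
        using G *(4) by (simp add: single_mult[OF is_group fin])
      then have "?d \<otimes>\<^bsub>?R\<^esub> single g w \<otimes>\<^bsub>?R\<^esub> ?c =
          (?d \<otimes>\<^bsub>?R\<^esub> single u 1) \<otimes>\<^bsub>?R\<^esub> single (t \<otimes> n) w \<otimes>\<^bsub>?R\<^esub> (single v 1 \<otimes>\<^bsub>?R\<^esub> ?c)"
        using cl mem(1,2) by (simp add: R.m_assoc)
      also have "\<dots> = \<zero>\<^bsub>?R\<^esub>" using U(2)[OF *(1)] U(1)[OF *(2)] N[OF tn] by simp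
      finally show ?thesis .
    qed
  qed
qed

end

section \<open>The action of the weight elements on a module\<close>

context split_BN_module
begin

lemma Z_minus: "x \<in> carrier Z \<Longrightarrow> y \<in> carrier Z \<Longrightarrow> x \<ominus>\<^bsub>Z\<^esub> y = x \<ominus>\<^bsub>Y\<^esub> y"
  using Z.scal_minus_left[of y 1] Y.scal_minus_left[of y 1] by (simp add: a_minus_def Z_Y)

text \<open>Let b be an eigenvector for \<chi> modulo S i. Modulo S i the weight element multiplies
  b by the product of the orders of U and of \<open>tors m\<close>, which is nonzero in k, so the
  image of b is not even in S i.\<close>

lemma wt_elem_nonzero:
  assumes \<chi>: "is_char \<chi>" and wf: "Z.weight_factor \<chi>"
    and m: "of_nat (card (tors m)) \<noteq> (0 :: 'k)"
  shows "\<exists>y\<in>carrier Y. wt_elem m \<chi> \<odot>\<^bsub>Y\<^esub> y \<noteq> \<zero>\<^bsub>Y\<^esub>"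
proof -
  obtain l S i b where cs: "composition_series kT Z l S" and i: "i < l"
    and b: "b \<in> S (Suc i)" "b \<notin> S i"
    and wb: "\<forall>t\<in>carrier GT. Z.act t b \<ominus>\<^bsub>Z\<^esub> Z.scal (\<chi> t) b \<in> S i"
    using wf unfolding Z.weight_factor_def by blast
  have S: "Module.submodule (S i) kT Z" "Module.submodule (S (Suc i)) kT Z"
    using cs i by (simp_all add: composition_series_def)
  note S' = submodule_closed[OF S(1)] and S'' = Z.submodule_act[OF S(1)]
  have bZ: "b \<in> carrier Z" using b(1) submodule_closed(1)[OF S(2)] by blast
  have bY: "b \<in> carrier Y" by (rule Z_Y[OF bZ])
  let ?D = "preimage (tors m)"
  let ?f = "\<lambda>d. Y.scal (\<chi> (inv (proj d))) (Y.act d b)"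
  interpret D: subgroup ?D G by (rule preimage_tors)
  have finD: "finite ?D" using D.subset fin finite_subset by blast
  have sum: "wt_elem m \<chi> \<odot>\<^bsub>Y\<^esub> b = (\<Oplus>\<^bsub>Y\<^esub>d\<in>?D. ?f d)"
    unfolding wt_elem_def by (rule Y.smult_eq_finsum[OF finD D.subset bY])
  have cong: "?f d \<ominus>\<^bsub>Y\<^esub> b \<in> S i" if d: "d \<in> ?D" for d
  proof -
    have dB: "d \<in> B" using d by (simp add: preimage_def)
    obtain u t where ut: "u \<in> U" "t \<in> T" "d = u \<otimes> t" using B_cases[OF dB] by metis
    have pd: "proj d = t" using ut proj_eq by simp
    have tG: "t \<in> carrier G" "u \<in> carrier G" using ut by auto
    \<comment> \<open>The vector t b is again fixed by U, so the factor u has no effect.\<close>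
    have act: "Y.act d b = Y.act t b"
    proof -
      have "Y.act d b = Y.act u (Y.act t b)" using tG bY ut(3) by (simp add: Y.act_act)
      then show ?thesis using act_T_Z[OF ut(2) bZ] ut(1) by (simp add: Z_iff)
    qed
    have "Y.act t b \<ominus>\<^bsub>Y\<^esub> Y.scal (\<chi> t) b \<in> S i"
      using bspec[OF wb, of t] ut(2) Z_minus[OF act_T_Z[OF ut(2) bZ] scal_Z[OF bZ, of "\<chi> t"]] by simp
    then have "Y.scal (\<chi> (inv t)) (Y.act t b \<ominus>\<^bsub>Y\<^esub> Y.scal (\<chi> t) b) \<in> S i"
      using S''(2) by simp
    also have "Y.scal (\<chi> (inv t)) (Y.act t b \<ominus>\<^bsub>Y\<^esub> Y.scal (\<chi> t) b) = ?f d \<ominus>\<^bsub>Y\<^esub> b"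
      using tG bY is_charD(3)[OF \<chi> ut(2)]
      by (simp add: act pd a_minus_def Y.scal_add Y.scal_minus Y.scal_scal)
    finally show ?thesis .
  qed
  have "card ?D = card U * card (tors m)" by (rule card_preimage[OF tors_T])
  then have n: "of_nat (card {d \<in> ?D. True}) \<noteq> (0 :: 'k)" using m of_nat_card_U by simp
  have "wt_elem m \<chi> \<odot>\<^bsub>Y\<^esub> b \<notin> S i"
  proof
    assume "wt_elem m \<chi> \<odot>\<^bsub>Y\<^esub> b \<in> S i"
    then have mem: "(\<Oplus>\<^bsub>Y\<^esub>d\<in>?D. ?f d) \<in> S i" by (simp add: sum)
    have "b \<in> S i"
    proof (rule Y.finsum_congruence_mem[of "S i" ?D ?f b "\<lambda>_. True"])
      show "S i \<subseteq> carrier Y" using S'(1) Z_Y by blast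
      show "\<zero>\<^bsub>Y\<^esub> \<in> S i" using S'(2) by simp
      show "x \<oplus>\<^bsub>Y\<^esub> y \<in> S i" if "x \<in> S i" "y \<in> S i" for x y using S'(3)[OF that] by simp
      show "Y.scal c x \<in> S i" if "x \<in> S i" for c x using S''(2)[OF that, of c] by simp
      show "?f \<in> ?D \<rightarrow> carrier Y" using bY by auto
    qed (use finD bY cong n mem in auto)
    then show False using b(2) by simp
  qed
  then show ?thesis using bY S'(2) by force
qed

end

text \<open>The iterated Frobenius map is additive, so equal powers of x and y force the power of x
  - y to vanish.\<close>

lemma power_CHAR_power_inject:
  fixes x y :: "'k::field"
  assumes r: "prime CHAR('k)" and eq: "x ^ (CHAR('k) ^ a) = y ^ (CHAR('k) ^ a)"
  shows "x = y"
proof -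
  have "x ^ (CHAR('k) ^ a) = (x - y) ^ (CHAR('k) ^ a) + y ^ (CHAR('k) ^ a)"
    using freshmans_dream'[OF r refl, of "x - y" y a] by simp
  then show ?thesis using eq by simp
qed

theorem Ext1_distinct_principal_series:
  fixes G :: "('g, 'c) monoid_scheme"
    and Irr :: "('g \<Rightarrow> 'k::alg_closed_field, 'k vec) module set"
    and X :: "('g \<Rightarrow> 'k, 'x, 'd) module_scheme" and X' :: "('g \<Rightarrow> 'k, 'y, 'e) module_scheme"
  assumes p: "prime p" and BN: "split_BN_pair p G B N T U"
    and char: "CHAR('k) > 0" "CHAR('k) \<noteq> p"
    and Irr: "full_set_of_irreducibles G Irr"
    and X: "one_dimensional (G\<lparr>carrier := T\<rparr>) X"
    and X': "one_dimensional (G\<lparr>carrier := T\<rparr>) X'"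
    and distinct: "principal_series G T U Irr X \<noteq> principal_series G T U Irr X'"
    and Y: "Y \<in> principal_series G T U Irr X"
    and V: "V \<in> principal_series G T U Irr X'"
  shows "trivial_group (Ext1 (group_algebra G :: ('g \<Rightarrow> 'k) ring) Y V)"
proof -
  have T: "T = B \<inter> N" and grp: "group G" and fin: "finite (carrier G)"
    using BN by (simp_all add: split_BN_pair_def)
  interpret split_BN_group G B N p U
    using p BN[unfolded T] by (simp add: split_BN_pair_def split_BN_group_def split_BN_group_axioms_def
        BN_group_def BN_group_axioms_def)
  let ?r = "CHAR('k)"
  let ?GT = "G\<lparr>carrier := T\<rparr>"
  let ?kT = "group_algebra ?GT :: ('g \<Rightarrow> 'k) ring"
  have r: "prime ?r" by (rule prime_CHAR_semidom[OF char(1)])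
  \<comment> \<open>The characteristic of k and p are distinct primes.\<close>
  have "of_nat p \<noteq> (0 :: 'k)"
    using p r char(2) primes_dvd_imp_eq by (auto simp: of_nat_eq_0_iff_char_dvd)
  then have modI: "split_BN_module G B N p U W" if "W \<in> Irr" for W
    using Irr that fin grp split_BN_group_axioms
    by (simp add: full_set_of_irreducibles_def kG_module_def split_BN_module_def
        split_BN_module_axioms_def group_algebra_module_def group_algebra_module_axioms_def)
  have grpT: "group ?GT" unfolding T by (rule T.subgroup_is_group[OF grp])
  have finT: "finite (carrier ?GT)" using finite_T by (simp add: T)
  have modX: "group_algebra_module ?GT X" and modX': "group_algebra_module ?GT X'"
    using X X' grpT finT
    by (simp_all add: one_dimensional_def kG_module_def group_algebra_module_def
        group_algebra_module_axioms_def)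
  interpret X: group_algebra_module ?GT X by (rule modX)
  interpret X': group_algebra_module ?GT X' by (rule modX')
  obtain x \<chi> where x: "x \<in> carrier X" "x \<noteq> \<zero>\<^bsub>X\<^esub>" "\<And>z. z \<in> carrier X \<Longrightarrow> \<exists>c. z = X.scal c x"
    "\<And>t. t \<in> carrier ?GT \<Longrightarrow> X.act t x = X.scal (\<chi> t) x"
    and \<chi>: "\<And>s t. s \<in> carrier ?GT \<Longrightarrow> t \<in> carrier ?GT \<Longrightarrow> \<chi> (s \<otimes>\<^bsub>?GT\<^esub> t) = \<chi> s * \<chi> t"
      "\<chi> \<one>\<^bsub>?GT\<^esub> = 1"
    using X.one_dimensional_character[OF X] by metis
  obtain x' \<psi> where x': "x' \<in> carrier X'" "x' \<noteq> \<zero>\<^bsub>X'\<^esub>" "\<And>z. z \<in> carrier X' \<Longrightarrow> \<exists>c. z = X'.scal c x'"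
    "\<And>t. t \<in> carrier ?GT \<Longrightarrow> X'.act t x' = X'.scal (\<psi> t) x'"
    and \<psi>: "\<And>s t. s \<in> carrier ?GT \<Longrightarrow> t \<in> carrier ?GT \<Longrightarrow> \<psi> (s \<otimes>\<^bsub>?GT\<^esub> t) = \<psi> s * \<psi> t"
      "\<psi> \<one>\<^bsub>?GT\<^esub> = 1"
    using X'.one_dimensional_character[OF X'] by metis
  have \<chi>c: "is_char \<chi>" and \<psi>c: "is_char \<psi>"
    using \<chi> \<psi> by (simp_all add: is_char_def T)
  let ?wf = "\<lambda>W \<omega>. group_algebra_module.weight_factor ?GT (invariants U W) \<omega>"
  have inv: "group_algebra_module ?GT (invariants U W)" if "W \<in> Irr" for W
    unfolding T by (rule split_BN_module.invariants_module[OF modI[OF that]])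
  have cf: "composition_factor ?kT X (invariants U W) \<longleftrightarrow> ?wf W \<chi>"
    "composition_factor ?kT X' (invariants U W) \<longleftrightarrow> ?wf W \<psi>" if W: "W \<in> Irr" for W
    using group_algebra_module.composition_factor_iff_weight_factor[OF inv[OF W] modX x]
      group_algebra_module.composition_factor_iff_weight_factor[OF inv[OF W] modX' x']
    by blast+
  \<comment> \<open>If \<psi> were the twist of \<chi> by n, weights could be moved along n and back
    along n^-1 for every W in \<open>Irr\<close>, and the two series would coincide.\<close>
  have sep: "\<exists>t\<in>T. \<psi> t \<noteq> \<chi> (inv\<^bsub>G\<^esub> n \<otimes>\<^bsub>G\<^esub> t \<otimes>\<^bsub>G\<^esub> n)" if n: "n \<in> N" for n
  proof (rule ccontr)
    assume "\<not> ?thesis"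
    then have eq: "\<psi> t = \<chi> (inv\<^bsub>G\<^esub> n \<otimes>\<^bsub>G\<^esub> t \<otimes>\<^bsub>G\<^esub> n)" if "t \<in> T" for t using that by blast
    have nG: "n \<in> carrier G" using n by simp
    have "?wf W \<chi> \<longleftrightarrow> ?wf W \<psi>" if W: "W \<in> Irr" for W
    proof
      interpret W: split_BN_module G B N p U W by (rule modI[OF W])
      show "?wf W \<psi>" if "?wf W \<chi>"
        unfolding T
      proof (rule W.weight_factor_conj[OF n that[unfolded T]])
        fix t assume t: "t \<in> B \<inter> N"
        then have tG: "t \<in> carrier G" by simp
        have "inv\<^bsub>G\<^esub> n \<otimes>\<^bsub>G\<^esub> (n \<otimes>\<^bsub>G\<^esub> t \<otimes>\<^bsub>G\<^esub> inv\<^bsub>G\<^esub> n) \<otimes>\<^bsub>G\<^esub> n = t"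
          using tG nG by (simp add: m_assoc) (simp add: m_assoc[symmetric])
        then show "\<psi> (n \<otimes>\<^bsub>G\<^esub> t \<otimes>\<^bsub>G\<^esub> inv\<^bsub>G\<^esub> n) = \<chi> t"
          using eq conj_T[OF n t] by (simp add: T)
      qed
      show "?wf W \<chi>" if "?wf W \<psi>"
        unfolding T
      proof (rule W.weight_factor_conj[OF N.m_inv_closed[OF n] that[unfolded T]])
        show "\<chi> (inv\<^bsub>G\<^esub> n \<otimes>\<^bsub>G\<^esub> t \<otimes>\<^bsub>G\<^esub> inv\<^bsub>G\<^esub> (inv\<^bsub>G\<^esub> n)) = \<psi> t" if "t \<in> B \<inter> N" for t
          using eq[of t] that nG by (simp add: T)
      qed
    qed
    then have "principal_series G T U Irr X = principal_series G T U Irr X'"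
      unfolding principal_series_def using cf by blast
    then show False using distinct by simp
  qed
  have "B \<inter> N \<noteq> {}" using T.one_closed by blast
  then have "card T \<noteq> 0" using finite_T by (simp add: T card_eq_0_iff)
  \<comment> \<open>The order of T is split into a power of r, called \<open>?q\<close> below, and a
    factor m prime to r.\<close>
  then obtain m where m: "card T = ?r ^ multiplicity ?r (card T) * m" "\<not> ?r dvd m"
    using multiplicity_decompose'[of "card T" ?r] r by (metis not_prime_unit)
  let ?q = "?r ^ multiplicity ?r (card T)"
  \<comment> \<open>The power of a separating t with exponent \<open>?q\<close> lies in
    \<open>tors m\<close>. It still separates, because both values are raised to a power of the
    characteristic, and that map is injective on k.\<close>
  have sep_tors: "\<exists>t\<in>tors m. \<psi> t \<noteq> \<chi> (inv\<^bsub>G\<^esub> n \<otimes>\<^bsub>G\<^esub> t \<otimes>\<^bsub>G\<^esub> n)" if n: "n \<in> N" for n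
  proof -
    obtain t where t: "t \<in> T" "\<psi> t \<noteq> \<chi> (inv\<^bsub>G\<^esub> n \<otimes>\<^bsub>G\<^esub> t \<otimes>\<^bsub>G\<^esub> n)" using sep[OF n] by blast
    have tT: "t \<in> B \<inter> N" using t(1) T by simp
    have nG: "n \<in> carrier G" and tG: "t \<in> carrier G" using n tT by auto
    have "inv\<^bsub>G\<^esub> n \<otimes>\<^bsub>G\<^esub> (t [^]\<^bsub>G\<^esub> ?q) \<otimes>\<^bsub>G\<^esub> n = (inv\<^bsub>G\<^esub> n \<otimes>\<^bsub>G\<^esub> t \<otimes>\<^bsub>G\<^esub> n) [^]\<^bsub>G\<^esub> ?q"
      using pow_conj[of "inv\<^bsub>G\<^esub> n" t ?q] nG tG by simp
    then have "\<chi> (inv\<^bsub>G\<^esub> n \<otimes>\<^bsub>G\<^esub> (t [^]\<^bsub>G\<^esub> ?q) \<otimes>\<^bsub>G\<^esub> n) = \<chi> (inv\<^bsub>G\<^esub> n \<otimes>\<^bsub>G\<^esub> t \<otimes>\<^bsub>G\<^esub> n) ^ ?q"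
      using is_charD(4)[OF \<chi>c conj_T'[OF n tT]] by simp
    moreover have "\<psi> (t [^]\<^bsub>G\<^esub> ?q) = \<psi> t ^ ?q" by (rule is_charD(4)[OF \<psi>c tT])
    ultimately have "\<psi> (t [^]\<^bsub>G\<^esub> ?q) \<noteq> \<chi> (inv\<^bsub>G\<^esub> n \<otimes>\<^bsub>G\<^esub> (t [^]\<^bsub>G\<^esub> ?q) \<otimes>\<^bsub>G\<^esub> n)"
      using t(2) power_CHAR_power_inject[OF r] by metis
    moreover have "t [^]\<^bsub>G\<^esub> ?q \<in> tors m"
      using pow_mem_tors[OF tT] m(1) T by simp
    ultimately show ?thesis by blast
  qed
  have cards: "of_nat (card (tors m)) \<noteq> (0 :: 'k)"
    using card_tors[OF r m(2)] by (simp add: of_nat_eq_0_iff_char_dvd)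
  have YI: "Y \<in> Irr" "?wf Y \<chi>" using Y cf by (auto simp: principal_series_def)
  have VI: "V \<in> Irr" "?wf V \<psi>" using V cf by (auto simp: principal_series_def)
  interpret Y: split_BN_module G B N p U Y by (rule modI[OF YI(1)])
  interpret V: split_BN_module G B N p U V by (rule modI[OF VI(1)])
  obtain y where y: "y \<in> carrier Y" "wt_elem m \<chi> \<odot>\<^bsub>Y\<^esub> y \<noteq> \<zero>\<^bsub>Y\<^esub>"
    using Y.wt_elem_nonzero[OF \<chi>c YI(2)[unfolded T] cards] by blast
  obtain v where v: "v \<in> carrier V" "wt_elem m \<psi> \<odot>\<^bsub>V\<^esub> v \<noteq> \<zero>\<^bsub>V\<^esub>"
    using V.wt_elem_nonzero[OF \<psi>c VI(2)[unfolded T] cards] by blast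
  show ?thesis
  \<comment> \<open>The element c is built from \<chi>, which occurs in Y, and d from \<psi>, which
    occurs in V.\<close>
  proof (rule Ext1_trivialI[OF _ _ wt_elem_closed wt_elem_closed _ y v])
    show "irreducible_module (group_algebra G) Y" "irreducible_module (group_algebra G) V"
      using Irr YI(1) VI(1) by (simp_all add: full_set_of_irreducibles_def)
    show "wt_elem m \<psi> \<otimes>\<^bsub>group_algebra G\<^esub> a \<otimes>\<^bsub>group_algebra G\<^esub> wt_elem m \<chi> = \<zero>\<^bsub>group_algebra G\<^esub>"
      if "a \<in> carrier (group_algebra G)" for a
      by (rule wt_elem_orthogonal[OF Y.Y.M.R.ring_axioms \<chi>c \<psi>c sep_tors that])
  qed
qed

theorem corollary4p3:
  fixes p q e r n :: nat
    and GG BB TT :: "'a::alg_closed_field mat set"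
    and F :: "'a mat \<Rightarrow> 'a mat"
    and G :: "'a mat monoid"
    and B N T U :: "'a mat set"
    and Irr :: "('a mat \<Rightarrow> 'k::alg_closed_field, 'k vec) module set"
    and X :: "('a mat \<Rightarrow> 'k, 'x) module"
    and X' :: "('a mat \<Rightarrow> 'k, 'y) module"
    and Y V :: "('a mat \<Rightarrow> 'k, 'k vec) module"
  assumes "prime p" and "e > 0" and "q = p ^ e"
    and "is_closure_of_prime_field p TYPE('a)"
    and "connected_reductive n GG"
    and "steinberg_endomorphism q n GG F"
    and "borel_subgroup n GG BB" and "F ` BB = BB"
    and "maximal_torus n GG TT" and "F ` TT = TT" and "TT \<subseteq> BB"
    and "G = GL n\<lparr>carrier := fixed_points F GG\<rparr>"
    and "B = fixed_points F BB"
    and "N = fixed_points F (normalizer (GL n\<lparr>carrier := GG\<rparr>) TT)"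
    and "split_BN_pair p G B N T U"
    and "CHAR('k) = r" and "r > 0" and "r \<noteq> p"
    and "full_set_of_irreducibles G Irr"
    and "one_dimensional (G\<lparr>carrier := T\<rparr>) X"
    and "one_dimensional (G\<lparr>carrier := T\<rparr>) X'"
    and "principal_series G T U Irr X \<noteq> principal_series G T U Irr X'"
    and "Y \<in> principal_series G T U Irr X"
    and "V \<in> principal_series G T U Irr X'"
  shows "trivial_group (Ext1 (group_algebra G :: ('a mat \<Rightarrow> 'k) ring) Y V)"
proof -
  from assms(15) have BN: "split_BN_pair p G B N T U" .
  have char: "CHAR('k) > 0" "CHAR('k) \<noteq> p" using assms(16-18) by simp_all
  show ?thesis
    by (rule Ext1_distinct_principal_series[OF assms(1) BN char assms(19-24)])
qed

end
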